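(* Let $f:\mathbb S^1\times\mathbb R\to\mathbb R$ be smooth and tame, and assume that $0$ is a regular value of $u\mapsto\int_{\mathbb S^1}D_2f(t,u(t))\,dt$ on $B^1$. Let $F:B^1\to B^0$, $F(u)(t)=u'(t)+f(t,u(t))$. Let $u\in B^1$ and $v=F(u)$, and let $\rho_v$ be the return map of $v$. Then $\rho_v(u(0))=u(0)$. Also, $u\in S_1$ if and only if $\rho_v'(u(0))=1$, and (for $k\ge2$) $u\in S_k$ if and only if $\rho_v'(u(0))=1$ and $\rho_v^{(i)}(u(0))=0$ for $i=2,\dots,k$.
   Context: $\mathbb S^1=\mathbb R/\mathbb Z$. The pair $(B^1,B^0)$ is either $(H^1(\mathbb S^1;\mathbb R),L^2(\mathbb S^1;\mathbb R))$ or $(C^1(\mathbb S^1;\mathbb R),C^0(\mathbb S^1;\mathbb R))$; the result is asserted in both cases. $D_2f$ is the partial derivative in the second variable. $\tilde B^0$ is the space of average-zero functions in $B^0$. $f$ is *wild at $+\infty$* (resp. $-\infty$) if both $\int_I\frac{ds}{\max(1,\sup_t f(t,s))}<\infty$ and $\int_I\frac{ds}{\max(1,\sup_t(-f(t,s)))}<\infty$ for $I=[0,+\infty)$ (resp. $(-\infty,0]$); $f$ is *tame* if wild neither at $+\infty$ nor at $-\infty$. Return map: given $v\in B^0$, $\rho_v:I\to\mathbb R$, $I\subseteq\mathbb R$, sends $y(0)$ to $y(1)$ whenever $y:[0,1]\to\mathbb R$ (not necessarily periodic) solves $y'(t)+f(t,y(t))=v(t)$; $I$ is the set of initial conditions for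 which the solution extends to $t=1$. For tame $f$ the map $\Psi:B^1\to B^0$, $\Psi(u)=F(u)-\int F(u)+\int u$, is a diffeomorphism and $F\circ\Psi^{-1}(\tilde v,\overline u)=(\tilde v,\phi(\tilde v,\overline u))$ on $B^0=\tilde B^0\oplus\mathbb R$, with $\phi$ smooth. $S_k\subset B^1$ is the set of $u$ with $D_2\phi=\dots=D_2^k\phi=0$ at $\Psi(u)$, where $D_2\phi$ is the derivative in the real variable $\overline u$. *)

theory Defs
  imports "HOL-Analysis.Analysis" "HOL-Library.Periodic_Fun"
begin

section \<open>Functions on the circle\<close>

text \<open>Functions on \<open>\<real>/\<int>\<close> are 1-periodic functions on \<open>\<real>\<close>; integrals over the circle are
  integrals over \<open>[0,1]\<close>.\<close>

definition periodic :: "(real \<Rightarrow> 'a) \<Rightarrow> bool" where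
  "periodic g \<longleftrightarrow> (\<forall>t. g (t + 1) = g t)"

lemma periodic_frac:
  assumes "periodic g"
  shows "g t = g (frac t)"
proof -
  interpret periodic_fun_simple' g
    using assms by unfold_locales (simp add: periodic_def)
  show ?thesis
    by (simp add: frac_def minus_of_int)
qed

subsection \<open>Continuous functions with the sup norm\<close>

typedef circle_C0 = "{v :: real \<Rightarrow> real. continuous_on UNIV v \<and> periodic v}"
  by (rule exI[of _ "\<lambda>_. 0"]) (auto simp: periodic_def)

setup_lifting type_definition_circle_C0

lemma Rep_circle_C0_cont: "continuous_on A (Rep_circle_C0 v)"
  and Rep_circle_C0_periodic: "periodic (Rep_circle_C0 v)"
  using Rep_circle_C0[of v] by (auto intro: continuous_on_subset)

lemma bdd_circle_C0: "bdd_above (range (\<lambda>t. \<bar>Rep_circle_C0 v t\<bar>))"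
proof -
  have "compact ((\<lambda>t. \<bar>Rep_circle_C0 v t\<bar>) ` {0..1})"
    by (intro compact_continuous_image continuous_intros Rep_circle_C0_cont compact_Icc)
  then have "bdd_above ((\<lambda>t. \<bar>Rep_circle_C0 v t\<bar>) ` {0..1})"
    by (intro bounded_imp_bdd_above compact_imp_bounded)
  then obtain M where M: "\<And>t. t \<in> {0..1} \<Longrightarrow> \<bar>Rep_circle_C0 v t\<bar> \<le> M"
    unfolding bdd_above_def by blast
  have "\<bar>Rep_circle_C0 v t\<bar> \<le> M" for t
    using M[of "frac t"] periodic_frac[OF Rep_circle_C0_periodic, of v t]
    by (simp add: frac_ge_0 frac_lt_1 less_imp_le)
  then show ?thesis by (auto simp: bdd_above_def)
qed

instantiation circle_C0 :: real_normed_vector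
begin

lift_definition zero_circle_C0 :: circle_C0 is "\<lambda>_. 0" by (simp add: periodic_def)
lift_definition plus_circle_C0 :: "circle_C0 \<Rightarrow> circle_C0 \<Rightarrow> circle_C0"
  is "\<lambda>v w t. v t + w t" by (auto simp: periodic_def intro!: continuous_intros)
lift_definition minus_circle_C0 :: "circle_C0 \<Rightarrow> circle_C0 \<Rightarrow> circle_C0"
  is "\<lambda>v w t. v t - w t" by (auto simp: periodic_def intro!: continuous_intros)
lift_definition uminus_circle_C0 :: "circle_C0 \<Rightarrow> circle_C0"
  is "\<lambda>v t. - v t" by (auto simp: periodic_def intro!: continuous_intros)
lift_definition scaleR_circle_C0 :: "real \<Rightarrow> circle_C0 \<Rightarrow> circle_C0"
  is "\<lambda>r v t. r * v t" by (auto simp: periodic_def intro!: continuous_intros)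
definition norm_circle_C0 :: "circle_C0 \<Rightarrow> real" where
  "norm_circle_C0 v = (SUP t. \<bar>Rep_circle_C0 v t\<bar>)"
definition dist_circle_C0 :: "circle_C0 \<Rightarrow> circle_C0 \<Rightarrow> real" where
  "dist_circle_C0 v w = norm (v - w)"
definition sgn_circle_C0 :: "circle_C0 \<Rightarrow> circle_C0" where
  "sgn_circle_C0 v = inverse (norm v) *\<^sub>R v"
definition uniformity_circle_C0 :: "(circle_C0 \<times> circle_C0) filter" where
  "uniformity_circle_C0 = (INF e\<in>{0<..}. principal {(v, w). dist v w < e})"
definition open_circle_C0 :: "circle_C0 set \<Rightarrow> bool" where
  "open_circle_C0 U \<longleftrightarrow> (\<forall>v\<in>U. \<forall>\<^sub>F (v', w) in uniformity. v' = v \<longrightarrow> w \<in> U)"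

lemma abs_le_norm_circle_C0: "\<bar>Rep_circle_C0 v t\<bar> \<le> norm v"
  unfolding norm_circle_C0_def by (intro cSUP_upper bdd_circle_C0) simp

lemma norm_circle_C0_le: "(\<And>t. \<bar>Rep_circle_C0 v t\<bar> \<le> b) \<Longrightarrow> norm v \<le> b"
  unfolding norm_circle_C0_def by (intro cSUP_least) auto

instance
proof
  fix a b c :: circle_C0 and r s :: real
  show "a + b + c = a + (b + c)" by transfer (simp add: algebra_simps)
  show "a + b = b + a" by transfer (simp add: algebra_simps)
  show "0 + a = a" by transfer simp
  show "- a + a = 0" by transfer simp
  show "a - b = a + - b" by transfer simp
  show "r *\<^sub>R (a + b) = r *\<^sub>R a + r *\<^sub>R b" by transfer (simp add: algebra_simps)
  show "(r + s) *\<^sub>R a = r *\<^sub>R a + s *\<^sub>R a" by transfer (simp add: algebra_simps)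
  show "r *\<^sub>R s *\<^sub>R a = (r * s) *\<^sub>R a" by transfer (simp add: algebra_simps)
  show "1 *\<^sub>R a = a" by transfer simp
  show "dist a b = norm (a - b)" by (rule dist_circle_C0_def)
  show "sgn a = inverse (norm a) *\<^sub>R a" by (rule sgn_circle_C0_def)
  show "uniformity = (INF e\<in>{0<..}. principal {(x, y :: circle_C0). dist x y < e})"
    by (rule uniformity_circle_C0_def)
  show "open U \<longleftrightarrow> (\<forall>x\<in>U. \<forall>\<^sub>F (x', y) in uniformity. x' = x \<longrightarrow> y \<in> U)" for U :: "circle_C0 set"
    by (rule open_circle_C0_def)
  show "norm a = 0 \<longleftrightarrow> a = 0"
  proof
    assume "norm a = 0"
    then have "Rep_circle_C0 a t = 0" for t using abs_le_norm_circle_C0[of a t] by simp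
    then show "a = 0" by (simp add: Rep_circle_C0_inject[symmetric] zero_circle_C0.rep_eq fun_eq_iff)
  qed (simp add: norm_circle_C0_def zero_circle_C0.rep_eq)
  show "norm (a + b) \<le> norm a + norm b"
  proof (rule norm_circle_C0_le)
    fix t
    show "\<bar>Rep_circle_C0 (a + b) t\<bar> \<le> norm a + norm b"
      using abs_le_norm_circle_C0[of a t] abs_le_norm_circle_C0[of b t]
      by (simp add: plus_circle_C0.rep_eq)
  qed
  have le: "norm (r *\<^sub>R a) \<le> \<bar>r\<bar> * norm a" for r and a :: circle_C0
    by (rule norm_circle_C0_le)
       (simp add: scaleR_circle_C0.rep_eq abs_mult mult_left_mono abs_le_norm_circle_C0)
  show "norm (r *\<^sub>R a) = \<bar>r\<bar> * norm a"
  proof (cases "r = 0")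
    case True
    then show ?thesis
      by (simp add: norm_circle_C0_def scaleR_circle_C0.rep_eq)
  next
    case False
    have "(1 / r) *\<^sub>R (r *\<^sub>R a) = a" using False by transfer (simp add: field_simps)
    then have "norm a \<le> \<bar>1 / r\<bar> * norm (r *\<^sub>R a)" using le[of "1 / r" "r *\<^sub>R a"] by simp
    then have "\<bar>r\<bar> * norm a \<le> norm (r *\<^sub>R a)" using False by (simp add: field_simps)
    with le[of r a] show ?thesis by simp
  qed
qed

end

subsection \<open>Continuously differentiable functions with the norm \<open>sup \<bar>u\<bar> + sup \<bar>u'\<bar>\<close>\<close>

typedef circle_C1 = "{u :: real \<Rightarrow> real. u C1_differentiable_on UNIV \<and> periodic u}"
  by (rule exI[of _ "\<lambda>_. 0"]) (auto simp: periodic_def)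

setup_lifting type_definition_circle_C1

lemma C1_realD:
  assumes "u C1_differentiable_on UNIV"
  shows "(u has_real_derivative deriv u t) (at t)" "continuous_on UNIV (deriv u)"
    "continuous_on UNIV u"
proof -
  obtain D where D: "\<And>t. (u has_real_derivative D t) (at t)" "continuous_on UNIV D"
    using assms by (auto simp: C1_differentiable_on_def has_real_derivative_iff_has_vector_derivative)
  have "deriv u = D" using D(1) by (auto intro: DERIV_imp_deriv)
  with D show "(u has_real_derivative deriv u t) (at t)" "continuous_on UNIV (deriv u)" by auto
  show "continuous_on UNIV u"
    using D(1) by (intro continuous_at_imp_continuous_on ballI DERIV_isCont)
qed

lemma periodic_deriv:
  assumes "periodic u"
  shows "periodic (deriv u)"
  unfolding periodic_def deriv_def
proof
  fix t
  have "(u has_real_derivative D) (at (t + 1)) \<longleftrightarrow> (u has_real_derivative D) (at t)" for D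
    using DERIV_shift[of u D t 1] assms by (simp add: periodic_def)
  then show "(SOME D. (u has_real_derivative D) (at (t + 1))) = (SOME D. (u has_real_derivative D) (at t))"
    by simp
qed

lift_definition C1_to_C0 :: "circle_C1 \<Rightarrow> circle_C0" is "\<lambda>u. u"
  by (auto dest: C1_realD)

lift_definition deriv_C1 :: "circle_C1 \<Rightarrow> circle_C0" is deriv
  by (auto dest: C1_realD periodic_deriv)

instantiation circle_C1 :: real_normed_vector
begin

lift_definition zero_circle_C1 :: circle_C1 is "\<lambda>_. 0" by (simp add: periodic_def)
lift_definition plus_circle_C1 :: "circle_C1 \<Rightarrow> circle_C1 \<Rightarrow> circle_C1"
  is "\<lambda>v w t. v t + w t" by (auto simp: periodic_def)
lift_definition minus_circle_C1 :: "circle_C1 \<Rightarrow> circle_C1 \<Rightarrow> circle_C1"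
  is "\<lambda>v w t. v t - w t" by (auto simp: periodic_def)
lift_definition uminus_circle_C1 :: "circle_C1 \<Rightarrow> circle_C1"
  is "\<lambda>v t. - v t" by (auto simp: periodic_def)
lift_definition scaleR_circle_C1 :: "real \<Rightarrow> circle_C1 \<Rightarrow> circle_C1"
  is "\<lambda>r v t. r * v t" by (auto simp: periodic_def)
definition norm_circle_C1 :: "circle_C1 \<Rightarrow> real" where
  "norm_circle_C1 u = norm (C1_to_C0 u) + norm (deriv_C1 u)"
definition dist_circle_C1 :: "circle_C1 \<Rightarrow> circle_C1 \<Rightarrow> real" where
  "dist_circle_C1 v w = norm (v - w)"
definition sgn_circle_C1 :: "circle_C1 \<Rightarrow> circle_C1" where
  "sgn_circle_C1 v = inverse (norm v) *\<^sub>R v"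
definition uniformity_circle_C1 :: "(circle_C1 \<times> circle_C1) filter" where
  "uniformity_circle_C1 = (INF e\<in>{0<..}. principal {(v, w). dist v w < e})"
definition open_circle_C1 :: "circle_C1 set \<Rightarrow> bool" where
  "open_circle_C1 U \<longleftrightarrow> (\<forall>v\<in>U. \<forall>\<^sub>F (v', w) in uniformity. v' = v \<longrightarrow> w \<in> U)"

lemma C1_to_C0_add: "C1_to_C0 (a + b) = C1_to_C0 a + C1_to_C0 b"
  by transfer simp
lemma C1_to_C0_scaleR: "C1_to_C0 (r *\<^sub>R a) = r *\<^sub>R C1_to_C0 a"
  by transfer simp
lemma C1_to_C0_eq_0: "C1_to_C0 a = 0 \<longleftrightarrow> a = 0"
  by transfer simp
lemma deriv_C1_add: "deriv_C1 (a + b) = deriv_C1 a + deriv_C1 b"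
  by transfer (auto intro!: DERIV_imp_deriv DERIV_add C1_realD)
lemma deriv_C1_scaleR: "deriv_C1 (r *\<^sub>R a) = r *\<^sub>R deriv_C1 a"
  by transfer (auto intro!: DERIV_imp_deriv DERIV_cmult C1_realD)

instance
proof
  fix a b c :: circle_C1 and r s :: real
  show "a + b + c = a + (b + c)" by transfer (simp add: algebra_simps)
  show "a + b = b + a" by transfer (simp add: algebra_simps)
  show "0 + a = a" by transfer simp
  show "- a + a = 0" by transfer simp
  show "a - b = a + - b" by transfer simp
  show "r *\<^sub>R (a + b) = r *\<^sub>R a + r *\<^sub>R b" by transfer (simp add: algebra_simps)
  show "(r + s) *\<^sub>R a = r *\<^sub>R a + s *\<^sub>R a" by transfer (simp add: algebra_simps)
  show "r *\<^sub>R s *\<^sub>R a = (r * s) *\<^sub>R a" by transfer (simp add: algebra_simps)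
  show "1 *\<^sub>R a = a" by transfer simp
  show "dist a b = norm (a - b)" by (rule dist_circle_C1_def)
  show "sgn a = inverse (norm a) *\<^sub>R a" by (rule sgn_circle_C1_def)
  show "uniformity = (INF e\<in>{0<..}. principal {(x, y :: circle_C1). dist x y < e})"
    by (rule uniformity_circle_C1_def)
  show "open U \<longleftrightarrow> (\<forall>x\<in>U. \<forall>\<^sub>F (x', y) in uniformity. x' = x \<longrightarrow> y \<in> U)" for U :: "circle_C1 set"
    by (rule open_circle_C1_def)
  have D0: "deriv_C1 0 = 0" by transfer simp
  show "norm a = 0 \<longleftrightarrow> a = 0"
    using D0 by (auto simp: norm_circle_C1_def add_nonneg_eq_0_iff C1_to_C0_eq_0)
  show "norm (a + b) \<le> norm a + norm b"
    using norm_triangle_ineq[of "C1_to_C0 a" "C1_to_C0 b"] norm_triangle_ineq[of "deriv_C1 a" "deriv_C1 b"]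
    by (simp add: norm_circle_C1_def C1_to_C0_add deriv_C1_add)
  show "norm (r *\<^sub>R a) = \<bar>r\<bar> * norm a"
    by (simp add: norm_circle_C1_def C1_to_C0_scaleR deriv_C1_scaleR algebra_simps)
qed

end

subsection \<open>Square-integrable functions modulo equality almost everywhere\<close>

definition square_integrable :: "(real \<Rightarrow> real) \<Rightarrow> bool" where
  "square_integrable v \<longleftrightarrow> v \<in> borel_measurable borel \<and> periodic v \<and>
     set_integrable lborel {0..1} (\<lambda>t. (v t)\<^sup>2)"

definition L2_eq :: "(real \<Rightarrow> real) \<Rightarrow> (real \<Rightarrow> real) \<Rightarrow> bool" where
  "L2_eq v w \<longleftrightarrow> square_integrable v \<and> square_integrable w \<and> (AE t\<in>{0..1} in lborel. v t = w t)"

quotient_type circle_L2 = "real \<Rightarrow> real" / partial: L2_eq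
proof (rule part_equivpI)
  show "\<exists>x. L2_eq x x"
    by (rule exI[of _ "\<lambda>_. 0"]) (simp add: L2_eq_def square_integrable_def periodic_def set_integrable_def)
  show "symp L2_eq" by (auto simp: symp_def L2_eq_def)
  show "transp L2_eq" by (auto simp: transp_def L2_eq_def)
qed

lemma square_integrable_mult:
  assumes "square_integrable v" "square_integrable w"
  shows "set_integrable lborel {0..1} (\<lambda>t. v t * w t)"
  unfolding set_integrable_def
proof (rule Bochner_Integration.integrable_bound)
  show "integrable lborel (\<lambda>t. indicator {0..1} t *\<^sub>R (v t)\<^sup>2 + indicator {0..1} t *\<^sub>R (w t)\<^sup>2)"
    using assms by (intro Bochner_Integration.integrable_add) (auto simp: square_integrable_def set_integrable_def)
  show "(\<lambda>t. indicator {0..1} t *\<^sub>R (v t * w t)) \<in> borel_measurable lborel"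
    using assms by (auto simp: square_integrable_def)
  have "\<bar>x * y\<bar> \<le> x\<^sup>2 + y\<^sup>2" for x y :: real
  proof -
    have "0 \<le> \<bar>x\<bar> * \<bar>y\<bar>" by simp
    with sum_squares_bound[of "\<bar>x\<bar>" "\<bar>y\<bar>"] show ?thesis
      unfolding abs_mult power2_abs by linarith
  qed
  then show "AE t in lborel. norm (indicator {0..1} t *\<^sub>R (v t * w t))
      \<le> norm (indicator {0..1} t *\<^sub>R (v t)\<^sup>2 + indicator {0..1} t *\<^sub>R (w t)\<^sup>2)"
    by (auto simp: indicator_def)
qed

lemma square_integrable_add:
  assumes "square_integrable v" "square_integrable w"
  shows "square_integrable (\<lambda>t. v t + w t)"
proof -
  have "set_integrable lborel {0..1} (\<lambda>t. (v t)\<^sup>2 + (w t)\<^sup>2 + 2 * (v t * w t))"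
    using assms square_integrable_mult[OF assms]
    by (intro set_integral_add set_integrable_mult_right) (auto simp: square_integrable_def)
  then have "set_integrable lborel {0..1} (\<lambda>t. (v t + w t)\<^sup>2)"
    by (simp add: power2_sum mult.assoc)
  with assms show ?thesis by (auto simp: square_integrable_def periodic_def)
qed

lemma square_integrable_cmult:
  assumes "square_integrable v"
  shows "square_integrable (\<lambda>t. r * v t)"
proof -
  have "set_integrable lborel {0..1} (\<lambda>t. (r * v t)\<^sup>2)"
    using assms unfolding power_mult_distrib
    by (intro set_integrable_mult_right) (auto simp: square_integrable_def)
  with assms show ?thesis by (auto simp: square_integrable_def periodic_def)
qed

lemma square_integrable_continuous:
  assumes "continuous_on UNIV v" "periodic v"
  shows "square_integrable v"
  using assms unfolding square_integrable_def
  by (auto intro!: borel_measurable_continuous_onI borel_integrable_atLeastAtMost' continuous_intros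
      intro: continuous_on_subset)

lemma square_integrable_imp_integrable:
  assumes "square_integrable v"
  shows "set_integrable lborel {0..1} v"
  using square_integrable_mult[OF assms square_integrable_continuous[of "\<lambda>_. 1"]]
  by (simp add: periodic_def)

instantiation circle_L2 :: real_inner
begin

lift_definition zero_circle_L2 :: circle_L2 is "\<lambda>_. 0"
  by (auto simp: L2_eq_def periodic_def intro!: square_integrable_continuous)
lift_definition plus_circle_L2 :: "circle_L2 \<Rightarrow> circle_L2 \<Rightarrow> circle_L2" is "\<lambda>v w t. v t + w t"
  by (auto simp: L2_eq_def intro: square_integrable_add)
lift_definition scaleR_circle_L2 :: "real \<Rightarrow> circle_L2 \<Rightarrow> circle_L2" is "\<lambda>r v t. r * v t"
  by (auto simp: L2_eq_def intro: square_integrable_cmult)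
definition uminus_circle_L2 :: "circle_L2 \<Rightarrow> circle_L2" where
  "uminus_circle_L2 v = (-1) *\<^sub>R v"
definition minus_circle_L2 :: "circle_L2 \<Rightarrow> circle_L2 \<Rightarrow> circle_L2" where
  "minus_circle_L2 v w = v + - w"
lift_definition inner_circle_L2 :: "circle_L2 \<Rightarrow> circle_L2 \<Rightarrow> real"
  is "\<lambda>v w. \<integral>t\<in>{0..1}. v t * w t \<partial>lborel"
  unfolding set_lebesgue_integral_def
  by (intro integral_cong_AE) (auto simp: L2_eq_def square_integrable_def indicator_def)
definition norm_circle_L2 :: "circle_L2 \<Rightarrow> real" where
  "norm_circle_L2 v = sqrt (inner v v)"
definition dist_circle_L2 :: "circle_L2 \<Rightarrow> circle_L2 \<Rightarrow> real" where
  "dist_circle_L2 v w = norm (v - w)"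
definition sgn_circle_L2 :: "circle_L2 \<Rightarrow> circle_L2" where
  "sgn_circle_L2 v = inverse (norm v) *\<^sub>R v"
definition uniformity_circle_L2 :: "(circle_L2 \<times> circle_L2) filter" where
  "uniformity_circle_L2 = (INF e\<in>{0<..}. principal {(v, w). dist v w < e})"
definition open_circle_L2 :: "circle_L2 set \<Rightarrow> bool" where
  "open_circle_L2 U \<longleftrightarrow> (\<forall>v\<in>U. \<forall>\<^sub>F (v', w) in uniformity. v' = v \<longrightarrow> w \<in> U)"

instance
proof
  fix a b c :: circle_L2 and r s :: real
  note si = square_integrable_add square_integrable_cmult
  show "a + b + c = a + (b + c)" by transfer (auto simp: L2_eq_def algebra_simps intro!: si)
  show "a + b = b + a" by transfer (auto simp: L2_eq_def algebra_simps intro!: si)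
  show "0 + a = a" by transfer (auto simp: L2_eq_def intro!: si)
  show "- a + a = 0" unfolding uminus_circle_L2_def
    by transfer (auto simp: L2_eq_def periodic_def intro!: si square_integrable_continuous)
  show "a - b = a + - b" by (rule minus_circle_L2_def)
  show "r *\<^sub>R (a + b) = r *\<^sub>R a + r *\<^sub>R b" by transfer (auto simp: L2_eq_def algebra_simps intro!: si)
  show "(r + s) *\<^sub>R a = r *\<^sub>R a + s *\<^sub>R a" by transfer (auto simp: L2_eq_def algebra_simps intro!: si)
  show "r *\<^sub>R s *\<^sub>R a = (r * s) *\<^sub>R a" by transfer (auto simp: L2_eq_def algebra_simps intro!: si)
  show "1 *\<^sub>R a = a" by transfer (auto simp: L2_eq_def)
  show "dist a b = norm (a - b)" by (rule dist_circle_L2_def)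
  show "sgn a = inverse (norm a) *\<^sub>R a" by (rule sgn_circle_L2_def)
  show "uniformity = (INF e\<in>{0<..}. principal {(x, y :: circle_L2). dist x y < e})"
    by (rule uniformity_circle_L2_def)
  show "open U \<longleftrightarrow> (\<forall>x\<in>U. \<forall>\<^sub>F (x', y) in uniformity. x' = x \<longrightarrow> y \<in> U)" for U :: "circle_L2 set"
    by (rule open_circle_L2_def)
  show "inner a b = inner b a" by transfer (simp add: mult.commute)
  show "inner (a + b) c = inner a c + inner b c"
    by transfer (simp add: distrib_right L2_eq_def square_integrable_mult set_integral_add(2))
  show "inner (r *\<^sub>R a) b = r * inner a b"
    by transfer (simp add: mult.assoc)
  show "0 \<le> inner a a"
    by transfer (auto simp: set_lebesgue_integral_def indicator_def intro!: Bochner_Integration.integral_nonneg)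
  show "inner a a = 0 \<longleftrightarrow> a = 0"
  proof transfer
    fix v assume "L2_eq v v"
    then have v: "square_integrable v" by (simp add: L2_eq_def)
    have z: "square_integrable (\<lambda>_. 0)"
      by (rule square_integrable_continuous) (auto simp: periodic_def)
    have "(\<integral>t\<in>{0..1}. v t * v t \<partial>lborel) = 0 \<longleftrightarrow>
        (AE t in lborel. indicator {0..1} t *\<^sub>R (v t * v t) = 0)"
      unfolding set_lebesgue_integral_def
      using square_integrable_mult[OF v v] unfolding set_integrable_def
      by (intro integral_nonneg_eq_0_iff_AE) (auto simp: indicator_def)
    also have "\<dots> \<longleftrightarrow> (AE t\<in>{0..1} in lborel. v t = 0)"
      by (intro AE_cong) (auto simp: indicator_def)
    finally show "(\<integral>t\<in>{0..1}. v t * v t \<partial>lborel) = 0 \<longleftrightarrow> L2_eq v (\<lambda>_. 0)"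
      using v z by (simp add: L2_eq_def)
  qed
  show "norm a = sqrt (inner a a)" by (rule norm_circle_L2_def)
qed

end

lemma square_integrable_rep: "square_integrable (rep_circle_L2 w)"
  using Quotient3_rep_reflp[OF Quotient3_circle_L2] by (auto simp: L2_eq_def)

lemma rep_abs_L2:
  assumes "square_integrable v"
  shows "AE t\<in>{0..1} in lborel. rep_circle_L2 (abs_circle_L2 v) t = v t"
  using rep_abs_rsp_left[OF Quotient3_circle_L2, of v v] assms by (auto simp: L2_eq_def)

lemma circle_L2_eqI:
  assumes "AE t\<in>{0..1} in lborel. rep_circle_L2 v t = rep_circle_L2 w t"
  shows "v = w"
  using Quotient3_rel_rep[OF Quotient3_circle_L2, of v w] assms square_integrable_rep
  by (auto simp: L2_eq_def)

subsection \<open>The Sobolev space \<open>H\<^sup>1\<close>\<close>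

text \<open>Weak derivatives on \<open>[0,1]\<close>, in the form appropriate to dimension one: \<open>y\<close> is the continuous
  (absolutely continuous) representative and \<open>g\<close>, which matters only up to a null set, is its
  derivative.\<close>

definition has_weak_deriv :: "(real \<Rightarrow> real) \<Rightarrow> (real \<Rightarrow> real) \<Rightarrow> bool" where
  "has_weak_deriv y g \<longleftrightarrow> set_integrable lborel {0..1} g \<and>
     (\<forall>t\<in>{0..1}. y t = y 0 + (\<integral>s\<in>{0..t}. g s \<partial>lborel))"

lemma has_weak_derivI:
  assumes "set_integrable lborel {0..1} g"
    and "\<And>t. t \<in> {0..1} \<Longrightarrow> y t = y 0 + (\<integral>s\<in>{0..t}. g s \<partial>lborel)"
  shows "has_weak_deriv y g"
  using assms unfolding has_weak_deriv_def by blast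

lemma has_weak_derivD:
  assumes "has_weak_deriv y g"
  shows "set_integrable lborel {0..1} g"
    and "t \<in> {0..1} \<Longrightarrow> y t = y 0 + (\<integral>s\<in>{0..t}. g s \<partial>lborel)"
  using assms unfolding has_weak_deriv_def by blast+

text \<open>Elements of \<open>H\<^sup>1\<close> are represented by their continuous representatives.\<close>

typedef circle_H1 = "{u :: real \<Rightarrow> real. periodic u \<and> (\<exists>w. has_weak_deriv u (rep_circle_L2 w))}"
proof -
  have "set_integrable lborel {0..1} (rep_circle_L2 0)"
    by (intro square_integrable_imp_integrable square_integrable_rep)
  moreover have "AE s in lborel. s \<in> {0..1} \<longrightarrow> rep_circle_L2 0 s = 0"
    unfolding zero_circle_L2_def
    using rep_abs_L2[of "\<lambda>_. 0"] square_integrable_continuous[of "\<lambda>_. 0"] by (simp add: periodic_def)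
  then have "(\<integral>s\<in>{0..t}. rep_circle_L2 0 s \<partial>lborel) = 0" if "t \<in> {0..1}" for t
    unfolding set_lebesgue_integral_def using that
    by (intro integral_eq_zero_AE) (auto simp: indicator_def elim!: eventually_mono)
  ultimately have "has_weak_deriv (\<lambda>_. 0) (rep_circle_L2 0)"
    by (intro has_weak_derivI) simp_all
  then show ?thesis
    by (intro exI[of _ "\<lambda>_. 0"]) (auto simp: periodic_def)
qed

setup_lifting type_definition_circle_H1

definition deriv_H1 :: "circle_H1 \<Rightarrow> circle_L2" where
  "deriv_H1 u = (THE w. has_weak_deriv (Rep_circle_H1 u) (rep_circle_L2 w))"

definition H1_to_L2 :: "circle_H1 \<Rightarrow> circle_L2" where
  "H1_to_L2 u = abs_circle_L2 (Rep_circle_H1 u)"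

lemma integral_initial_eq_0_imp_AE:
  fixes k :: "real \<Rightarrow> real"
  assumes k: "integrable lborel k" and 0: "\<And>t. (\<integral>s\<in>{..t}. k s \<partial>lborel) = 0"
  shows "AE t in lborel. k t = 0"
proof (rule sigma_finite_measure.density_zero[OF sigma_finite_lborel k])
  fix A :: "real set" assume "A \<in> sets lborel"
  have si: "set_integrable lborel B k" if "B \<in> sets borel" for B
    unfolding set_integrable_def using k that by (intro integrable_mult_indicator) auto
  have total: "(\<integral>s\<in>UNIV. k s \<partial>lborel) = 0"
  proof -
    have "(\<lambda>n::nat. \<integral>s\<in>{..real n}. k s \<partial>lborel) \<longlonglongrightarrow> (\<integral>s\<in>(\<Union>n::nat. {..real n}). k s \<partial>lborel)"
      by (intro set_integral_cont_up si) (auto simp: incseq_def)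
    moreover have "(\<Union>n::nat. {..real n}) = UNIV"
      using real_arch_simple by auto
    ultimately show ?thesis using 0 by (simp add: LIMSEQ_const_iff)
  qed
  have A: "A \<in> sigma_sets UNIV (range (\<lambda>a :: real. {..a}))"
    using \<open>A \<in> sets lborel\<close> by (simp add: borel_eq_atMost)
  have G: "Int_stable (range (\<lambda>a :: real. {..a}))" "range (\<lambda>a :: real. {..a}) \<subseteq> Pow UNIV"
    by (auto simp: Int_stable_def)
  show "(\<integral>s\<in>A. k s \<partial>lborel) = 0"
    using G A
  proof (induction rule: sigma_sets_induct_disjoint)
    case (basic B)
    then show ?case using 0 by auto
  next
    case empty
    then show ?case by (simp add: set_lebesgue_integral_def)
  next
    case (compl B)
    then have B: "B \<in> sets borel" by (simp add: borel_eq_atMost)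
    have "(\<integral>s\<in>(UNIV - B) \<union> B. k s \<partial>lborel) = (\<integral>s\<in>UNIV - B. k s \<partial>lborel) + (\<integral>s\<in>B. k s \<partial>lborel)"
      using B by (intro set_integral_Un si) auto
    then show ?case using compl total by (simp add: Un_absorb2)
  next
    case (union B)
    then have B: "B i \<in> sets borel" for i by (auto simp: borel_eq_atMost)
    have "(\<integral>s\<in>(\<Union>i. B i). k s \<partial>lborel) = (\<Sum>i. \<integral>s\<in>B i. k s \<partial>lborel)"
      using B union by (intro lebesgue_integral_countable_add si) (auto simp: disjoint_family_on_def)
    then show ?case using union by simp
  qed
qed

lemma has_weak_deriv_unique:
  assumes "has_weak_deriv y g" "has_weak_deriv y h"
  shows "AE t\<in>{0..1} in lborel. g t = h t"
proof -
  let ?k = "\<lambda>t. indicator {0..1} t *\<^sub>R (g t - h t)"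
  have sg: "set_integrable lborel {0..1} g" "set_integrable lborel {0..1} h"
    using assms by (blast dest: has_weak_derivD(1))+
  have "AE t in lborel. ?k t = 0"
  proof (rule integral_initial_eq_0_imp_AE)
    show "integrable lborel ?k"
      using set_integral_diff(1)[OF sg] by (simp add: set_integrable_def)
    fix t :: real
    show "(\<integral>s\<in>{..t}. ?k s \<partial>lborel) = 0"
    proof (cases "t < 0")
      case True
      then have "(\<integral>s\<in>{..t}. ?k s \<partial>lborel) = (\<integral>s. 0 \<partial>(lborel :: real measure))"
        unfolding set_lebesgue_integral_def
        by (intro Bochner_Integration.integral_cong) (auto simp: indicator_def)
      then show ?thesis by simp
    next
      case False
      define t' where "t' = min t 1"
      have t': "t' \<in> {0..1}" using False by (auto simp: t'_def)
      have "(\<integral>s\<in>{..t}. ?k s \<partial>lborel) = (\<integral>s\<in>{0..t'}. g s - h s \<partial>lborel)"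
        unfolding set_lebesgue_integral_def using t'
        by (intro Bochner_Integration.integral_cong) (auto simp: indicator_def t'_def)
      also have "\<dots> = (\<integral>s\<in>{0..t'}. g s \<partial>lborel) - (\<integral>s\<in>{0..t'}. h s \<partial>lborel)"
        using t' by (intro set_integral_diff(2) set_integrable_subset[OF sg(1)] set_integrable_subset[OF sg(2)]) auto
      also have "\<dots> = 0"
        using has_weak_derivD(2)[OF assms(1) t'] has_weak_derivD(2)[OF assms(2) t'] by linarith
      finally show ?thesis .
    qed
  qed
  then show ?thesis by (rule eventually_mono) (auto simp: indicator_def)
qed

lemma has_weak_deriv_cong_AE:
  assumes "has_weak_deriv y g" "set_integrable lborel {0..1} h"
    and ae: "AE t\<in>{0..1} in lborel. g t = h t"
  shows "has_weak_deriv y h"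
proof -
  have sg: "set_integrable lborel {0..1} g" using assms(1) by (rule has_weak_derivD(1))
  have "(\<integral>s\<in>{0..t}. g s \<partial>lborel) = (\<integral>s\<in>{0..t}. h s \<partial>lborel)" if "t \<in> {0..1}" for t
  proof -
    have "set_integrable lborel {0..t} g" "set_integrable lborel {0..t} h"
      using that by (auto intro!: set_integrable_subset[OF sg] set_integrable_subset[OF assms(2)])
    then show ?thesis
      unfolding set_lebesgue_integral_def set_integrable_def
    proof (intro integral_cong_AE borel_measurable_integrable)
      show "AE s in lborel. indicator {0..t} s *\<^sub>R g s = indicator {0..t} s *\<^sub>R h s"
        using ae by (rule eventually_mono) (use that in \<open>auto simp: indicator_def\<close>)
    qed
  qed
  with has_weak_derivD(2)[OF assms(1)] assms(2) show ?thesis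
    by (intro has_weak_derivI) metis+
qed

lemma has_weak_deriv_add:
  assumes "has_weak_deriv y g" "has_weak_deriv z h"
  shows "has_weak_deriv (\<lambda>t. y t + z t) (\<lambda>t. g t + h t)"
proof -
  have sg: "set_integrable lborel {0..1} g" "set_integrable lborel {0..1} h"
    using assms by (blast dest: has_weak_derivD(1))+
  have "(\<integral>s\<in>{0..t}. g s + h s \<partial>lborel) = (\<integral>s\<in>{0..t}. g s \<partial>lborel) + (\<integral>s\<in>{0..t}. h s \<partial>lborel)"
    if "t \<in> {0..1}" for t
    using that by (intro set_integral_add(2) set_integrable_subset[OF sg(1)] set_integrable_subset[OF sg(2)]) auto
  note int = this
  show ?thesis
  proof (rule has_weak_derivI[OF set_integral_add(1)[OF sg]])
    fix t :: real assume t: "t \<in> {0..1}"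
    show "y t + z t = y 0 + z 0 + (\<integral>s\<in>{0..t}. g s + h s \<partial>lborel)"
      using has_weak_derivD(2)[OF assms(1) t] has_weak_derivD(2)[OF assms(2) t] int[OF t] by linarith
  qed
qed

lemma has_weak_deriv_cmult:
  assumes "has_weak_deriv y g"
  shows "has_weak_deriv (\<lambda>t. r * y t) (\<lambda>t. r * g t)"
proof (rule has_weak_derivI)
  show "set_integrable lborel {0..1} (\<lambda>t. r * g t)"
    using has_weak_derivD(1)[OF assms] by simp
  fix t :: real assume "t \<in> {0..1}"
  from has_weak_derivD(2)[OF assms this]
  have "r * y t = r * (y 0 + (\<integral>s\<in>{0..t}. g s \<partial>lborel))" by (rule arg_cong)
  then show "r * y t = r * y 0 + (\<integral>s\<in>{0..t}. r * g s \<partial>lborel)"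
    by (simp only: distrib_left set_integral_mult_right)
qed

lemma has_weak_deriv_abs_L2:
  assumes "has_weak_deriv y g" "square_integrable g"
  shows "has_weak_deriv y (rep_circle_L2 (abs_circle_L2 g))"
proof (rule has_weak_deriv_cong_AE[OF assms(1)])
  show "set_integrable lborel {0..1} (rep_circle_L2 (abs_circle_L2 g))"
    by (rule square_integrable_imp_integrable[OF square_integrable_rep])
  show "AE t\<in>{0..1} in lborel. g t = rep_circle_L2 (abs_circle_L2 g) t"
    using rep_abs_L2[OF assms(2)] by (rule eventually_mono) simp
qed

lemma plus_L2_abs:
  "v + w = abs_circle_L2 (\<lambda>t. rep_circle_L2 v t + rep_circle_L2 w t)"
  by (simp add: plus_circle_L2_def map_fun_def)

lemma scaleR_L2_abs:
  "r *\<^sub>R v = abs_circle_L2 (\<lambda>t. r * rep_circle_L2 v t)"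
  by (simp add: scaleR_circle_L2_def map_fun_def)

lemma has_weak_deriv_plus_L2:
  assumes "has_weak_deriv y (rep_circle_L2 v)" "has_weak_deriv z (rep_circle_L2 w)"
  shows "has_weak_deriv (\<lambda>t. y t + z t) (rep_circle_L2 (v + w))"
  unfolding plus_L2_abs using assms
  by (rule has_weak_deriv_abs_L2[OF has_weak_deriv_add square_integrable_add[OF square_integrable_rep square_integrable_rep]])

lemma has_weak_deriv_scaleR_L2:
  assumes "has_weak_deriv y (rep_circle_L2 v)"
  shows "has_weak_deriv (\<lambda>t. r * y t) (rep_circle_L2 (r *\<^sub>R v))"
  unfolding scaleR_L2_abs using assms
  by (rule has_weak_deriv_abs_L2[OF has_weak_deriv_cmult square_integrable_cmult[OF square_integrable_rep]])

lemma deriv_H1_eqI: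
  assumes "has_weak_deriv (Rep_circle_H1 u) (rep_circle_L2 w)"
  shows "deriv_H1 u = w"
  unfolding deriv_H1_def
proof (rule the_equality)
  show "has_weak_deriv (Rep_circle_H1 u) (rep_circle_L2 w)" by (rule assms)
next
  fix w' assume "has_weak_deriv (Rep_circle_H1 u) (rep_circle_L2 w')"
  from has_weak_deriv_unique[OF this assms] show "w' = w" by (rule circle_L2_eqI)
qed

lemma has_weak_deriv_H1: "has_weak_deriv (Rep_circle_H1 u) (rep_circle_L2 (deriv_H1 u))"
  using Rep_circle_H1[of u] deriv_H1_eqI by auto

lemma Rep_circle_H1_periodic: "periodic (Rep_circle_H1 u)"
  using Rep_circle_H1[of u] by auto

lemma has_weak_deriv_continuous:
  assumes "has_weak_deriv y g"
  shows "continuous_on {0..1} y"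
proof -
  have sg: "set_integrable lborel {0..1} g" using assms(1) by (rule has_weak_derivD(1))
  then have ab: "g absolutely_integrable_on {0..1}"
    unfolding set_integrable_def by (simp add: integrable_completion borel_measurable_integrable)
  have "continuous_on {0..1} (\<lambda>t. y 0 + integral {0..t} g)"
    by (intro continuous_intros indefinite_integral_continuous_1 set_lebesgue_integral_eq_integral(1)[OF ab])
  moreover have "y t = y 0 + integral {0..t} g" if "t \<in> {0..1}" for t
  proof -
    have "set_integrable lborel {0..t} g" using that by (intro set_integrable_subset[OF sg]) auto
    then have "(\<integral>s\<in>{0..t}. g s \<partial>lborel) = integral {0..t} g"
      by (rule set_borel_integral_eq_integral(2))
    with has_weak_derivD(2)[OF assms that] show ?thesis by metis
  qed
  ultimately show ?thesis
    using continuous_on_eq[of "{0..1}" "\<lambda>t. y 0 + integral {0..t} g" y] by metis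
qed

lemma square_integrable_H1: "square_integrable (Rep_circle_H1 u)"
proof -
  let ?u = "Rep_circle_H1 u"
  have c: "continuous_on {0..1} ?u"
    by (rule has_weak_deriv_continuous[OF has_weak_deriv_H1])
  then have "(\<lambda>s. indicator {0..1} s *\<^sub>R ?u s) \<in> borel_measurable borel"
    by (intro borel_measurable_continuous_on_indicator) auto
  moreover have "frac \<in> borel_measurable (borel :: real measure)"
    unfolding frac_def by measurable
  ultimately have "(\<lambda>t. indicator {0..1} (frac t) *\<^sub>R ?u (frac t)) \<in> borel_measurable borel"
    by (rule measurable_compose[rotated])
  moreover have "indicator {0..1} (frac t) *\<^sub>R ?u (frac t) = ?u t" for t
    using periodic_frac[OF Rep_circle_H1_periodic, of u t] frac_ge_0[of t] frac_lt_1[of t]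
    by (simp add: indicator_def)
  ultimately have "?u \<in> borel_measurable borel" by simp
  moreover have "set_integrable lborel {0..1} (\<lambda>t. (?u t)\<^sup>2)"
    by (intro borel_integrable_atLeastAtMost' continuous_intros c)
  ultimately show ?thesis
    by (simp add: square_integrable_def Rep_circle_H1_periodic)
qed

instantiation circle_H1 :: real_inner
begin

lift_definition zero_circle_H1 :: circle_H1 is "\<lambda>_. 0"
  using has_weak_deriv_scaleR_L2[where r = 0, OF has_weak_deriv_H1] by (auto simp: periodic_def)
lift_definition plus_circle_H1 :: "circle_H1 \<Rightarrow> circle_H1 \<Rightarrow> circle_H1" is "\<lambda>v w t. v t + w t"
  by (auto simp: periodic_def intro: has_weak_deriv_plus_L2)
lift_definition scaleR_circle_H1 :: "real \<Rightarrow> circle_H1 \<Rightarrow> circle_H1" is "\<lambda>r v t. r * v t"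
  by (auto simp: periodic_def intro: has_weak_deriv_scaleR_L2)
definition uminus_circle_H1 :: "circle_H1 \<Rightarrow> circle_H1" where
  "uminus_circle_H1 v = (-1) *\<^sub>R v"
definition minus_circle_H1 :: "circle_H1 \<Rightarrow> circle_H1 \<Rightarrow> circle_H1" where
  "minus_circle_H1 v w = v + - w"
definition inner_circle_H1 :: "circle_H1 \<Rightarrow> circle_H1 \<Rightarrow> real" where
  "inner_circle_H1 v w = inner (H1_to_L2 v) (H1_to_L2 w) + inner (deriv_H1 v) (deriv_H1 w)"
definition norm_circle_H1 :: "circle_H1 \<Rightarrow> real" where
  "norm_circle_H1 v = sqrt (inner v v)"
definition dist_circle_H1 :: "circle_H1 \<Rightarrow> circle_H1 \<Rightarrow> real" where
  "dist_circle_H1 v w = norm (v - w)"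
definition sgn_circle_H1 :: "circle_H1 \<Rightarrow> circle_H1" where
  "sgn_circle_H1 v = inverse (norm v) *\<^sub>R v"
definition uniformity_circle_H1 :: "(circle_H1 \<times> circle_H1) filter" where
  "uniformity_circle_H1 = (INF e\<in>{0<..}. principal {(v, w). dist v w < e})"
definition open_circle_H1 :: "circle_H1 set \<Rightarrow> bool" where
  "open_circle_H1 U \<longleftrightarrow> (\<forall>v\<in>U. \<forall>\<^sub>F (v', w) in uniformity. v' = v \<longrightarrow> w \<in> U)"

lemma deriv_H1_add: "deriv_H1 (a + b) = deriv_H1 a + deriv_H1 b"
  by (rule deriv_H1_eqI)
     (simp add: plus_circle_H1.rep_eq has_weak_deriv_plus_L2 has_weak_deriv_H1)

lemma deriv_H1_scaleR: "deriv_H1 (r *\<^sub>R a) = r *\<^sub>R deriv_H1 a"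
  by (rule deriv_H1_eqI)
     (simp add: scaleR_circle_H1.rep_eq has_weak_deriv_scaleR_L2 has_weak_deriv_H1)

lemma rep_H1_to_L2: "AE t\<in>{0..1} in lborel. rep_circle_L2 (H1_to_L2 u) t = Rep_circle_H1 u t"
  unfolding H1_to_L2_def by (rule rep_abs_L2[OF square_integrable_H1])

lemma L2_eq_refl: "square_integrable v \<Longrightarrow> L2_eq v v"
  by (simp add: L2_eq_def)

lemma H1_to_L2_add: "H1_to_L2 (a + b) = H1_to_L2 a + H1_to_L2 b"
  unfolding H1_to_L2_def plus_circle_H1.rep_eq
  by (simp add: plus_circle_L2.abs_eq L2_eq_refl square_integrable_H1)

lemma H1_to_L2_scaleR: "H1_to_L2 (r *\<^sub>R a) = r *\<^sub>R H1_to_L2 a"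
  unfolding H1_to_L2_def scaleR_circle_H1.rep_eq
  by (simp add: scaleR_circle_L2.abs_eq L2_eq_refl square_integrable_H1)

lemma H1_eq_0_if:
  assumes "H1_to_L2 a = 0" "deriv_H1 a = 0"
  shows "a = 0"
proof -
  let ?u = "Rep_circle_H1 a"
  have z: "square_integrable (\<lambda>_. 0)"
    by (rule square_integrable_continuous) (auto simp: periodic_def)
  have rep0: "AE t\<in>{0..1} in lborel. rep_circle_L2 0 t = 0"
    unfolding zero_circle_L2_def by (rule rep_abs_L2[OF z])
  have "has_weak_deriv ?u (\<lambda>_. 0)"
  proof (rule has_weak_deriv_cong_AE[OF has_weak_deriv_H1])
    show "set_integrable lborel {0..1} (\<lambda>_. 0 :: real)" by (simp add: set_integrable_def)
    show "AE t\<in>{0..1} in lborel. rep_circle_L2 (deriv_H1 a) t = 0"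
      using rep0 assms(2) by simp
  qed
  then have const: "?u t = ?u 0" if "t \<in> {0..1}" for t
    using has_weak_derivD(2)[of ?u "\<lambda>_. 0" t] that by (simp add: set_lebesgue_integral_def)
  have "AE t\<in>{0..1} in lborel. ?u t = 0"
    using rep_H1_to_L2[of a] rep0 unfolding assms(1) by eventually_elim auto
  then have "AE t\<in>{0..1::real} in lborel. ?u 0 = 0"
    by (rule eventually_mono) (metis const)
  then have "?u 0 = 0"
  proof (rule contrapos_pp)
    assume "?u 0 \<noteq> 0"
    moreover have "{0..1::real} \<notin> null_sets lborel" by (simp add: null_sets_def)
    ultimately show "\<not> (AE t\<in>{0..1::real} in lborel. ?u 0 = 0)"
      by (simp add: AE_iff_null_sets)
  qed
  have "?u t = 0" for t
    using periodic_frac[OF Rep_circle_H1_periodic, of a t] const[of "frac t"] \<open>?u 0 = 0\<close>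
      frac_ge_0[of t] frac_lt_1[of t] by simp
  then show ?thesis
    by (simp add: Rep_circle_H1_inject[symmetric] zero_circle_H1.rep_eq fun_eq_iff)
qed

instance
proof
  fix a b c :: circle_H1 and r s :: real
  show "a + b + c = a + (b + c)" by transfer (simp add: algebra_simps)
  show "a + b = b + a" by transfer (simp add: algebra_simps)
  show "0 + a = a" by transfer simp
  show "- a + a = 0" unfolding uminus_circle_H1_def by transfer simp
  show "a - b = a + - b" by (rule minus_circle_H1_def)
  show "r *\<^sub>R (a + b) = r *\<^sub>R a + r *\<^sub>R b" by transfer (simp add: algebra_simps)
  show "(r + s) *\<^sub>R a = r *\<^sub>R a + s *\<^sub>R a" by transfer (simp add: algebra_simps)
  show "r *\<^sub>R s *\<^sub>R a = (r * s) *\<^sub>R a" by transfer (simp add: algebra_simps)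
  show "1 *\<^sub>R a = a" by transfer simp
  show "dist a b = norm (a - b)" by (rule dist_circle_H1_def)
  show "sgn a = inverse (norm a) *\<^sub>R a" by (rule sgn_circle_H1_def)
  show "uniformity = (INF e\<in>{0<..}. principal {(x, y :: circle_H1). dist x y < e})"
    by (rule uniformity_circle_H1_def)
  show "open U \<longleftrightarrow> (\<forall>x\<in>U. \<forall>\<^sub>F (x', y) in uniformity. x' = x \<longrightarrow> y \<in> U)" for U :: "circle_H1 set"
    by (rule open_circle_H1_def)
  show "inner a b = inner b a" by (simp add: inner_circle_H1_def inner_commute)
  show "inner (a + b) c = inner a c + inner b c"
    by (simp add: inner_circle_H1_def H1_to_L2_add deriv_H1_add inner_add_left)
  show "inner (r *\<^sub>R a) b = r * inner a b"
    by (simp add: inner_circle_H1_def H1_to_L2_scaleR deriv_H1_scaleR distrib_left)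
  show "0 \<le> inner a a" by (simp add: inner_circle_H1_def)
  have "a = 0 \<Longrightarrow> H1_to_L2 a = 0" "a = 0 \<Longrightarrow> deriv_H1 a = 0"
  proof -
    assume "a = 0"
    then have "0 *\<^sub>R a = a" by transfer simp
    then show "H1_to_L2 a = 0" "deriv_H1 a = 0"
      using H1_to_L2_scaleR[of 0 a] deriv_H1_scaleR[of 0 a] by simp_all
  qed
  then show "inner a a = 0 \<longleftrightarrow> a = 0"
    by (auto simp: inner_circle_H1_def add_nonneg_eq_0_iff intro: H1_eq_0_if)
  show "norm a = sqrt (inner a a)" by (rule norm_circle_H1_def)
qed

end


section \<open>The nonlinearity\<close>

text \<open>\<open>C\<^sup>k\<close> on the plane: all partial derivatives up to order \<open>k\<close> exist and are continuous.\<close>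

primrec Ck :: "nat \<Rightarrow> (real \<Rightarrow> real \<Rightarrow> real) \<Rightarrow> bool" where
  "Ck 0 g \<longleftrightarrow> continuous_on UNIV (\<lambda>(t, s). g t s)"
| "Ck (Suc k) g \<longleftrightarrow> continuous_on UNIV (\<lambda>(t, s). g t s) \<and>
     (\<exists>g1 g2. (\<forall>t s. ((\<lambda>t'. g t' s) has_real_derivative g1 t s) (at t) \<and>
                     (g t has_real_derivative g2 t s) (at s)) \<and> Ck k g1 \<and> Ck k g2)"

definition smooth_on_cylinder :: "(real \<Rightarrow> real \<Rightarrow> real) \<Rightarrow> bool" where
  "smooth_on_cylinder f \<longleftrightarrow> periodic f \<and> (\<forall>k. Ck k f)"

definition D2 :: "(real \<Rightarrow> real \<Rightarrow> real) \<Rightarrow> real \<Rightarrow> real \<Rightarrow> real" where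
  "D2 f t s = deriv (f t) s"

definition wild_on :: "(real \<Rightarrow> real \<Rightarrow> real) \<Rightarrow> real set \<Rightarrow> bool" where
  "wild_on f I \<longleftrightarrow>
     (\<integral>\<^sup>+s\<in>I. ennreal (1 / max 1 (SUP t. f t s)) \<partial>lborel) < \<infinity> \<and>
     (\<integral>\<^sup>+s\<in>I. ennreal (1 / max 1 (SUP t. - f t s)) \<partial>lborel) < \<infinity>"

definition tame :: "(real \<Rightarrow> real \<Rightarrow> real) \<Rightarrow> bool" where
  "tame f \<longleftrightarrow> \<not> wild_on f {0..} \<and> \<not> wild_on f {..0}"

text \<open>For real-valued maps the kernel of a surjective derivative is automatically complemented, so
  surjectivity is the whole condition.\<close>

definition regular_value :: "('a::real_normed_vector \<Rightarrow> real) \<Rightarrow> real \<Rightarrow> bool" where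
  "regular_value G c \<longleftrightarrow> (\<forall>x. G x = c \<longrightarrow> (\<exists>G'. (G has_derivative G') (at x) \<and> surj G'))"


section \<open>The differential operator and the return map\<close>

text \<open>The constructions are the same for both pairs \<open>(B\<^sup>1, B\<^sup>0)\<close>. The parameters are: the values of an
  element of \<open>B\<^sup>1\<close>, the derivative \<open>B\<^sup>1 \<rightarrow> B\<^sup>0\<close>, a function representing an element of \<open>B\<^sup>0\<close>, the
  element of \<open>B\<^sup>0\<close> represented by a function, and the notion of derivative on \<open>[0,1]\<close> in which
  (not necessarily periodic) solutions of the differential equation are understood.\<close>

locale circle_pair =
  fixes val :: "'b1::real_normed_vector \<Rightarrow> real \<Rightarrow> real"
    and D :: "'b1 \<Rightarrow> 'b0::real_normed_vector"
    and rep :: "'b0 \<Rightarrow> real \<Rightarrow> real"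
    and cls :: "(real \<Rightarrow> real) \<Rightarrow> 'b0"
    and has_der :: "(real \<Rightarrow> real) \<Rightarrow> (real \<Rightarrow> real) \<Rightarrow> bool"
begin

definition mean :: "'b0 \<Rightarrow> real" where
  "mean v = (\<integral>t\<in>{0..1}. rep v t \<partial>lborel)"

definition const :: "real \<Rightarrow> 'b0" where
  "const c = cls (\<lambda>_. c)"

definition mean_D2 :: "(real \<Rightarrow> real \<Rightarrow> real) \<Rightarrow> 'b1 \<Rightarrow> real" where
  "mean_D2 f u = (\<integral>t\<in>{0..1}. D2 f t (val u t) \<partial>lborel)"

definition F :: "(real \<Rightarrow> real \<Rightarrow> real) \<Rightarrow> 'b1 \<Rightarrow> 'b0" where
  "F f u = D u + cls (\<lambda>t. f t (val u t))"

definition Psi :: "(real \<Rightarrow> real \<Rightarrow> real) \<Rightarrow> 'b1 \<Rightarrow> 'b0" where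
  "Psi f u = F f u - const (mean (F f u)) + const (\<integral>t\<in>{0..1}. val u t \<partial>lborel)"

text \<open>In the decomposition of \<open>B\<^sup>0\<close> into average-zero functions and constants, the components of
  \<open>v\<close> are
  \<open>v - const (mean v)\<close> and \<open>mean v\<close>.\<close>

definition phi :: "(real \<Rightarrow> real \<Rightarrow> real) \<Rightarrow> 'b0 \<Rightarrow> real \<Rightarrow> real" where
  "phi f w c = mean (F f (inv (Psi f) (w + const c)))"

definition S :: "(real \<Rightarrow> real \<Rightarrow> real) \<Rightarrow> nat \<Rightarrow> 'b1 set" where
  "S f k = {u. let v = Psi f u in
     \<forall>i\<in>{1..k}. (deriv ^^ i) (phi f (v - const (mean v))) (mean v) = 0}"

definition solution :: "(real \<Rightarrow> real \<Rightarrow> real) \<Rightarrow> 'b0 \<Rightarrow> (real \<Rightarrow> real) \<Rightarrow> bool" where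
  "solution f v y \<longleftrightarrow> has_der y (\<lambda>t. rep v t - f t (y t))"

definition return_domain :: "(real \<Rightarrow> real \<Rightarrow> real) \<Rightarrow> 'b0 \<Rightarrow> real set" where
  "return_domain f v = {a. \<exists>y. solution f v y \<and> y 0 = a}"

text \<open>Only meaningful on \<^const>\<open>return_domain\<close>.\<close>

definition return_map :: "(real \<Rightarrow> real \<Rightarrow> real) \<Rightarrow> 'b0 \<Rightarrow> real \<Rightarrow> real" where
  "return_map f v a = (THE b. \<exists>y. solution f v y \<and> y 0 = a \<and> y 1 = b)"

end

definition has_deriv_on_unit_interval :: "(real \<Rightarrow> real) \<Rightarrow> (real \<Rightarrow> real) \<Rightarrow> bool" where
  "has_deriv_on_unit_interval y g \<longleftrightarrow>
     (\<forall>t\<in>{0..1}. (y has_real_derivative g t) (at t within {0..1}))"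

global_interpretation C: circle_pair Rep_circle_C1 deriv_C1 Rep_circle_C0 Abs_circle_C0
  has_deriv_on_unit_interval .

global_interpretation H: circle_pair Rep_circle_H1 deriv_H1 rep_circle_L2 abs_circle_L2
  has_weak_deriv .

end

theory Submission
  imports Defs
begin

text \<open>Let \<open>v = F(u)\<close>. Two solutions of \<open>y' + f(t, y) = v + \<kappa>\<close>, with possibly different constants \<open>\<kappa>\<close>,
  differ by a solution \<open>w\<close> of a linear equation \<open>w' + q w = const\<close>, which is solved by an integrating
  factor. For periodic solutions this shows that \<open>w\<close> has no zeros unless it vanishes identically, so that a
  periodic solution is determined by its mean. Hence \<open>\<Psi>\<close> is injective, and along the vertical line through
  \<open>\<Psi>(u)\<close> the preimages are periodic solutions \<open>u\<^sub>c\<close> of mean \<open>c\<close> with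
  \<open>F(u\<^sub>c) = v + \<kappa>(c)\<close>; thus \<open>\<phi>\<close> and \<open>\<kappa>\<close> differ by a constant. Comparing \<open>u\<^sub>c\<close> with the
  solution of \<open>y' + f(t, y) = v\<close> that starts at \<open>a = u\<^sub>c(0)\<close> gives
  \<open>\<rho>\<^sub>v(a) - a = - K(c) \<kappa>(c)\<close>, where \<open>K\<close> lies between positive constants, and \<open>c \<mapsto> u\<^sub>c(0)\<close> is
  bi-Lipschitz. So \<open>\<kappa>\<close> at the mean of \<open>u\<close> and \<open>\<rho>\<^sub>v - id\<close> at \<open>u(0)\<close> vanish to the same order, which by
  Taylor's formula is a statement about derivatives once both functions are smooth. Smoothness is a bootstrap:
  the linear formula expresses the derivative of \<open>u\<^sub>c\<close> in \<open>c\<close> through integrals and exponentials of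
  \<open>D\<^sub>2f(t, u\<^sub>c(t))\<close>, which is as smooth in \<open>c\<close> as \<open>u\<^sub>c\<close> itself. The local existence needed for
  this follows by shooting, after \<open>f\<close> is made globally Lipschitz far away from \<open>u\<close>.\<close>

section \<open>Families with smooth dependence on a parameter\<close>

text \<open>Only derivatives in the parameter \<open>p\<close> are counted. In \<open>t\<close>
  joint continuity is recorded, since the families are only integrated, evaluated or combined
  pointwise in \<open>t\<close>.\<close>

primrec param_Ck :: "real set \<Rightarrow> nat \<Rightarrow> (real \<Rightarrow> real \<Rightarrow> real) \<Rightarrow> bool" where
  "param_Ck I 0 y \<longleftrightarrow> continuous_on (I \<times> {0..1}) (\<lambda>(p, t). y p t)"
| "param_Ck I (Suc k) y \<longleftrightarrow> continuous_on (I \<times> {0..1}) (\<lambda>(p, t). y p t) \<and>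
     (\<exists>y'. (\<forall>p\<in>I. \<forall>t\<in>{0..1}. ((\<lambda>p. y p t) has_real_derivative y' p t) (at p)) \<and> param_Ck I k y')"

lemma param_Ck_continuous: "param_Ck I k y \<Longrightarrow> continuous_on (I \<times> {0..1}) (\<lambda>(p, t). y p t)"
  by (cases k) auto

lemma param_Ck_Suc:
  assumes "\<And>p t. p \<in> I \<Longrightarrow> t \<in> {0..1} \<Longrightarrow> ((\<lambda>p. y p t) has_real_derivative y' p t) (at p)"
    and "param_Ck I k y'" and "continuous_on (I \<times> {0..1}) (\<lambda>(p, t). y p t)"
  shows "param_Ck I (Suc k) y"
  unfolding param_Ck.simps using assms by blast

lemma param_Ck_SucE:
  assumes "param_Ck I (Suc k) y"
  obtains y' where
    "\<And>p t. p \<in> I \<Longrightarrow> t \<in> {0..1} \<Longrightarrow> ((\<lambda>p. y p t) has_real_derivative y' p t) (at p)"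
    "param_Ck I k y'"
  using assms unfolding param_Ck.simps by blast

lemma param_Ck_SucD: "param_Ck I (Suc k) y \<Longrightarrow> param_Ck I k y"
proof (induction k arbitrary: y)
  case (Suc k)
  from Suc.prems obtain y' where "\<And>p t. p \<in> I \<Longrightarrow> t \<in> {0..1} \<Longrightarrow> ((\<lambda>p. y p t) has_real_derivative y' p t) (at p)"
    "param_Ck I (Suc k) y'" using param_Ck_SucE by blast
  with Suc param_Ck_continuous[of I _ y] show ?case
    by (intro param_Ck_Suc[of _ _ y']) auto
qed simp

text \<open>Since \<open>I\<close> is open, a derivative at a point of \<open>I\<close> depends only
  on values inside \<open>I\<close>. This permits a change of formula valid only on
  \<open>I\<close>, such as replacing a truncated nonlinearity by the original one.\<close>

lemma param_Ck_cong:
  assumes "open I" "param_Ck I k y" "\<And>p t. p \<in> I \<Longrightarrow> t \<in> {0..1} \<Longrightarrow> z p t = y p t"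
  shows "param_Ck I k z"
proof -
  have c: "continuous_on (I \<times> {0..1}) (\<lambda>(p, t). z p t)"
    using param_Ck_continuous[OF assms(2)] by (rule continuous_on_eq) (use assms(3) in auto)
  show ?thesis
  proof (cases k)
    case (Suc l)
    with assms(2) obtain y' where y': "\<And>p t. p \<in> I \<Longrightarrow> t \<in> {0..1} \<Longrightarrow> ((\<lambda>p. y p t) has_real_derivative y' p t) (at p)"
      "param_Ck I l y'" using param_Ck_SucE by blast
    have "((\<lambda>p. z p t) has_real_derivative y' p t) (at p)" if "p \<in> I" "t \<in> {0..1}" for p t
      using has_field_derivative_transform_within_open[OF y'(1)[OF that] assms(1) that(1), of "\<lambda>p. z p t"]
        assms(3) that by metis
    with y'(2) c show ?thesis unfolding Suc by (intro param_Ck_Suc)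
  qed (use c in simp)
qed

section \<open>Closure under sums, products, exponentials and inverses\<close>

lemma param_Ck_zero: "param_Ck I k (\<lambda>_ _. 0)"
  by (induction k) (auto simp: split_beta intro!: continuous_intros exI[of _ "\<lambda>_ _. 0"] derivative_eq_intros)

lemma param_Ck_const: "param_Ck I k (\<lambda>_ _. c)"
proof (cases k)
  case (Suc l)
  have "param_Ck I (Suc l) (\<lambda>_ _. c)"
    by (rule param_Ck_Suc[where y' = "\<lambda>_ _. 0"]) (auto simp: param_Ck_zero split_beta intro!: continuous_intros)
  then show ?thesis using Suc by simp
qed (simp add: split_beta)

lemma param_Ck_add: "param_Ck I k y \<Longrightarrow> param_Ck I k z \<Longrightarrow> param_Ck I k (\<lambda>p t. y p t + z p t)"
proof (induction k arbitrary: y z)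
  case 0
  then show ?case by (auto simp: split_beta intro!: continuous_intros)
next
  case (Suc k)
  obtain y' where y: "\<And>p t. p \<in> I \<Longrightarrow> t \<in> {0..1} \<Longrightarrow> ((\<lambda>p. y p t) has_real_derivative y' p t) (at p)"
    "param_Ck I k y'" using Suc.prems param_Ck_SucE by blast
  obtain z' where z: "\<And>p t. p \<in> I \<Longrightarrow> t \<in> {0..1} \<Longrightarrow> ((\<lambda>p. z p t) has_real_derivative z' p t) (at p)"
    "param_Ck I k z'" using Suc.prems param_Ck_SucE by blast
  show ?case
  proof (rule param_Ck_Suc)
    show "((\<lambda>p. y p t + z p t) has_real_derivative y' p t + z' p t) (at p)" if "p \<in> I" "t \<in> {0..1}" for p t
      by (intro DERIV_add y z that)
    show "param_Ck I k (\<lambda>p t. y' p t + z' p t)" by (rule Suc.IH[OF y(2) z(2)])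
    show "continuous_on (I \<times> {0..1}) (\<lambda>(p, t). y p t + z p t)"
      using Suc.prems[THEN param_Ck_continuous] by (auto simp: split_beta intro!: continuous_intros)
  qed
qed

lemma param_Ck_mult: "param_Ck I k y \<Longrightarrow> param_Ck I k z \<Longrightarrow> param_Ck I k (\<lambda>p t. y p t * z p t)"
proof (induction k arbitrary: y z)
  case 0
  then show ?case by (auto simp: split_beta intro!: continuous_intros)
next
  case (Suc k)
  obtain y' where y: "\<And>p t. p \<in> I \<Longrightarrow> t \<in> {0..1} \<Longrightarrow> ((\<lambda>p. y p t) has_real_derivative y' p t) (at p)"
    "param_Ck I k y'" using Suc.prems param_Ck_SucE by blast
  obtain z' where z: "\<And>p t. p \<in> I \<Longrightarrow> t \<in> {0..1} \<Longrightarrow> ((\<lambda>p. z p t) has_real_derivative z' p t) (at p)"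
    "param_Ck I k z'" using Suc.prems param_Ck_SucE by blast
  show ?case
  proof (rule param_Ck_Suc)
    show "((\<lambda>p. y p t * z p t) has_real_derivative y' p t * z p t + z' p t * y p t) (at p)"
      if "p \<in> I" "t \<in> {0..1}" for p t
      by (intro DERIV_mult y z that)
    show "param_Ck I k (\<lambda>p t. y' p t * z p t + z' p t * y p t)"
      by (intro param_Ck_add Suc.IH y z Suc.prems[THEN param_Ck_SucD])
    show "continuous_on (I \<times> {0..1}) (\<lambda>(p, t). y p t * z p t)"
      using Suc.prems[THEN param_Ck_continuous] by (auto simp: split_beta intro!: continuous_intros)
  qed
qed

lemma param_Ck_minus: "param_Ck I k y \<Longrightarrow> param_Ck I k (\<lambda>p t. - y p t)"
  using param_Ck_mult[OF param_Ck_const[of _ _ "-1"]] by simp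

lemma param_Ck_diff: "param_Ck I k y \<Longrightarrow> param_Ck I k z \<Longrightarrow> param_Ck I k (\<lambda>p t. y p t - z p t)"
  using param_Ck_add[OF _ param_Ck_minus] by simp

lemma param_Ck_exp: "param_Ck I k y \<Longrightarrow> param_Ck I k (\<lambda>p t. exp (y p t))"
proof (induction k arbitrary: y)
  case 0
  then show ?case by (auto simp: split_beta intro!: continuous_intros)
next
  case (Suc k)
  obtain y' where y: "\<And>p t. p \<in> I \<Longrightarrow> t \<in> {0..1} \<Longrightarrow> ((\<lambda>p. y p t) has_real_derivative y' p t) (at p)"
    "param_Ck I k y'" using Suc.prems param_Ck_SucE by blast
  show ?case
  proof (rule param_Ck_Suc)
    show "((\<lambda>p. exp (y p t)) has_real_derivative exp (y p t) * y' p t) (at p)" if "p \<in> I" "t \<in> {0..1}" for p t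
      by (intro DERIV_fun_exp y that)
    show "param_Ck I k (\<lambda>p t. exp (y p t) * y' p t)"
      by (intro param_Ck_mult Suc.IH y Suc.prems[THEN param_Ck_SucD])
    show "continuous_on (I \<times> {0..1}) (\<lambda>(p, t). exp (y p t))"
      using Suc.prems[THEN param_Ck_continuous] by (auto simp: split_beta intro!: continuous_intros)
  qed
qed

lemma param_Ck_inverse:
  "param_Ck I k y \<Longrightarrow> (\<And>p t. p \<in> I \<Longrightarrow> t \<in> {0..1} \<Longrightarrow> y p t \<noteq> 0) \<Longrightarrow> param_Ck I k (\<lambda>p t. inverse (y p t))"
proof (induction k arbitrary: y)
  case 0
  then show ?case by (auto simp: split_beta intro!: continuous_intros)
next
  case (Suc k)
  obtain y' where y: "\<And>p t. p \<in> I \<Longrightarrow> t \<in> {0..1} \<Longrightarrow> ((\<lambda>p. y p t) has_real_derivative y' p t) (at p)"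
    "param_Ck I k y'" using Suc.prems(1) param_Ck_SucE by blast
  have inv: "param_Ck I k (\<lambda>p t. inverse (y p t))"
    by (intro Suc.IH Suc.prems(1)[THEN param_Ck_SucD] Suc.prems(2))
  show ?case
  proof (rule param_Ck_Suc)
    show "((\<lambda>p. inverse (y p t)) has_real_derivative - (inverse (y p t) * y' p t * inverse (y p t))) (at p)"
      if "p \<in> I" "t \<in> {0..1}" for p t
      by (intro DERIV_inverse' y Suc.prems(2) that)
    show "param_Ck I k (\<lambda>p t. - (inverse (y p t) * y' p t * inverse (y p t)))"
      by (intro param_Ck_minus param_Ck_mult inv y)
    show "continuous_on (I \<times> {0..1}) (\<lambda>(p, t). inverse (y p t))"
      using Suc.prems(1)[THEN param_Ck_continuous] Suc.prems(2)
      by (auto simp: split_beta intro!: continuous_intros)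
  qed
qed

text \<open>Freezing \<open>t\<close> gives a function of \<open>p\<close> alone, still regarded as
  a family; endpoint values and means thereby stay within the same calculus.\<close>

lemma param_Ck_eval:
  assumes "s \<in> {0..1}"
  shows "param_Ck I k y \<Longrightarrow> param_Ck I k (\<lambda>p t. y p s)"
proof (induction k arbitrary: y)
  case 0
  then have "continuous_on (I \<times> {0..1}) (\<lambda>x. y (fst x) (snd x))" by (simp add: split_beta)
  from continuous_on_compose2[OF this, of "I \<times> {0..1}" "\<lambda>x. (fst x, s)"] assms
  have "continuous_on (I \<times> {0..1 :: real}) (\<lambda>x. y (fst x) s)" by (simp add: image_subset_iff continuous_intros)
  then show ?case by (simp add: split_beta)
next
  case (Suc k)
  obtain y' where y: "\<And>p t. p \<in> I \<Longrightarrow> t \<in> {0..1} \<Longrightarrow> ((\<lambda>p. y p t) has_real_derivative y' p t) (at p)"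
    "param_Ck I k y'" using Suc.prems param_Ck_SucE by blast
  have "continuous_on (I \<times> {0..1}) (\<lambda>(p, t :: real). y p s)"
    using Suc.IH[OF Suc.prems[THEN param_Ck_SucD]] by (rule param_Ck_continuous)
  then show ?case
    using y assms Suc.IH[OF y(2)] by (intro param_Ck_Suc[where y' = "\<lambda>p t. y' p s"]) auto
qed

section \<open>Integration in \<open>t\<close> and composition with a nonlinearity\<close>

lemma param_continuous_section:
  assumes "continuous_on (I \<times> {0..1}) (\<lambda>(p, t). y p t)" "p \<in> I"
  shows "continuous_on {0..1} (y p)"
proof -
  have "continuous_on (I \<times> {0..1}) (\<lambda>x. y (fst x) (snd x))" using assms by (simp add: split_beta)
  from continuous_on_compose2[OF this, of "{0..1}" "\<lambda>t. (p, t)"] assms(2)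
  show ?thesis by (simp add: image_subset_iff continuous_intros)
qed

text \<open>The substitution \<open>s = t * \<sigma>\<close> moves the variable endpoint into the
  integrand, so that joint continuity in \<open>(p, t)\<close> follows from continuity of integrals
  over a fixed interval.\<close>

lemma integral_rescale:
  fixes h :: "real \<Rightarrow> real"
  assumes "continuous_on {0..1} h" "t \<in> {0..1}"
  shows "integral {0..t} h = t * integral {0..1} (\<lambda>\<sigma>. h (t * \<sigma>))"
proof (cases "t = 0")
  case False
  with assms have t: "0 < t" by simp
  have "(h has_integral integral {0..t} h) {0..t}"
    using assms by (auto intro!: integrable_integral integrable_continuous_real elim: continuous_on_subset)
  from has_integral_stretch_real[OF this, of t] t
  have "((\<lambda>x. h (t * x)) has_integral (1 / t) * integral {0..t} h) {0..1}" by simp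
  then show ?thesis using t by (simp add: integral_unique)
qed simp

lemma continuous_on_param_integral:
  fixes y :: "real \<Rightarrow> real \<Rightarrow> real"
  assumes "continuous_on (I \<times> {0..1}) (\<lambda>(p, t). y p t)"
  shows "continuous_on (I \<times> {0..1}) (\<lambda>(p, t). integral {0..t} (y p))"
proof -
  have "continuous_on (I \<times> {0..1}) (\<lambda>x. y (fst x) (snd x))" using assms by (simp add: split_beta)
  from this have "continuous_on ((I \<times> {0..1}) \<times> cbox 0 1) (\<lambda>z. y (fst (fst z)) (snd (fst z) * snd z))"
    using continuous_on_compose2[of "I \<times> {0..1}" "\<lambda>x. y (fst x) (snd x)" "(I \<times> {0..1}) \<times> cbox 0 1" "\<lambda>z. (fst (fst z), snd (fst z) * snd z)"]
    by (simp add: image_subset_iff mult_le_one continuous_intros)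
  then have "continuous_on (I \<times> {0..1}) (\<lambda>x. integral (cbox 0 1) (\<lambda>\<sigma>. y (fst x) (snd x * \<sigma>)))"
    by (intro integral_continuous_on_param) (simp add: split_beta)
  then have "continuous_on (I \<times> {0..1}) (\<lambda>x. snd x * integral {0..1} (\<lambda>\<sigma>. y (fst x) (snd x * \<sigma>)))"
    by (intro continuous_intros) simp
  then show ?thesis
    by (rule continuous_on_eq) (use param_continuous_section[OF assms] in \<open>auto simp: integral_rescale\<close>)
qed

text \<open>The Leibniz rule differentiates under the integral sign with the endpoint
  \<open>t\<close> held fixed. The derivative is an integral of the same type, which closes the
  induction.\<close>

lemma param_Ck_integral:
  assumes I: "open I" "convex I"
  shows "param_Ck I k y \<Longrightarrow> param_Ck I k (\<lambda>p t. integral {0..t} (y p))"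
proof (induction k arbitrary: y)
  case 0
  then show ?case using continuous_on_param_integral[of I y] by simp
next
  case (Suc k)
  obtain y' where y: "\<And>p t. p \<in> I \<Longrightarrow> t \<in> {0..1} \<Longrightarrow> ((\<lambda>p. y p t) has_real_derivative y' p t) (at p)"
    "param_Ck I k y'" using Suc.prems param_Ck_SucE by blast
  note cy = param_Ck_continuous[OF Suc.prems] param_Ck_continuous[OF y(2)]
  show ?case
  proof (rule param_Ck_Suc)
    fix p t :: real assume p: "p \<in> I" and t: "t \<in> {0..1}"
    have "((\<lambda>p. integral (cbox 0 t) (y p)) has_real_derivative integral (cbox 0 t) (y' p)) (at p within I)"
    proof (rule leibniz_rule_field_derivative[OF _ _ _ p I(2)])
      show "((\<lambda>x. y x s) has_real_derivative y' x s) (at x within I)" if "x \<in> I" "s \<in> cbox 0 t" for x s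
        by (rule has_field_derivative_at_within[OF y(1)]) (use that t in auto)
      show "y x integrable_on cbox 0 t" if "x \<in> I" for x
        using t
        by (intro integrable_continuous continuous_on_subset[OF param_continuous_section[OF cy(1) that]]) auto
      show "continuous_on (I \<times> cbox 0 t) (\<lambda>(x, s). y' x s)"
        using cy(2) by (rule continuous_on_subset) (use t in auto)
    qed
    then show "((\<lambda>p. integral {0..t} (y p)) has_real_derivative integral {0..t} (y' p)) (at p)"
      unfolding at_within_open[OF p I(1)] cbox_interval .
  next
    show "param_Ck I k (\<lambda>p t. integral {0..t} (y' p))" by (rule Suc.IH[OF y(2)])
    show "continuous_on (I \<times> {0..1}) (\<lambda>(p, t). integral {0..t} (y p))"
      by (rule continuous_on_param_integral[OF cy(1)])
  qed
qed

lemma Ck_continuous: "Ck k g \<Longrightarrow> continuous_on UNIV (\<lambda>(t, s). g t s)"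
  by (cases k) auto

lemma continuous_on_nonlinearity:
  assumes "continuous_on UNIV (\<lambda>(t, s). g t s)" "continuous_on A a" "continuous_on A b"
  shows "continuous_on A (\<lambda>x. g (a x) (b x) :: real)"
  using continuous_on_compose2[OF assms(1) continuous_on_Pair[OF assms(2,3)]] by simp

lemma param_continuous_compose:
  assumes "continuous_on UNIV (\<lambda>(t, s). g t s)" "continuous_on (I \<times> {0..1}) (\<lambda>(p, t). y p t)"
  shows "continuous_on (I \<times> {0..1}) (\<lambda>(p, t). g t (y p t :: real) :: real)"
  unfolding split_beta
  by (rule continuous_on_nonlinearity[OF assms(1)])
    (use assms(2) in \<open>auto simp: split_beta intro!: continuous_intros\<close>)

text \<open>As \<open>t\<close> is frozen while differentiating in \<open>p\<close>, the chain rule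
  involves only the partial derivative \<open>g2\<close> in the second variable.\<close>

lemma param_Ck_compose:
  "Ck k g \<Longrightarrow> param_Ck I k y \<Longrightarrow> param_Ck I k (\<lambda>p t. g t (y p t))"
proof (induction k arbitrary: y g)
  case 0
  then show ?case using param_continuous_compose[of g I y] by simp
next
  case (Suc k)
  obtain y' where y: "\<And>p t. p \<in> I \<Longrightarrow> t \<in> {0..1} \<Longrightarrow> ((\<lambda>p. y p t) has_real_derivative y' p t) (at p)"
    "param_Ck I k y'" using Suc.prems(2) param_Ck_SucE by blast
  obtain g2 where g2: "\<And>t s. (g t has_real_derivative g2 t s) (at s)" "Ck k g2"
    using Suc.prems(1) by auto
  show ?case
  proof (rule param_Ck_Suc)
    show "((\<lambda>p. g t (y p t)) has_real_derivative g2 t (y p t) * y' p t) (at p)" if "p \<in> I" "t \<in> {0..1}" for p t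
      by (rule DERIV_chain2[OF g2(1) y(1)[OF that]])
    show "param_Ck I k (\<lambda>p t. g2 t (y p t) * y' p t)"
      by (rule param_Ck_mult[OF Suc.IH[OF g2(2) Suc.prems(2)[THEN param_Ck_SucD]] y(2)])
    show "continuous_on (I \<times> {0..1}) (\<lambda>(p, t). g t (y p t))"
      by (rule param_continuous_compose[OF Ck_continuous[OF Suc.prems(1)] param_Ck_continuous[OF Suc.prems(2)]])
  qed
qed

section \<open>Scalar linear equations\<close>

lemma integrable_on_initial:
  fixes h :: "real \<Rightarrow> real"
  assumes "continuous_on {0..1} h" "t \<in> {0..1}"
  shows "h integrable_on {0..t}"
  by (rule integrable_continuous_real[OF continuous_on_subset[OF assms(1)]]) (use assms(2) in auto)

lemma continuous_on_initial_integral: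
  fixes h :: "real \<Rightarrow> real"
  assumes "continuous_on {0..1} h"
  shows "continuous_on {0..1} (\<lambda>t. integral {0..t} h)"
  by (rule indefinite_integral_continuous_1[OF integrable_on_initial[OF assms]]) simp

lemma continuous_on_unit_bounded:
  fixes q :: "real \<Rightarrow> real"
  assumes "continuous_on {0..1} q"
  shows "\<exists>L. \<forall>t\<in>{0..1}. \<bar>q t\<bar> \<le> L"
proof -
  have "bounded (q ` {0..1})"
    by (intro compact_imp_bounded compact_continuous_image assms compact_Icc)
  then obtain L where "\<forall>x\<in>q ` {0..1}. \<bar>x\<bar> \<le> L" by (auto simp: bounded_iff)
  then show ?thesis by blast
qed

definition int_factor :: "(real \<Rightarrow> real) \<Rightarrow> real \<Rightarrow> real" where
  "int_factor q t = exp (integral {0..t} q)"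

text \<open>With \<open>E = int_factor q\<close>, the equation \<open>w' + q w = \<kappa>\<close>
  reads \<open>(E w)' = \<kappa> E\<close>, so this primitive of \<open>E\<close> carries the
  inhomogeneous part of the solution.\<close>

definition int_factor_prim :: "(real \<Rightarrow> real) \<Rightarrow> real \<Rightarrow> real" where
  "int_factor_prim q t = integral {0..t} (int_factor q)"

text \<open>Up to a factor, the unique \<open>w\<close> such that \<open>w' + q w\<close> is constant and \<open>w(0) = w(1)\<close>.\<close>

definition periodic_profile :: "(real \<Rightarrow> real) \<Rightarrow> real \<Rightarrow> real" where
  "periodic_profile q t = exp (- integral {0..t} q) *
     (int_factor_prim q 1 - int_factor_prim q t + int_factor q 1 * int_factor_prim q t)"

definition profile_mean :: "(real \<Rightarrow> real) \<Rightarrow> real" where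
  "profile_mean q = integral {0..1} (periodic_profile q)"

text \<open>The integrated form of \<open>w' + q w = \<kappa>\<close>, \<open>w 0 = c\<close>. It is
  what subtracting two integral equations produces, also when the individual solutions have only
  weak derivatives.\<close>

definition linear_sol :: "(real \<Rightarrow> real) \<Rightarrow> real \<Rightarrow> real \<Rightarrow> (real \<Rightarrow> real) \<Rightarrow> bool" where
  "linear_sol q c \<kappa> w \<longleftrightarrow> continuous_on {0..1} w \<and>
     (\<forall>t\<in>{0..1}. w t = c + \<kappa> * t - integral {0..t} (\<lambda>s. q s * w s))"

context
  fixes q :: "real \<Rightarrow> real"
  assumes q: "continuous_on {0..1} q"
begin

lemma int_factor_continuous: "continuous_on {0..1} (int_factor q)"
  unfolding int_factor_def by (intro continuous_intros continuous_on_initial_integral q)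

lemma int_factor_prim_continuous: "continuous_on {0..1} (int_factor_prim q)"
  unfolding int_factor_prim_def by (intro continuous_on_initial_integral int_factor_continuous)

lemma periodic_profile_continuous: "continuous_on {0..1} (periodic_profile q)"
  unfolding periodic_profile_def
  by (intro continuous_intros continuous_on_initial_integral q int_factor_prim_continuous)

text \<open>The equation amounts to \<open>(E w)' = \<kappa> E\<close> with \<open>E\<close> the
  integrating factor; at \<open>t = 0\<close> one has \<open>E = 1\<close> and its primitive
  vanishes.\<close>

lemma linear_sol_eq:
  assumes "linear_sol q c \<kappa> w" "t \<in> {0..1}"
  shows "int_factor q t * w t = c + \<kappa> * int_factor_prim q t"
proof -
  from assms have w: "continuous_on {0..1} w"
    and eq: "\<And>t. t \<in> {0..1} \<Longrightarrow> w t = c + \<kappa> * t - integral {0..t} (\<lambda>s. q s * w s)"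
    by (auto simp: linear_sol_def)
  \<comment> \<open>Here \<open>w\<close> is replaced by the right-hand side of its integral
    equation, which is visibly differentiable; \<open>?D\<close> is the quantity that should be
    constant.\<close>
  let ?D = "\<lambda>t. int_factor q t * (c + \<kappa> * t - integral {0..t} (\<lambda>s. q s * w s)) - \<kappa> * int_factor_prim q t"
  have dq: "((\<lambda>t. integral {0..t} q) has_real_derivative q t) (at t within {0..1})" if "t \<in> {0..1}" for t
    by (rule integral_has_real_derivative[OF q that])
  have dw: "((\<lambda>t. integral {0..t} (\<lambda>s. q s * w s)) has_real_derivative q t * w t) (at t within {0..1})"
    if "t \<in> {0..1}" for t
    by (rule integral_has_real_derivative[OF _ that]) (intro continuous_intros q w)
  have dE: "(int_factor q has_real_derivative int_factor q t * q t) (at t within {0..1})" if "t \<in> {0..1}" for t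
    unfolding int_factor_def using dq[OF that] by (auto intro!: derivative_eq_intros)
  have dJ: "(int_factor_prim q has_real_derivative int_factor q t) (at t within {0..1})" if "t \<in> {0..1}" for t
    unfolding int_factor_prim_def by (rule integral_has_real_derivative[OF int_factor_continuous that])
  have "(?D has_real_derivative 0) (at t within {0..1})" if t: "t \<in> {0..1}" for t
    by (rule derivative_eq_intros dE[OF t] dJ[OF t] dw[OF t] refl)+
      (simp add: eq[OF t, symmetric] algebra_simps)
  from has_field_derivative_zero_constant[OF convex_real_interval(5) this]
  obtain C where C: "\<And>t. t \<in> {0..1} \<Longrightarrow> ?D t = C" by blast
  have "C = c"
    using C[of 0] by (simp add: int_factor_def int_factor_prim_def)
  then show ?thesis using C[OF assms(2)] eq[OF assms(2)] by simp
qed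

section \<open>Two-sided estimates from a bound on the coefficient\<close>

context
  fixes L :: real
  assumes L: "\<And>t. t \<in> {0..1} \<Longrightarrow> \<bar>q t\<bar> \<le> L"
begin

lemma bound_nonneg: "0 \<le> L" using L[of 0] by simp

lemma abs_integral_le:
  assumes "t \<in> {0..1}"
  shows "\<bar>integral {0..t} q\<bar> \<le> L"
proof -
  have "norm (integral {0..t} q) \<le> integral {0..t} (\<lambda>_. L)"
    by (rule integral_norm_bound_integral) (use assms integrable_on_initial[OF q assms] L in auto)
  also have "\<dots> = t * L" using assms by simp
  also have "\<dots> \<le> L" using assms bound_nonneg by (auto intro: mult_left_le_one_le)
  finally show ?thesis by simp
qed

lemma int_factor_bounds:
  assumes "t \<in> {0..1}"
  shows "exp (- L) \<le> int_factor q t" "int_factor q t \<le> exp L"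
    "exp (- L) \<le> exp (- integral {0..t} q)" "exp (- integral {0..t} q) \<le> exp L"
  using abs_integral_le[OF assms] by (auto simp: int_factor_def)

lemma int_factor_prim_bounds:
  shows "exp (- L) \<le> int_factor_prim q 1" "int_factor_prim q 1 \<le> exp L"
    "t \<in> {0..1} \<Longrightarrow> 0 \<le> int_factor_prim q t" "t \<in> {0..1} \<Longrightarrow> int_factor_prim q t \<le> int_factor_prim q 1"
proof -
  note int = integrable_on_initial[OF int_factor_continuous]
  have "integral {0..1} (\<lambda>_::real. exp (- L)) \<le> int_factor_prim q 1"
    "int_factor_prim q 1 \<le> integral {0..1} (\<lambda>_::real. exp L)"
    unfolding int_factor_prim_def using int_factor_bounds
    by (intro integral_le integrable_continuous_real int_factor_continuous; simp)+
  then show "exp (- L) \<le> int_factor_prim q 1" "int_factor_prim q 1 \<le> exp L" by simp_all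
  show "0 \<le> int_factor_prim q t" if "t \<in> {0..1}"
    unfolding int_factor_prim_def
    by (rule integral_nonneg[OF int[OF that]]) (simp add: int_factor_def)
  show "int_factor_prim q t \<le> int_factor_prim q 1" if "t \<in> {0..1}"
    unfolding int_factor_prim_def
    by (rule integral_subset_le[OF _ int[OF that] int[of 1]]) (use that in \<open>auto simp: int_factor_def\<close>)
qed

lemma int_factor_prim_pos: "0 < int_factor_prim q 1"
  using int_factor_prim_bounds(1) exp_gt_zero[of "- L"] by linarith

text \<open>The bracket in the profile combines the nonnegative numbers \<open>N - J\<close> and
  \<open>J\<close> with weights \<open>1\<close> and \<open>int_factor q 1\<close>, both in
  \<open>[exp (- L), exp L]\<close>; the exponential in front contributes a second factor from the
  same range.\<close>

lemma periodic_profile_bounds: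
  assumes t: "t \<in> {0..1}"
  shows "exp (- (2 * L)) * int_factor_prim q 1 \<le> periodic_profile q t"
    "periodic_profile q t \<le> exp (2 * L) * int_factor_prim q 1"
proof -
  define J N where "J = int_factor_prim q t" and "N = int_factor_prim q 1"
  have JN: "0 \<le> J" "J \<le> N" "0 < N"
    using int_factor_prim_bounds(3,4)[OF t] int_factor_prim_pos by (auto simp: J_def N_def)
  have e1: "exp (- L) \<le> 1" "1 \<le> exp L" using bound_nonneg by auto
  have E: "exp (- L) \<le> int_factor q 1" "int_factor q 1 \<le> exp L" using int_factor_bounds by auto
  have "exp (- L) * N = exp (- L) * (N - J) + exp (- L) * J" by (simp add: algebra_simps)
  also have "\<dots> \<le> 1 * (N - J) + int_factor q 1 * J"
    using JN e1 E by (intro add_mono mult_right_mono) auto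
  finally have lo: "exp (- L) * N \<le> N - J + int_factor q 1 * J" by simp
  have "1 * (N - J) + int_factor q 1 * J \<le> exp L * (N - J) + exp L * J"
    using JN e1 E by (intro add_mono mult_right_mono) auto
  also have "\<dots> = exp L * N" by (simp add: algebra_simps)
  finally have hi: "N - J + int_factor q 1 * J \<le> exp L * N" by simp
  have pos: "0 \<le> N - J + int_factor q 1 * J" using lo JN by (smt (verit) exp_gt_zero mult_pos_pos)
  have two: "exp (- (2 * L)) = exp (- L) * exp (- L)" "exp (2 * L) = exp L * exp L"
    by (simp_all flip: exp_add)
  show "exp (- (2 * L)) * int_factor_prim q 1 \<le> periodic_profile q t"
    unfolding two periodic_profile_def J_def[symmetric] N_def[symmetric] mult.assoc
    using lo pos JN int_factor_bounds(3)[OF t] by (intro mult_mono) auto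
  show "periodic_profile q t \<le> exp (2 * L) * int_factor_prim q 1"
    unfolding two periodic_profile_def J_def[symmetric] N_def[symmetric] mult.assoc
    using hi pos JN int_factor_bounds(4)[OF t] by (intro mult_mono) auto
qed

lemma profile_mean_bounds:
  shows "exp (- (2 * L)) * int_factor_prim q 1 \<le> profile_mean q"
    "profile_mean q \<le> exp (2 * L) * int_factor_prim q 1"
proof -
  have "integral {0..1} (\<lambda>_::real. exp (- (2 * L)) * int_factor_prim q 1) \<le> profile_mean q"
    "profile_mean q \<le> integral {0..1} (\<lambda>_::real. exp (2 * L) * int_factor_prim q 1)"
    unfolding profile_mean_def using periodic_profile_bounds
    by (intro integral_le integrable_continuous_real periodic_profile_continuous; simp)+
  then show "exp (- (2 * L)) * int_factor_prim q 1 \<le> profile_mean q"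
    "profile_mean q \<le> exp (2 * L) * int_factor_prim q 1" by simp_all
qed

text \<open>For zero initial value, \<open>w 1\<close> is \<open>\<kappa>\<close> times two positive
  factors, \<open>exp (- integral {0..1} q)\<close> and \<open>int_factor_prim q 1\<close>, each in
  \<open>[exp (- L), exp L]\<close>. This will compare the displacement of the return map with the
  constant.\<close>

lemma linear_sol_endpoint:
  assumes "linear_sol q 0 \<kappa> w"
  shows "exp (- (2 * L)) * \<bar>\<kappa>\<bar> \<le> \<bar>w 1\<bar>" "\<bar>w 1\<bar> \<le> exp (2 * L) * \<bar>\<kappa>\<bar>"
proof -
  have "int_factor q 1 * w 1 = \<kappa> * int_factor_prim q 1"
    using linear_sol_eq[OF assms, of 1] by simp
  then have "w 1 = exp (- integral {0..1} q) * int_factor_prim q 1 * \<kappa>"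
    by (simp add: int_factor_def exp_minus field_simps)
  then have w: "\<bar>w 1\<bar> = exp (- integral {0..1} q) * int_factor_prim q 1 * \<bar>\<kappa>\<bar>"
    using int_factor_prim_pos by (simp add: abs_mult)
  have two: "exp (- (2 * L)) = exp (- L) * exp (- L)" "exp (2 * L) = exp L * exp L"
    by (simp_all flip: exp_add)
  show "exp (- (2 * L)) * \<bar>\<kappa>\<bar> \<le> \<bar>w 1\<bar>" unfolding w two
    by (intro mult_right_mono mult_mono int_factor_bounds int_factor_prim_bounds) auto
  show "\<bar>w 1\<bar> \<le> exp (2 * L) * \<bar>\<kappa>\<bar>" unfolding w two
    by (intro mult_right_mono mult_mono int_factor_bounds int_factor_prim_bounds) (auto intro: int_factor_prim_bounds)
qed

end

lemma int_factor_prim_1_pos: "0 < int_factor_prim q 1"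
proof -
  obtain L where L: "\<forall>t\<in>{0..1}. \<bar>q t\<bar> \<le> L" using continuous_on_unit_bounded[OF q] by blast
  from int_factor_prim_pos[OF L[rule_format]] show ?thesis .
qed

lemma profile_mean_pos: "0 < profile_mean q"
proof -
  obtain L where L: "\<forall>t\<in>{0..1}. \<bar>q t\<bar> \<le> L" using continuous_on_unit_bounded[OF q] by blast
  from profile_mean_bounds(1)[OF L[rule_format]] have "exp (- (2 * L)) * int_factor_prim q 1 \<le> profile_mean q" .
  moreover have "0 < exp (- (2 * L)) * int_factor_prim q 1" using int_factor_prim_1_pos by simp
  ultimately show ?thesis by linarith
qed

text \<open>Setting \<open>t = 1\<close> in the explicit formula determines \<open>\<kappa>\<close>
  from \<open>c\<close>; inserting this shows that \<open>w\<close> is a multiple of the profile.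
  Integration relates \<open>c\<close> to the mean, and the last two clauses eliminate
  \<open>c\<close>, so that a periodic \<open>w\<close> is governed by its mean.\<close>

lemma linear_sol_periodic:
  assumes w: "linear_sol q c \<kappa> w" "w 1 = c"
  shows "\<kappa> * int_factor_prim q 1 = c * (int_factor q 1 - 1)"
    and "t \<in> {0..1} \<Longrightarrow> int_factor_prim q 1 * w t = c * periodic_profile q t"
    and "int_factor_prim q 1 * integral {0..1} w = c * profile_mean q"
    and "t \<in> {0..1} \<Longrightarrow> profile_mean q * w t = integral {0..1} w * periodic_profile q t"
    and "profile_mean q * \<kappa> = integral {0..1} w * (int_factor q 1 - 1)"
proof -
  let ?N = "int_factor_prim q 1"
  show \<kappa>: "\<kappa> * ?N = c * (int_factor q 1 - 1)"
    using linear_sol_eq[OF w(1), of 1] w(2) by (simp add: algebra_simps)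
  show scaled: "?N * w t = c * periodic_profile q t" if "t \<in> {0..1}" for t
  proof -
    have "int_factor q t * (?N * w t) = c * ?N + (\<kappa> * ?N) * int_factor_prim q t"
      using arg_cong[OF linear_sol_eq[OF w(1) that], of "\<lambda>x. ?N * x"] by (simp add: algebra_simps)
    also have "\<dots> = int_factor q t * (c * periodic_profile q t)"
      unfolding \<kappa> periodic_profile_def int_factor_def by (simp add: exp_minus field_simps)
    finally show ?thesis by (simp add: int_factor_def)
  qed
  have "?N * integral {0..1} w = integral {0..1} (\<lambda>t. ?N * w t)" by simp
  also have "\<dots> = integral {0..1} (\<lambda>t. c * periodic_profile q t)"
    by (rule integral_cong) (rule scaled)
  finally show mean: "?N * integral {0..1} w = c * profile_mean q" by (simp add: profile_mean_def)
  have N: "?N \<noteq> 0" using int_factor_prim_1_pos by simp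
  have "?N * (profile_mean q * w t) = ?N * (integral {0..1} w * periodic_profile q t)" if "t \<in> {0..1}" for t
    using scaled[OF that] mean by (metis (no_types, lifting) mult.assoc mult.commute)
  with N show "profile_mean q * w t = integral {0..1} w * periodic_profile q t" if "t \<in> {0..1}" for t
    using that by simp
  have "?N * (profile_mean q * \<kappa>) = ?N * (integral {0..1} w * (int_factor q 1 - 1))"
    using \<kappa> mean by (metis (no_types, lifting) mult.assoc mult.commute)
  with N show "profile_mean q * \<kappa> = integral {0..1} w * (int_factor q 1 - 1)" by simp
qed

end

lemma
  assumes I: "open I" "convex I" and q: "param_Ck I k q"
  shows param_Ck_int_factor: "param_Ck I k (\<lambda>p. int_factor (q p))"
    and param_Ck_periodic_profile: "param_Ck I k (\<lambda>p. periodic_profile (q p))"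
    and param_Ck_profile_mean: "param_Ck I k (\<lambda>p t. profile_mean (q p))"
proof -
  show E: "param_Ck I k (\<lambda>p. int_factor (q p))"
    unfolding int_factor_def[abs_def] by (intro param_Ck_exp param_Ck_integral I q)
  have J: "param_Ck I k (\<lambda>p. int_factor_prim (q p))"
    unfolding int_factor_prim_def[abs_def] by (rule param_Ck_integral[OF I E])
  show B: "param_Ck I k (\<lambda>p. periodic_profile (q p))"
    unfolding periodic_profile_def[abs_def]
    by (intro param_Ck_mult param_Ck_exp param_Ck_minus param_Ck_add param_Ck_diff
        param_Ck_integral[OF I q] J param_Ck_eval[OF _ J] param_Ck_eval[OF _ E]) auto
  show "param_Ck I k (\<lambda>p t. profile_mean (q p))"
    unfolding profile_mean_def by (rule param_Ck_eval[OF _ param_Ck_integral[OF I B]]) simp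
qed

section \<open>The integral equation\<close>

text \<open>With \<open>V\<close> a primitive of the forcing \<open>v\<close> and
  \<open>V 0 = 0\<close>, this is \<open>y' + g t y = v + \<kappa>\<close>, \<open>y 0 = a\<close>.
  In integrated form continuous and square-integrable forcings are treated alike.\<close>

definition integral_sol ::
    "(real \<Rightarrow> real \<Rightarrow> real) \<Rightarrow> (real \<Rightarrow> real) \<Rightarrow> real \<Rightarrow> real \<Rightarrow> (real \<Rightarrow> real) \<Rightarrow> bool" where
  "integral_sol g V a \<kappa> y \<longleftrightarrow> continuous_on {0..1} y \<and>
     (\<forall>t\<in>{0..1}. y t = a + V t + \<kappa> * t - integral {0..t} (\<lambda>s. g s (y s)))"

lemma integral_solI:
  assumes "continuous_on {0..1} y"
    and "\<And>t. t \<in> {0..1} \<Longrightarrow> y t = a + V t + \<kappa> * t - integral {0..t} (\<lambda>s. g s (y s))"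
  shows "integral_sol g V a \<kappa> y"
  using assms by (simp add: integral_sol_def)

text \<open>Picard iteration for \<open>z(t) = exp (- K t) y(t)\<close>, which is contracting in the sup norm on the whole
  of \<open>[0,1]\<close> once \<open>K > L\<close>.\<close>

lemma integral_sol_exists:
  assumes g: "continuous_on UNIV (\<lambda>(t, s). g t s)"
    and lip: "\<And>t x y. t \<in> {0..1} \<Longrightarrow> \<bar>g t x - g t y\<bar> \<le> L * \<bar>x - y\<bar>"
    and V: "continuous_on {0..1} V"
  shows "\<exists>y. integral_sol g V a \<kappa> y"
proof -
  have L: "0 \<le> L" using lip[of 0 1 0] by simp
  \<comment> \<open>This choice gives \<open>L / K \<le> 1 / 2\<close>, the contraction factor
    below.\<close>
  define K where "K = 2 * L + 1"
  have K: "K > 0" "2 * L \<le> K" using L by (auto simp: K_def)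
  define G where "G z s = g s (exp (K * s) * apply_bcontfun z s)" for z :: "real \<Rightarrow>\<^sub>C real" and s
  define P where "P z t = exp (- (K * t)) * (a + V t + \<kappa> * t - integral {0..t} (G z))"
    for z :: "real \<Rightarrow>\<^sub>C real" and t
  \<comment> \<open>Bounded continuous functions live on the whole line, so time is clamped to
    \<open>[0,1]\<close>, where \<open>P z\<close> is unaffected.\<close>
  define cl where "cl t = max 0 (min 1 t)" for t :: real
  have cl: "cl t \<in> {0..1}" "t \<in> {0..1} \<Longrightarrow> cl t = t" for t by (auto simp: cl_def)
  have ccl: "continuous_on UNIV cl" unfolding cl_def by (intro continuous_intros)
  define T where "T z = Bcontfun (\<lambda>t. P z (cl t))" for z
  have cG: "continuous_on {0..1} (G z)" for z
    unfolding G_def by (intro continuous_on_nonlinearity[OF g] continuous_intros) simp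
  have cP: "continuous_on {0..1} (P z)" for z
    unfolding P_def by (intro continuous_intros V continuous_on_initial_integral cG)
  have bc: "(\<lambda>t. P z (cl t)) \<in> bcontfun" for z
  proof -
    have "continuous_on UNIV (\<lambda>t. P z (cl t))"
      by (rule continuous_on_compose2[OF cP ccl]) (use cl in auto)
    moreover have "bounded (P z ` {0..1})"
      by (intro compact_imp_bounded compact_continuous_image cP compact_Icc)
    then have "bounded (range (\<lambda>t. P z (cl t)))"
      by (rule bounded_subset) (use cl in blast)
    ultimately show ?thesis by (simp add: bcontfun_def)
  qed
  have T: "apply_bcontfun (T z) t = P z (cl t)" for z t
    unfolding T_def by (simp add: Bcontfun_inverse[OF bc])
  have "dist (T z1) (T z2) \<le> (1 / 2) * dist z1 z2" for z1 z2
  proof (rule dist_bound)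
    fix x :: real
    define t where "t = cl x"
    have t: "t \<in> {0..1}" using cl by (simp add: t_def)
    define d where "d = dist z1 z2"
    have d: "0 \<le> d" by (simp add: d_def)
    have int: "G z integrable_on {0..t}" for z by (rule integrable_on_initial[OF cG t])
    \<comment> \<open>The integrated Lipschitz bound grows like
      \<open>L * d / K * exp (K * t)\<close>, and the factor \<open>exp (- (K * t))\<close> in
      \<open>P\<close> cancels this growth.\<close>
    have dE: "((\<lambda>s. L * exp (K * s) * d) has_integral (L * d / K * exp (K * t) - L * d / K * exp (K * 0))) {0..t}"
      using t K by (intro fundamental_theorem_of_calculus)
        (auto intro!: derivative_eq_intros simp flip: has_real_derivative_iff_has_vector_derivative)
    have "norm (integral {0..t} (\<lambda>s. G z2 s - G z1 s)) \<le> integral {0..t} (\<lambda>s. L * exp (K * s) * d)"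
    proof (rule integral_norm_bound_integral[OF integrable_diff[OF int int] has_integral_integrable[OF dE]])
      fix s assume s: "s \<in> {0..t}"
      then have "norm (G z2 s - G z1 s) \<le> L * \<bar>exp (K * s) * z2 s - exp (K * s) * z1 s\<bar>"
        unfolding G_def real_norm_def using t by (intro lip) auto
      also have "\<dots> = L * exp (K * s) * \<bar>z1 s - z2 s\<bar>"
        by (simp add: abs_mult abs_minus_commute flip: right_diff_distrib)
      also have "\<dots> \<le> L * exp (K * s) * d"
        using dist_bounded[of z1 s z2] L by (intro mult_left_mono) (auto simp: d_def dist_real_def)
      finally show "norm (G z2 s - G z1 s) \<le> L * exp (K * s) * d" .
    qed
    also have "\<dots> = L * d / K * exp (K * t) - L * d / K" using integral_unique[OF dE] by simp
    also have "\<dots> \<le> L * d / K * exp (K * t)" using L d K by simp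
    finally have *: "\<bar>integral {0..t} (\<lambda>s. G z2 s - G z1 s)\<bar> \<le> L * d / K * exp (K * t)" by simp
    have "dist (T z1 x) (T z2 x) = exp (- (K * t)) * \<bar>integral {0..t} (\<lambda>s. G z2 s - G z1 s)\<bar>"
      by (simp add: T P_def dist_real_def integral_diff[OF int int] abs_mult flip: t_def right_diff_distrib)
    also have "\<dots> \<le> exp (- (K * t)) * (L * d / K * exp (K * t))" by (rule mult_left_mono[OF *]) simp
    also have "\<dots> = L * d / K" by (simp add: exp_minus)
    also have "\<dots> \<le> 1 / 2 * d" using K d L mult_right_mono[OF K(2) d] by (simp add: field_simps)
    finally show "dist (T z1 x) (T z2 x) \<le> 1 / 2 * dist z1 z2" by (simp add: d_def)
  qed
  then obtain z where z: "T z = z" using banach_fix_type[of "1 / 2" T] by auto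
  show ?thesis
  proof (rule exI, rule integral_solI)
    let ?y = "\<lambda>t. exp (K * t) * z t"
    show "continuous_on {0..1} ?y" by (intro continuous_intros) simp
    fix t :: real assume t: "t \<in> {0..1}"
    have "z t = P z t" using T[of z t] cl(2)[OF t] z by simp
    then show "?y t = a + V t + \<kappa> * t - integral {0..t} (\<lambda>s. g s (?y s))"
      by (simp add: P_def G_def[abs_def] exp_minus field_simps)
  qed
qed

text \<open>Hadamard's form of the difference quotient: the average of \<open>g'\<close> over the
  segment from \<open>y\<close> to \<open>x\<close>. For continuous \<open>g'\<close> it is
  continuous also across \<open>x = y\<close>, where the quotient itself is undefined.\<close>

definition avg_deriv :: "(real \<Rightarrow> real \<Rightarrow> real) \<Rightarrow> real \<Rightarrow> real \<Rightarrow> real \<Rightarrow> real" where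
  "avg_deriv g' t x y = integral {0..1} (\<lambda>\<sigma>. g' t (y + \<sigma> * (x - y)))"

lemma avg_deriv_same: "avg_deriv g' t x x = g' t x"
  by (simp add: avg_deriv_def)

context
  fixes g' :: "real \<Rightarrow> real \<Rightarrow> real"
  assumes g': "continuous_on UNIV (\<lambda>(t, s). g' t s)"
begin

lemma continuous_on_avg_deriv:
  fixes a b c :: "'a :: topological_space \<Rightarrow> real"
  assumes "continuous_on A a" "continuous_on A b" "continuous_on A c"
  shows "continuous_on A (\<lambda>x. avg_deriv g' (a x) (b x) (c x))"
proof -
  have *: "continuous_on (A \<times> cbox 0 (1::real)) (\<lambda>z. h (fst z))"
    if "continuous_on A h" for h :: "'a \<Rightarrow> real"
    by (rule continuous_on_compose2[OF that]) (auto intro: continuous_intros)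
  have "continuous_on (A \<times> cbox 0 (1::real))
      (\<lambda>z. g' (a (fst z)) (c (fst z) + snd z * (b (fst z) - c (fst z))))"
    by (intro continuous_on_nonlinearity[OF g'] continuous_intros * assms)
  then have "continuous_on A (\<lambda>x. integral (cbox 0 1) (\<lambda>\<sigma>. g' (a x) (c x + \<sigma> * (b x - c x))))"
    by (intro integral_continuous_on_param) (simp add: split_beta)
  then show ?thesis by (simp add: avg_deriv_def)
qed

lemma continuous_on_segment: "continuous_on {0..1} (\<lambda>\<sigma>. g' t (y + \<sigma> * (x - y)))"
  by (intro continuous_on_nonlinearity[OF g'] continuous_intros)

lemma diff_eq_avg_deriv:
  assumes "\<And>s. (g t has_real_derivative g' t s) (at s)"
  shows "g t x - g t y = avg_deriv g' t x y * (x - y)"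
proof -
  have "((\<lambda>\<sigma>. g' t (y + \<sigma> * (x - y)) * (x - y)) has_integral
      (g t (y + 1 * (x - y)) - g t (y + 0 * (x - y)))) {0..1}"
  proof (rule fundamental_theorem_of_calculus)
    fix \<sigma> :: real
    have "((\<lambda>\<sigma>. g t (y + \<sigma> * (x - y))) has_real_derivative g' t (y + \<sigma> * (x - y)) * (x - y)) (at \<sigma> within {0..1})"
      by (rule DERIV_chain2[OF assms]) (auto intro!: derivative_eq_intros)
    then show "((\<lambda>\<sigma>. g t (y + \<sigma> * (x - y))) has_vector_derivative g' t (y + \<sigma> * (x - y)) * (x - y)) (at \<sigma> within {0..1})"
      by (simp add: has_real_derivative_iff_has_vector_derivative)
  qed simp
  then have "integral {0..1} (\<lambda>\<sigma>. g' t (y + \<sigma> * (x - y)) * (x - y)) = g t x - g t y"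
    by (simp only: integral_unique) simp
  then show ?thesis by (simp add: avg_deriv_def)
qed

lemma abs_avg_deriv_le:
  assumes "\<And>s. \<bar>g' t s\<bar> \<le> L"
  shows "\<bar>avg_deriv g' t x y\<bar> \<le> L"
proof -
  have "norm (avg_deriv g' t x y) \<le> integral {0..1} (\<lambda>_::real. L)"
    unfolding avg_deriv_def
    by (rule integral_norm_bound_integral)
      (use assms integrable_continuous_real[OF continuous_on_segment] in auto)
  then show ?thesis by simp
qed

end

section \<open>Initial and periodic solutions\<close>

text \<open>The upper slope bound gives continuity, and the lower bound \<open>d\<close> forces
  \<open>r\<close> to pass the value \<open>z\<close> within distance
  \<open>\<bar>z - r 0\<bar> / d\<close> of the origin; the intermediate value theorem does the
  rest.\<close>

lemma bilipschitz_surj: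
  fixes r :: "real \<Rightarrow> real"
  assumes d: "0 < d" and \<theta>: "\<And>x y. \<exists>\<theta>. d \<le> \<theta> \<and> \<theta> \<le> C \<and> r x - r y = \<theta> * (x - y)"
  shows "\<exists>x. r x = z"
proof -
  have "C \<ge> 0" using \<theta>[of 0 0] d by auto
  have "C-lipschitz_on UNIV r"
  proof (rule lipschitz_onI)
    fix x y
    obtain \<theta> where "d \<le> \<theta>" "\<theta> \<le> C" "r x - r y = \<theta> * (x - y)" using \<theta> by blast
    with d show "dist (r x) (r y) \<le> C * dist x y"
      by (auto simp: dist_real_def abs_mult intro: mult_right_mono)
  qed fact
  then have cont: "continuous_on UNIV r" by (rule lipschitz_on_continuous_on)
  define R where "R = \<bar>z - r 0\<bar> / d"
  have R: "0 \<le> R" "d * R = \<bar>z - r 0\<bar>" using d by (auto simp: R_def)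
  obtain \<theta>1 where 1: "d \<le> \<theta>1" "r R - r 0 = \<theta>1 * (R - 0)" using \<theta>[of R 0] by blast
  have "d * R \<le> \<theta>1 * R" using 1 R by (intro mult_right_mono) auto
  then have up: "z \<le> r R" using 1 R by auto
  obtain \<theta>2 where 2: "d \<le> \<theta>2" "r 0 - r (- R) = \<theta>2 * (0 - (- R))" using \<theta>[of 0 "- R"] by blast
  have "d * R \<le> \<theta>2 * R" using 2 R by (intro mult_right_mono) auto
  then have lo: "r (- R) \<le> z" using 2 R by auto
  show ?thesis
    using IVT'[of r "- R" z R] up lo R continuous_on_subset[OF cont] by auto
qed

text \<open>An increment splits into a change of parameter at fixed \<open>t\<close>, controlled
  uniformly by the Lipschitz bound, and an increment of a single continuous section.\<close>

lemma continuous_on_param_lipschitz: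
  fixes y :: "real \<Rightarrow> real \<Rightarrow> real"
  assumes lip: "\<And>p p' t. t \<in> {0..1} \<Longrightarrow> \<bar>y p t - y p' t\<bar> \<le> C * \<bar>p - p'\<bar>"
    and cont: "\<And>p. continuous_on {0..1} (y p)"
  shows "continuous_on (I \<times> {0..1}) (\<lambda>(p, t). y p t)"
proof (rule continuous_on_subset[of "UNIV \<times> {0..1}"], unfold continuous_on_def, safe)
  fix p t :: real assume t: "t \<in> {0..1}"
  let ?F = "at (p, t) within UNIV \<times> {0..1}"
  have ev: "\<forall>\<^sub>F x in ?F. snd x \<in> {0..1}"
    unfolding eventually_at_topological by (rule exI[of _ UNIV]) auto
  have id: "((\<lambda>x. x) \<longlongrightarrow> (p, t)) ?F" by (rule tendsto_ident_at)
  have fst: "(fst \<longlongrightarrow> p) ?F" and snd: "(snd \<longlongrightarrow> t) ?F"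
    using tendsto_fst[OF id] tendsto_snd[OF id] by simp_all
  have "((\<lambda>x. C * \<bar>fst x - p\<bar>) \<longlongrightarrow> C * \<bar>p - p\<bar>) ?F" by (intro tendsto_intros fst)
  then have lim0: "((\<lambda>x. C * \<bar>fst x - p\<bar>) \<longlongrightarrow> 0) ?F" by simp
  have "\<forall>\<^sub>F x in ?F. norm (y (fst x) (snd x) - y p (snd x)) \<le> C * \<bar>fst x - p\<bar>"
    using ev by (rule eventually_mono) (simp add: lip)
  then have "((\<lambda>x. y (fst x) (snd x) - y p (snd x)) \<longlongrightarrow> 0) ?F"
    by (rule Lim_null_comparison[OF _ lim0])
  moreover have "((\<lambda>x. y p (snd x)) \<longlongrightarrow> y p t) ?F"
    by (rule continuous_on_tendsto_compose[OF cont snd t ev])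
  ultimately have "((\<lambda>x. y (fst x) (snd x) - y p (snd x) + y p (snd x)) \<longlongrightarrow> 0 + y p t) ?F"
    by (rule tendsto_add)
  then show "((\<lambda>(p, t). y p t) \<longlongrightarrow> y p t) ?F" by (simp add: case_prod_unfold)
qed auto

text \<open>On subtraction \<open>V\<close> cancels, and Hadamard's form turns the difference of the
  nonlinear terms into an exact linear term. The formulas for linear equations then apply to
  solutions that may be far apart.\<close>

lemma integral_sol_diff:
  assumes g: "continuous_on UNIV (\<lambda>(t, s). g t s)" and g': "continuous_on UNIV (\<lambda>(t, s). g' t s)"
    and deriv: "\<And>t s. (g t has_real_derivative g' t s) (at s)"
    and y: "integral_sol g V a1 \<kappa>1 y1" "integral_sol g V a2 \<kappa>2 y2"
  shows "continuous_on {0..1} (\<lambda>t. avg_deriv g' t (y1 t) (y2 t))"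
    and "linear_sol (\<lambda>t. avg_deriv g' t (y1 t) (y2 t)) (a1 - a2) (\<kappa>1 - \<kappa>2) (\<lambda>t. y1 t - y2 t)"
proof -
  have c: "continuous_on {0..1} y1" "continuous_on {0..1} y2" using y by (auto simp: integral_sol_def)
  then show "continuous_on {0..1} (\<lambda>t. avg_deriv g' t (y1 t) (y2 t))"
    by (intro continuous_on_avg_deriv[OF g'] continuous_intros)
  show "linear_sol (\<lambda>t. avg_deriv g' t (y1 t) (y2 t)) (a1 - a2) (\<kappa>1 - \<kappa>2) (\<lambda>t. y1 t - y2 t)"
    unfolding linear_sol_def
  proof (intro conjI ballI)
    show "continuous_on {0..1} (\<lambda>t. y1 t - y2 t)" by (intro continuous_intros c)
    fix t :: real assume t: "t \<in> {0..1}"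
    have int: "(\<lambda>s. g s (y1 s)) integrable_on {0..t}" "(\<lambda>s. g s (y2 s)) integrable_on {0..t}"
      by (rule integrable_on_initial[OF continuous_on_nonlinearity[OF g continuous_on_id c(1)] t]
          integrable_on_initial[OF continuous_on_nonlinearity[OF g continuous_on_id c(2)] t])+
    have "y1 t = a1 + V t + \<kappa>1 * t - integral {0..t} (\<lambda>s. g s (y1 s))"
      "y2 t = a2 + V t + \<kappa>2 * t - integral {0..t} (\<lambda>s. g s (y2 s))"
      using y t by (auto simp: integral_sol_def)
    then have "y1 t - y2 t = a1 - a2 + (\<kappa>1 - \<kappa>2) * t - integral {0..t} (\<lambda>s. g s (y1 s) - g s (y2 s))"
      using integral_diff[OF int] by (simp add: algebra_simps)
    also have "(\<lambda>s. g s (y1 s) - g s (y2 s)) = (\<lambda>s. avg_deriv g' s (y1 s) (y2 s) * (y1 s - y2 s))"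
      by (rule ext, rule diff_eq_avg_deriv[where g = g, OF g' deriv])
    finally show "y1 t - y2 t = a1 - a2 + (\<kappa>1 - \<kappa>2) * t -
        integral {0..t} (\<lambda>s. avg_deriv g' s (y1 s) (y2 s) * (y1 s - y2 s))" .
  qed
qed

lemma integral_sol_unique:
  assumes g: "continuous_on UNIV (\<lambda>(t, s). g t s)" and g': "continuous_on UNIV (\<lambda>(t, s). g' t s)"
    and deriv: "\<And>t s. (g t has_real_derivative g' t s) (at s)"
    and y: "integral_sol g V a \<kappa> y1" "integral_sol g V a \<kappa> y2" and t: "t \<in> {0..1}"
  shows "y1 t = y2 t"
  using linear_sol_eq[OF integral_sol_diff[OF g g' deriv y] t] by (simp add: int_factor_def)

text \<open>The difference is a periodic solution of a linear equation with mean zero, and such a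
  solution is its mean times a profile, up to a positive factor. Applied to the original
  nonlinearity, this yields injectivity of \<open>Psi\<close>.\<close>

lemma integral_sol_periodic_unique:
  assumes g: "continuous_on UNIV (\<lambda>(t, s). g t s)" and g': "continuous_on UNIV (\<lambda>(t, s). g' t s)"
    and deriv: "\<And>t s. (g t has_real_derivative g' t s) (at s)"
    and y: "integral_sol g V a1 \<kappa>1 y1" "integral_sol g V a2 \<kappa>2 y2" "y1 1 = a1" "y2 1 = a2"
    and mean: "integral {0..1} y1 = integral {0..1} y2" and t: "t \<in> {0..1}"
  shows "y1 t = y2 t"
proof -
  have "y1 integrable_on {0..1}" "y2 integrable_on {0..1}"
    using y by (auto simp: integral_sol_def intro: integrable_continuous_real)
  then have "integral {0..1} (\<lambda>t. y1 t - y2 t) = 0" using mean by (simp add: integral_diff)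
  then show ?thesis
    using linear_sol_periodic(4)[OF integral_sol_diff[OF g g' deriv y(1,2)] _ t] y(3,4)
      profile_mean_pos[OF integral_sol_diff(1)[OF g g' deriv y(1,2)]] by simp
qed

text \<open>The global bound \<open>L\<close> yields solutions on all of \<open>[0,1]\<close> for
  every initial value and constant, and comparison constants depending on \<open>L\<close> alone.
  The original nonlinearity enters through a truncation of this kind.\<close>

locale lipschitz_ode =
  fixes g g' :: "real \<Rightarrow> real \<Rightarrow> real" and V :: "real \<Rightarrow> real" and L :: real
  assumes g: "continuous_on UNIV (\<lambda>(t, s). g t s)" and g': "continuous_on UNIV (\<lambda>(t, s). g' t s)"
    and deriv: "\<And>t s. (g t has_real_derivative g' t s) (at s)"
    and bound: "\<And>t s. t \<in> {0..1} \<Longrightarrow> \<bar>g' t s\<bar> \<le> L"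
    and V: "continuous_on {0..1} V" "V 0 = 0"
begin

abbreviation q :: "(real \<Rightarrow> real) \<Rightarrow> (real \<Rightarrow> real) \<Rightarrow> real \<Rightarrow> real" where
  "q y1 y2 t \<equiv> avg_deriv g' t (y1 t) (y2 t)"

lemma q_le: "t \<in> {0..1} \<Longrightarrow> \<bar>q y1 y2 t\<bar> \<le> L"
  by (rule abs_avg_deriv_le[OF g' bound])

lemmas sol_diff = integral_sol_diff[OF g g' deriv]

lemma sol_exists: "\<exists>y. integral_sol g V a \<kappa> y"
proof (rule integral_sol_exists[OF g _ V(1)])
  show "\<bar>g t x - g t y\<bar> \<le> L * \<bar>x - y\<bar>" if "t \<in> {0..1}" for t x y
    unfolding diff_eq_avg_deriv[where g = g, OF g' deriv] abs_mult
    by (intro mult_right_mono abs_avg_deriv_le[OF g' bound[OF that]]) simp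
qed

lemma sol_0: "integral_sol g V a \<kappa> y \<Longrightarrow> y 0 = a"
  by (simp add: integral_sol_def V)

lemma sol_initial_diff:
  assumes y: "integral_sol g V a1 \<kappa> y1" "integral_sol g V a2 \<kappa> y2" and t: "t \<in> {0..1}"
  shows "y1 t - y2 t = inverse (int_factor (q y1 y2) t) * (a1 - a2)"
    and "\<bar>y1 t - y2 t\<bar> \<le> exp L * \<bar>a1 - a2\<bar>"
proof -
  have w: "int_factor (q y1 y2) t * (y1 t - y2 t) = a1 - a2"
    using linear_sol_eq[OF sol_diff[OF y] t] by simp
  then show 1: "y1 t - y2 t = inverse (int_factor (q y1 y2) t) * (a1 - a2)"
    by (simp add: int_factor_def field_simps)
  have "inverse (int_factor (q y1 y2) t) \<le> exp L"
    using int_factor_bounds(4)[OF sol_diff(1)[OF y] q_le[of _ y1 y2] t] by (simp add: int_factor_def exp_minus)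
  then show "\<bar>y1 t - y2 t\<bar> \<le> exp L * \<bar>a1 - a2\<bar>"
    unfolding 1 abs_mult by (intro mult_right_mono) (auto simp: int_factor_def)
qed

text \<open>The formulas for periodic linear solutions, rearranged as a coefficient times a
  parameter difference. The first two coefficients vary continuously with the solutions and will
  serve as Caratheodory difference quotients.\<close>

lemma periodic_sol_diff:
  assumes y: "integral_sol g V (y1 0) \<kappa>1 y1" "integral_sol g V (y2 0) \<kappa>2 y2"
    and p: "y1 1 = y1 0" "y2 1 = y2 0" and t: "t \<in> {0..1}"
  defines "m \<equiv> integral {0..1} y1 - integral {0..1} y2"
  shows "y1 t - y2 t = periodic_profile (q y1 y2) t * inverse (profile_mean (q y1 y2)) * m"
    and "\<kappa>1 - \<kappa>2 = (int_factor (q y1 y2) 1 - 1) * inverse (profile_mean (q y1 y2)) * m"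
    and "m = profile_mean (q y1 y2) / int_factor_prim (q y1 y2) 1 * (y1 0 - y2 0)"
proof -
  note d = sol_diff[OF y]
  have "y1 integrable_on {0..1}" "y2 integrable_on {0..1}"
    using y by (auto simp: integral_sol_def intro: integrable_continuous_real)
  then have m: "integral {0..1} (\<lambda>t. y1 t - y2 t) = m" by (simp add: integral_diff m_def)
  have M: "profile_mean (q y1 y2) \<noteq> 0" using profile_mean_pos[OF d(1)] by simp
  have N: "int_factor_prim (q y1 y2) 1 \<noteq> 0" using int_factor_prim_1_pos[OF d(1)] by simp
  have e: "y1 1 - y2 1 = y1 0 - y2 0" using p by simp
  note per = linear_sol_periodic[OF d e, unfolded m]
  show "y1 t - y2 t = periodic_profile (q y1 y2) t * inverse (profile_mean (q y1 y2)) * m"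
    using per(4)[OF t] M by (simp add: field_simps)
  show "\<kappa>1 - \<kappa>2 = (int_factor (q y1 y2) 1 - 1) * inverse (profile_mean (q y1 y2)) * m"
    using per(5) M by (simp add: field_simps)
  show "m = profile_mean (q y1 y2) / int_factor_prim (q y1 y2) 1 * (y1 0 - y2 0)"
    using per(3) N by (simp add: field_simps)
qed

text \<open>Shooting twice: \<open>\<kappa>\<close> is adjusted until the solution starting at
  \<open>a\<close> returns to \<open>a\<close>, then \<open>a\<close> is adjusted until the mean is
  \<open>c\<close>. Both maps have slopes between positive constants, hence are surjective.\<close>

lemma periodic_sol_exists:
  "\<exists>y \<kappa>. integral_sol g V (y 0) \<kappa> y \<and> y 1 = y 0 \<and> integral {0..1} y = c"
proof -
  have two: "exp (- (2 * L)) = exp (- L) * exp (- L)" "exp (2 * L) = exp L * exp L"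
    by (simp_all flip: exp_add)
  have shoot: "\<exists>y \<kappa>. integral_sol g V a \<kappa> y \<and> y 1 = a" for a
  proof -
    obtain Y where Y: "\<And>\<kappa>. integral_sol g V a \<kappa> (Y \<kappa>)" using sol_exists[of a] by metis
    have "\<exists>\<theta>. exp (- (2 * L)) \<le> \<theta> \<and> \<theta> \<le> exp (2 * L) \<and> Y \<kappa>1 1 - Y \<kappa>2 1 = \<theta> * (\<kappa>1 - \<kappa>2)" for \<kappa>1 \<kappa>2
    proof -
      let ?q = "q (Y \<kappa>1) (Y \<kappa>2)"
      note d = sol_diff[OF Y[of \<kappa>1] Y[of \<kappa>2]]
      have b: "0 \<le> int_factor_prim ?q 1" using int_factor_prim_1_pos[OF d(1)] by simp
      note b = this int_factor_bounds(3,4)[OF d(1) q_le[of _ "Y \<kappa>1" "Y \<kappa>2"], of 1] int_factor_prim_bounds(1,2)[OF d(1) q_le[of _ "Y \<kappa>1" "Y \<kappa>2"]]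
      have "int_factor ?q 1 * (Y \<kappa>1 1 - Y \<kappa>2 1) = (\<kappa>1 - \<kappa>2) * int_factor_prim ?q 1"
        using linear_sol_eq[OF d, of 1] by simp
      then have "Y \<kappa>1 1 - Y \<kappa>2 1 = exp (- integral {0..1} ?q) * int_factor_prim ?q 1 * (\<kappa>1 - \<kappa>2)"
        by (simp add: int_factor_def exp_minus field_simps)
      moreover have "exp (- L) * exp (- L) \<le> exp (- integral {0..1} ?q) * int_factor_prim ?q 1"
        "exp (- integral {0..1} ?q) * int_factor_prim ?q 1 \<le> exp L * exp L"
        by (intro mult_mono b; simp)+
      ultimately show ?thesis unfolding two by blast
    qed
    from bilipschitz_surj[OF _ this, of a] obtain \<kappa> where "Y \<kappa> 1 = a" by auto
    with Y[of \<kappa>] show ?thesis by blast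
  qed
  then obtain Y \<kappa> where Y: "\<And>a. integral_sol g V a (\<kappa> a) (Y a)" "\<And>a. Y a 1 = a" by metis
  have Y0: "Y a 0 = a" for a using sol_0[OF Y(1)] .
  \<comment> \<open>The second shooting map sends \<open>a\<close> to the mean; its slope is the
    ratio of \<open>profile_mean\<close> to \<open>int_factor_prim\<close> at
    \<open>1\<close>.\<close>
  have "\<exists>\<theta>. exp (- (2 * L)) \<le> \<theta> \<and> \<theta> \<le> exp (2 * L) \<and>
      integral {0..1} (Y a) - integral {0..1} (Y b) = \<theta> * (a - b)" for a b
  proof -
    have s: "integral_sol g V (Y a 0) (\<kappa> a) (Y a)" "integral_sol g V (Y b 0) (\<kappa> b) (Y b)"
      by (simp_all add: Y0 Y)
    note d = sol_diff(1)[OF s]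
    have "integral {0..1} (Y a) - integral {0..1} (Y b) =
        profile_mean (q (Y a) (Y b)) / int_factor_prim (q (Y a) (Y b)) 1 * (Y a 0 - Y b 0)"
      by (rule periodic_sol_diff(3)[OF s, of 0]) (simp_all add: Y0 Y)
    moreover have "exp (- (2 * L)) \<le> profile_mean (q (Y a) (Y b)) / int_factor_prim (q (Y a) (Y b)) 1"
      "profile_mean (q (Y a) (Y b)) / int_factor_prim (q (Y a) (Y b)) 1 \<le> exp (2 * L)"
      using profile_mean_bounds[OF d q_le[of _ "Y a" "Y b"]] int_factor_prim_1_pos[OF d] by (simp_all add: field_simps)
    ultimately show ?thesis unfolding Y0 by blast
  qed
  from bilipschitz_surj[OF _ this, of c] obtain a where "integral {0..1} (Y a) = c" by auto
  with Y[of a] Y0[of a] show ?thesis by (intro exI[of _ "Y a"] exI[of _ "\<kappa> a"]) simp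
qed

text \<open>The profile and its mean both lie within factors \<open>exp (- (2 * L))\<close> and
  \<open>exp (2 * L)\<close> of the same number \<open>?N\<close>, so their quotient lies between
  \<open>exp (- (4 * L))\<close> and \<open>exp (4 * L)\<close>.\<close>

lemma periodic_sol_bounds:
  assumes y: "integral_sol g V (y1 0) \<kappa>1 y1" "integral_sol g V (y2 0) \<kappa>2 y2"
    and p: "y1 1 = y1 0" "y2 1 = y2 0" and t: "t \<in> {0..1}"
  defines "m \<equiv> integral {0..1} y1 - integral {0..1} y2"
  shows "exp (- (4 * L)) * \<bar>m\<bar> \<le> \<bar>y1 t - y2 t\<bar>" "\<bar>y1 t - y2 t\<bar> \<le> exp (4 * L) * \<bar>m\<bar>"
proof -
  let ?B = "periodic_profile (q y1 y2) t" and ?M = "profile_mean (q y1 y2)" and ?N = "int_factor_prim (q y1 y2) 1"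
  note d = sol_diff(1)[OF y]
  have N: "0 < ?N" by (rule int_factor_prim_1_pos[OF d])
  have M: "0 < ?M" by (rule profile_mean_pos[OF d])
  note b = periodic_profile_bounds[OF d q_le[of _ y1 y2] t] profile_mean_bounds[OF d q_le[of _ y1 y2]]
  have four: "exp (4 * L) = exp (2 * L) * exp (2 * L)" "exp (- (4 * L)) = exp (- (2 * L)) * exp (- (2 * L))"
    by (simp_all flip: exp_add)
  have inv: "exp (- (2 * L)) * exp (2 * L) = 1" "exp (2 * L) * exp (- (2 * L)) = 1" by (simp_all flip: exp_add)
  have "exp (- (4 * L)) * ?M \<le> exp (- (2 * L)) * (exp (- (2 * L)) * (exp (2 * L) * ?N))"
    unfolding four mult.assoc by (intro mult_left_mono b) auto
  also have "\<dots> \<le> ?B" using b(1) inv by (simp flip: mult.assoc)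
  finally have lo: "exp (- (4 * L)) \<le> ?B / ?M" using M by (simp add: field_simps)
  have "?B \<le> exp (2 * L) * (exp (2 * L) * (exp (- (2 * L)) * ?N))"
    using b(2) inv by (simp flip: mult.assoc)
  also have "\<dots> \<le> exp (4 * L) * ?M"
    unfolding four mult.assoc by (intro mult_left_mono b) auto
  finally have hi: "?B / ?M \<le> exp (4 * L)" using M by (simp add: field_simps)
  have B: "0 < ?B / ?M" using lo exp_gt_zero[of "- (4 * L)"] by linarith
  have eq: "\<bar>y1 t - y2 t\<bar> = ?B / ?M * \<bar>m\<bar>"
  proof -
    have "y1 t - y2 t = ?B / ?M * m"
      using periodic_sol_diff(1)[OF y p t] by (simp add: m_def divide_inverse)
    then show ?thesis using B by (simp only: abs_mult abs_of_pos)
  qed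
  show "exp (- (4 * L)) * \<bar>m\<bar> \<le> \<bar>y1 t - y2 t\<bar>" "\<bar>y1 t - y2 t\<bar> \<le> exp (4 * L) * \<bar>m\<bar>"
    unfolding eq using lo hi by (intro mult_right_mono; simp)+
qed

end

section \<open>Smooth dependence of solutions\<close>

lemma param_isCont:
  fixes y :: "real \<Rightarrow> real \<Rightarrow> real"
  assumes "continuous_on (I \<times> {0..1}) (\<lambda>(p, t). y p t)" "open I" "p \<in> I" "t \<in> {0..1}"
  shows "isCont (\<lambda>p. y p t) p"
proof -
  have "continuous_on (I \<times> {0..1}) (\<lambda>x. y (fst x) (snd x))" using assms by (simp add: split_beta)
  from continuous_on_compose2[OF this, of I "\<lambda>p. (p, t)"] assms(4)
  have "continuous_on I (\<lambda>p. y p t)" by (simp add: image_subset_iff continuous_intros)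
  then show ?thesis using assms by (simp add: continuous_on_eq_continuous_at)
qed

context lipschitz_ode
begin

lemma param_continuous_q:
  assumes "continuous_on (I \<times> {0..1}) (\<lambda>(p, t). y p t)" "continuous_on {0..1} z"
  shows "param_Ck I 0 (\<lambda>p. q (y p) z)"
proof -
  have "continuous_on (I \<times> {0..1}) (\<lambda>x. z (snd x))"
    by (rule continuous_on_compose2[OF assms(2)]) (auto intro!: continuous_intros)
  then show ?thesis
    using assms(1) unfolding param_Ck.simps split_beta
    by (intro continuous_on_avg_deriv[OF g'] continuous_intros)
qed

lemma q_same: "q y y = (\<lambda>t. g' t (y t))"
  by (simp add: avg_deriv_same)

text \<open>The truncated \<open>g'\<close> is only assumed continuous. Along a family that stays
  where it agrees with a smooth \<open>h\<close>, the coefficient still inherits the class of the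
  family.\<close>

lemma param_Ck_coefficient:
  assumes I: "open I" and h: "Ck k h" and y: "param_Ck I k y"
    and eq: "\<And>p t. p \<in> I \<Longrightarrow> t \<in> {0..1} \<Longrightarrow> g' t (y p t) = h t (y p t)"
  shows "param_Ck I k (\<lambda>p t. g' t (y p t))"
  by (rule param_Ck_cong[OF I param_Ck_compose[OF h y] eq])

section \<open>Solutions parametrized by their initial value\<close>

context
  fixes y :: "real \<Rightarrow> real \<Rightarrow> real"
  assumes y: "\<And>a. integral_sol g V a 0 (y a)"
begin

lemma initial_family_continuous: "continuous_on (I \<times> {0..1}) (\<lambda>(a, t). y a t)"
proof (rule continuous_on_param_lipschitz)
  show "\<bar>y a t - y b t\<bar> \<le> exp L * \<bar>a - b\<bar>" if "t \<in> {0..1}" for a b t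
    by (rule sol_initial_diff(2)[OF y y that])
  show "continuous_on {0..1} (y a)" for a using y[of a] by (simp add: integral_sol_def)
qed

text \<open>Caratheodory's criterion: the exact formula for \<open>y z t - y a t\<close> supplies a
  difference quotient that is continuous in \<open>z\<close>, and its value at \<open>z = a\<close>
  is the derivative.\<close>

lemma initial_family_deriv:
  assumes t: "t \<in> {0..1}"
  shows "((\<lambda>a. y a t) has_real_derivative inverse (int_factor (\<lambda>t. g' t (y a t)) t)) (at a)"
  unfolding CARAT_DERIV
proof (intro exI[of _ "\<lambda>z. inverse (int_factor (q (y z) (y a)) t)"] conjI allI)
  show "y z t - y a t = inverse (int_factor (q (y z) (y a)) t) * (z - a)" for z
    by (rule sol_initial_diff(1)[OF y y t])
  have "param_Ck UNIV 0 (\<lambda>z. q (y z) (y a))"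
    by (rule param_continuous_q[OF initial_family_continuous]) (use y[of a] in \<open>simp add: integral_sol_def\<close>)
  then have "param_Ck UNIV 0 (\<lambda>z t. inverse (int_factor (q (y z) (y a)) t))"
    by (intro param_Ck_inverse param_Ck_int_factor) (auto simp: int_factor_def)
  then show "isCont (\<lambda>z. inverse (int_factor (q (y z) (y a)) t)) a"
    using t by (intro param_isCont[where I = UNIV]) (simp_all only: param_Ck.simps open_UNIV UNIV_I)
  show "inverse (int_factor (q (y a) (y a)) t) = inverse (int_factor (\<lambda>t. g' t (y a t)) t)"
    by (simp only: q_same)
qed

text \<open>Bootstrap: the derivative is an expression in \<open>g'\<close> along \<open>y\<close>,
  so class \<open>k\<close> of \<open>y\<close> gives class \<open>k\<close> of the derivative and
  hence class \<open>Suc k\<close> of \<open>y\<close>.\<close>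

lemma initial_family_smooth:
  assumes I: "open I" "convex I" and h: "\<And>k. Ck k h"
    and eq: "\<And>p t. p \<in> I \<Longrightarrow> t \<in> {0..1} \<Longrightarrow> g' t (y p t) = h t (y p t)"
  shows "param_Ck I k y"
proof (induction k)
  case 0
  then show ?case by (simp add: initial_family_continuous)
next
  case (Suc k)
  show ?case
  proof (rule param_Ck_Suc[OF initial_family_deriv _ initial_family_continuous])
    show "param_Ck I k (\<lambda>a t. inverse (int_factor (\<lambda>t. g' t (y a t)) t))"
      by (intro param_Ck_inverse param_Ck_int_factor param_Ck_coefficient[OF I(1) h Suc eq] I)
        (auto simp: int_factor_def)
  qed
qed

end

section \<open>Periodic solutions parametrized by their mean\<close>

context
  fixes u :: "real \<Rightarrow> real \<Rightarrow> real" and \<kappa> :: "real \<Rightarrow> real"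
  assumes u: "\<And>c. integral_sol g V (u c 0) (\<kappa> c) (u c)" "\<And>c. u c 1 = u c 0"
    and mean: "\<And>c. integral {0..1} (u c) = c"
begin

lemma periodic_family_continuous: "continuous_on (I \<times> {0..1}) (\<lambda>(c, t). u c t)"
proof (rule continuous_on_param_lipschitz)
  show "\<bar>u c t - u d t\<bar> \<le> exp (4 * L) * \<bar>c - d\<bar>" if "t \<in> {0..1}" for c d t
    using periodic_sol_bounds(2)[OF u(1)[of c] u(1)[of d] u(2)[of c] u(2)[of d] that] by (simp add: mean)
  show "continuous_on {0..1} (u c)" for c using u(1)[of c] by (simp add: integral_sol_def)
qed

text \<open>Continuity of the difference quotients that Caratheodory's criterion requires for
  \<open>u\<close> and \<open>\<kappa>\<close>; positivity of the profile mean permits the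
  inverse.\<close>

lemma
  shows param_Ck_UNIV_profile: "param_Ck UNIV 0 (\<lambda>z t. periodic_profile (q (u z) (u c)) t * inverse (profile_mean (q (u z) (u c))))"
    and param_Ck_UNIV_factor: "param_Ck UNIV 0 (\<lambda>z t. (int_factor (q (u z) (u c)) 1 - 1) * inverse (profile_mean (q (u z) (u c))))"
proof -
  have 0: "param_Ck UNIV 0 (\<lambda>z. q (u z) (u c))"
    by (rule param_continuous_q[OF periodic_family_continuous]) (use u(1)[of c] in \<open>simp add: integral_sol_def\<close>)
  have M: "profile_mean (q (u z) (u c)) \<noteq> 0" for z
    using profile_mean_pos[OF sol_diff(1)[OF u(1)[of z] u(1)[of c]]] by simp
  show "param_Ck UNIV 0 (\<lambda>z t. periodic_profile (q (u z) (u c)) t * inverse (profile_mean (q (u z) (u c))))"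
    by (intro param_Ck_mult param_Ck_inverse param_Ck_periodic_profile param_Ck_profile_mean 0 M) auto
  show "param_Ck UNIV 0 (\<lambda>z t. (int_factor (q (u z) (u c)) 1 - 1) * inverse (profile_mean (q (u z) (u c))))"
    by (intro param_Ck_mult param_Ck_inverse param_Ck_diff param_Ck_const param_Ck_profile_mean
        param_Ck_eval[OF _ param_Ck_int_factor] 0 M) auto
qed

lemma periodic_family_deriv:
  assumes t: "t \<in> {0..1}"
  shows "((\<lambda>c. u c t) has_real_derivative
    periodic_profile (\<lambda>t. g' t (u c t)) t * inverse (profile_mean (\<lambda>t. g' t (u c t)))) (at c)"
  unfolding CARAT_DERIV
proof (intro exI[of _ "\<lambda>z. periodic_profile (q (u z) (u c)) t * inverse (profile_mean (q (u z) (u c)))"] conjI allI)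
  show "u z t - u c t = periodic_profile (q (u z) (u c)) t * inverse (profile_mean (q (u z) (u c))) * (z - c)" for z
    using periodic_sol_diff(1)[OF u(1)[of z] u(1)[of c] u(2)[of z] u(2)[of c] t] by (simp only: mean)
  show "isCont (\<lambda>z. periodic_profile (q (u z) (u c)) t * inverse (profile_mean (q (u z) (u c)))) c"
    using t param_Ck_UNIV_profile by (intro param_isCont[where I = UNIV]) (simp_all only: param_Ck.simps open_UNIV UNIV_I)
qed (simp only: q_same)

lemma periodic_forcing_deriv:
  "(\<kappa> has_real_derivative
    (int_factor (\<lambda>t. g' t (u c t)) 1 - 1) * inverse (profile_mean (\<lambda>t. g' t (u c t)))) (at c)"
  unfolding CARAT_DERIV
proof (intro exI[of _ "\<lambda>z. (int_factor (q (u z) (u c)) 1 - 1) * inverse (profile_mean (q (u z) (u c)))"] conjI allI)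
  show "\<kappa> z - \<kappa> c = (int_factor (q (u z) (u c)) 1 - 1) * inverse (profile_mean (q (u z) (u c))) * (z - c)" for z
    using periodic_sol_diff(2)[OF u(1)[of z] u(1)[of c] u(2)[of z] u(2)[of c], of 0] by (simp add: mean)
  show "isCont (\<lambda>z. (int_factor (q (u z) (u c)) 1 - 1) * inverse (profile_mean (q (u z) (u c)))) c"
    using param_Ck_UNIV_factor
    by (intro param_isCont[where I = UNIV and t = 0]) (simp_all only: param_Ck.simps open_UNIV UNIV_I, simp_all)
qed (simp only: q_same)

text \<open>The bootstrap for \<open>u\<close> runs as for initial values. Smoothness of
  \<open>\<kappa>\<close> follows because its derivative is expressed through
  \<open>u\<close>.\<close>

lemma periodic_family_smooth:
  assumes I: "open I" "convex I" and h: "\<And>k. Ck k h"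
    and eq: "\<And>p t. p \<in> I \<Longrightarrow> t \<in> {0..1} \<Longrightarrow> g' t (u p t) = h t (u p t)"
  shows "param_Ck I k u" and "param_Ck I k (\<lambda>c t. \<kappa> c)"
proof -
  have M: "profile_mean (\<lambda>t. g' t (u c t)) \<noteq> 0" for c
    using profile_mean_pos[OF sol_diff(1)[OF u(1)[of c] u(1)[of c]]] by (simp add: q_same)
  show u_smooth: "param_Ck I k u" for k
  proof (induction k)
    case 0
    then show ?case by (simp add: periodic_family_continuous)
  next
    case (Suc k)
    note q = param_Ck_coefficient[OF I(1) h Suc eq]
    show ?case
    proof (rule param_Ck_Suc[OF periodic_family_deriv _ periodic_family_continuous])
      show "param_Ck I k (\<lambda>c t. periodic_profile (\<lambda>t. g' t (u c t)) t * inverse (profile_mean (\<lambda>t. g' t (u c t))))"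
        by (intro param_Ck_mult param_Ck_inverse param_Ck_periodic_profile[OF I q] param_Ck_profile_mean[OF I q] M)
    qed
  qed
  note q = param_Ck_coefficient[OF I(1) h u_smooth eq]
  have "continuous_on UNIV \<kappa>"
    by (intro continuous_at_imp_continuous_on ballI DERIV_isCont[OF periodic_forcing_deriv])
  then have "continuous_on (I \<times> {0..1}) (\<lambda>x. \<kappa> (fst x))"
    by (rule continuous_on_compose2) (auto intro: continuous_intros)
  then have c: "continuous_on (I \<times> {0..1::real}) (\<lambda>(c, t). \<kappa> c)" by (simp add: split_beta)
  show "param_Ck I k (\<lambda>c t. \<kappa> c)"
  \<comment> \<open>The derivative formula yields class \<open>Suc k\<close> for
    \<open>\<kappa>\<close>, from which class \<open>k\<close> is extracted.\<close>
  proof (rule param_Ck_SucD, rule param_Ck_Suc[OF periodic_forcing_deriv _ c])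
    show "param_Ck I k (\<lambda>c t. (int_factor (\<lambda>t. g' t (u c t)) 1 - 1) * inverse (profile_mean (\<lambda>t. g' t (u c t))))"
      by (intro param_Ck_mult param_Ck_inverse param_Ck_diff param_Ck_const param_Ck_profile_mean[OF I q]
          param_Ck_eval[OF _ param_Ck_int_factor[OF I q]] M) auto
  qed
qed

end

end

section \<open>Order of vanishing\<close>

text \<open>A growth bound in place of vanishing derivatives: it survives a bi-Lipschitz change of
  variable, so two functions can be compared without a higher-order chain rule.\<close>

definition vanishes_to_order :: "nat \<Rightarrow> (real \<Rightarrow> real) \<Rightarrow> real \<Rightarrow> bool" where
  "vanishes_to_order n \<psi> x0 \<longleftrightarrow> (\<exists>C. \<exists>\<delta>>0. \<forall>x. \<bar>x - x0\<bar> < \<delta> \<longrightarrow> \<bar>\<psi> x\<bar> \<le> C * \<bar>x - x0\<bar> ^ n)"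

lemma vanishes_to_order_cong:
  assumes "\<epsilon> > 0" "\<And>x. \<bar>x - x0\<bar> < \<epsilon> \<Longrightarrow> \<psi> x = \<xi> x"
  shows "vanishes_to_order n \<psi> x0 \<longleftrightarrow> vanishes_to_order n \<xi> x0"
proof -
  have *: "vanishes_to_order n b x0" if a: "vanishes_to_order n a x0" and eq: "\<And>x. \<bar>x - x0\<bar> < \<epsilon> \<Longrightarrow> a x = b x" for a b
  proof -
    obtain C \<delta> where "\<delta> > 0" "\<forall>x. \<bar>x - x0\<bar> < \<delta> \<longrightarrow> \<bar>a x\<bar> \<le> C * \<bar>x - x0\<bar> ^ n"
      using a by (auto simp: vanishes_to_order_def)
    with eq assms(1) show ?thesis
      unfolding vanishes_to_order_def by (intro exI[of _ C] exI[of _ "min \<delta> \<epsilon>"]) auto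
  qed
  show ?thesis using *[of \<psi> \<xi>] *[of \<xi> \<psi>] assms(2) by metis
qed

text \<open>Distances and values are distorted by at most the factor \<open>A\<close> in either
  direction, so a bound carries over with its radius divided by \<open>A\<close> and its constant
  multiplied by \<open>A * A ^ n\<close>. Surjectivity lets every \<open>x\<close> be written as
  \<open>\<alpha> c\<close>.\<close>

lemma vanishes_to_order_reparam:
  assumes a: "\<And>c. \<bar>\<alpha> c - \<alpha> c0\<bar> \<le> A * \<bar>c - c0\<bar>" "\<And>c. \<bar>c - c0\<bar> \<le> A * \<bar>\<alpha> c - \<alpha> c0\<bar>"
    and "surj \<alpha>" and A: "A > 0"
    and h: "\<And>c. \<bar>\<psi> c\<bar> \<le> A * \<bar>\<xi> (\<alpha> c)\<bar>" "\<And>c. \<bar>\<xi> (\<alpha> c)\<bar> \<le> A * \<bar>\<psi> c\<bar>"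
  shows "vanishes_to_order n \<psi> c0 \<longleftrightarrow> vanishes_to_order n \<xi> (\<alpha> c0)"
proof
  assume "vanishes_to_order n \<psi> c0"
  then obtain C \<delta> where \<delta>: "\<delta> > 0" "\<And>c. \<bar>c - c0\<bar> < \<delta> \<Longrightarrow> \<bar>\<psi> c\<bar> \<le> C * \<bar>c - c0\<bar> ^ n"
    by (auto simp: vanishes_to_order_def)
  have "\<bar>\<xi> x\<bar> \<le> A * (\<bar>C\<bar> * A ^ n) * \<bar>x - \<alpha> c0\<bar> ^ n" if x: "\<bar>x - \<alpha> c0\<bar> < \<delta> / A" for x
  proof -
    obtain c where c: "x = \<alpha> c" using \<open>surj \<alpha>\<close> by auto
    have "A * \<bar>x - \<alpha> c0\<bar> < \<delta>" using x A by (simp add: field_simps)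
    then have "\<bar>c - c0\<bar> < \<delta>" using a(2)[of c] c by auto
    then have "\<bar>\<psi> c\<bar> \<le> \<bar>C\<bar> * \<bar>c - c0\<bar> ^ n"
      using \<delta>(2)[of c] mult_right_mono[OF abs_ge_self[of C], of "\<bar>c - c0\<bar> ^ n"] by auto
    also have "\<dots> \<le> \<bar>C\<bar> * (A * \<bar>x - \<alpha> c0\<bar>) ^ n"
      using a(2)[of c] c by (intro mult_left_mono power_mono) auto
    finally have "A * \<bar>\<psi> c\<bar> \<le> A * (\<bar>C\<bar> * (A * \<bar>x - \<alpha> c0\<bar>) ^ n)" using A by simp
    with h(2)[of c] c show ?thesis by (simp add: power_mult_distrib mult.assoc)
  qed
  moreover have "\<delta> / A > 0" using \<delta> A by simp
  ultimately show "vanishes_to_order n \<xi> (\<alpha> c0)" unfolding vanishes_to_order_def by blast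
next
  assume "vanishes_to_order n \<xi> (\<alpha> c0)"
  then obtain C \<delta> where \<delta>: "\<delta> > 0" "\<And>x. \<bar>x - \<alpha> c0\<bar> < \<delta> \<Longrightarrow> \<bar>\<xi> x\<bar> \<le> C * \<bar>x - \<alpha> c0\<bar> ^ n"
    by (auto simp: vanishes_to_order_def)
  have "\<bar>\<psi> c\<bar> \<le> A * (\<bar>C\<bar> * A ^ n) * \<bar>c - c0\<bar> ^ n" if c: "\<bar>c - c0\<bar> < \<delta> / A" for c
  proof -
    have "A * \<bar>c - c0\<bar> < \<delta>" using c A by (simp add: field_simps)
    then have "\<bar>\<alpha> c - \<alpha> c0\<bar> < \<delta>" using a(1)[of c] by auto
    then have "\<bar>\<xi> (\<alpha> c)\<bar> \<le> \<bar>C\<bar> * \<bar>\<alpha> c - \<alpha> c0\<bar> ^ n"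
      using \<delta>(2)[of "\<alpha> c"] mult_right_mono[OF abs_ge_self[of C], of "\<bar>\<alpha> c - \<alpha> c0\<bar> ^ n"] by auto
    also have "\<dots> \<le> \<bar>C\<bar> * (A * \<bar>c - c0\<bar>) ^ n"
      using a(1)[of c] by (intro mult_left_mono power_mono) auto
    finally have "A * \<bar>\<xi> (\<alpha> c)\<bar> \<le> A * (\<bar>C\<bar> * (A * \<bar>c - c0\<bar>) ^ n)" using A by simp
    with h(1)[of c] show ?thesis by (simp add: power_mult_distrib mult.assoc)
  qed
  moreover have "\<delta> / A > 0" using \<delta> A by simp
  ultimately show "vanishes_to_order n \<psi> c0" unfolding vanishes_to_order_def by blast
qed

section \<open>Taylor's formula for a chain of successive derivatives\<close>

context
  fixes d :: "nat \<Rightarrow> real \<Rightarrow> real" and x0 \<epsilon> :: real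
  assumes \<epsilon>: "\<epsilon> > 0"
    and d: "\<And>i x. \<bar>x - x0\<bar> < \<epsilon> \<Longrightarrow> (d i has_real_derivative d (Suc i) x) (at x)"
begin

lemma taylor_first_terms_vanish:
  assumes n: "n > 0" "\<And>i. 0 < i \<Longrightarrow> i < n \<Longrightarrow> d i x0 = 0" and x: "\<bar>x - x0\<bar> < \<epsilon>"
  shows "\<exists>t. \<bar>t - x0\<bar> \<le> \<bar>x - x0\<bar> \<and> d 0 x - d 0 x0 = d n t / fact n * (x - x0) ^ n"
proof (cases "x = x0")
  case True
  then show ?thesis using n by auto
next
  case False
  define r where "r = \<bar>x - x0\<bar>"
  have "\<exists>t. (if x < x0 then x < t \<and> t < x0 else x0 < t \<and> t < x) \<and>
     d 0 x = (\<Sum>m<n. d m x0 / fact m * (x - x0) ^ m) + d n t / fact n * (x - x0) ^ n"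
    by (rule Taylor[where a = "x0 - r" and b = "x0 + r"])
      (use n(1) False x in \<open>auto simp: r_def intro!: d\<close>)
  then obtain t where t: "if x < x0 then x < t \<and> t < x0 else x0 < t \<and> t < x"
    "d 0 x = (\<Sum>m<n. d m x0 / fact m * (x - x0) ^ m) + d n t / fact n * (x - x0) ^ n" by blast
  have "(\<Sum>m<n. d m x0 / fact m * (x - x0) ^ m) = (\<Sum>m<n. if m = 0 then d 0 x0 else 0)"
    using n(2) by (intro sum.cong) auto
  also have "\<dots> = d 0 x0" using n(1) by simp
  finally have "d 0 x - d 0 x0 = d n t / fact n * (x - x0) ^ n" using t(2) by simp
  moreover have "\<bar>t - x0\<bar> \<le> \<bar>x - x0\<bar>" using t(1) by (auto split: if_splits)
  ultimately show ?thesis by blast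
qed

text \<open>Forward, the difference is a Taylor remainder of order \<open>Suc k\<close>. Conversely,
  a first nonzero derivative of order \<open>j \<le> k\<close> would make the difference at least a
  positive multiple of \<open>r ^ j\<close>, against a bound of order
  \<open>r ^ Suc k\<close>.\<close>

lemma derivs_vanish_iff:
  "(\<forall>i\<in>{1..k}. d i x0 = 0) \<longleftrightarrow> vanishes_to_order (Suc k) (\<lambda>x. d 0 x - d 0 x0) x0"
proof
  assume z: "\<forall>i\<in>{1..k}. d i x0 = 0"
  \<comment> \<open>Halving the radius gives a compact interval inside the domain, on which the
    remainder's derivative is bounded.\<close>
  have cont: "continuous_on {x0 - \<epsilon> / 2..x0 + \<epsilon> / 2} (d (Suc k))"
    using \<epsilon> by (intro continuous_at_imp_continuous_on ballI DERIV_isCont[OF d]) (auto simp: abs_less_iff)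
  then have "bounded (d (Suc k) ` {x0 - \<epsilon> / 2..x0 + \<epsilon> / 2})"
    by (intro compact_imp_bounded compact_continuous_image compact_Icc)
  then obtain C where C: "\<And>t. t \<in> {x0 - \<epsilon> / 2..x0 + \<epsilon> / 2} \<Longrightarrow> \<bar>d (Suc k) t\<bar> \<le> C"
    unfolding bounded_iff by force
  have "\<bar>d 0 x - d 0 x0\<bar> \<le> C / fact (Suc k) * \<bar>x - x0\<bar> ^ Suc k" if x: "\<bar>x - x0\<bar> < \<epsilon> / 2" for x
  proof -
    obtain t where t: "\<bar>t - x0\<bar> \<le> \<bar>x - x0\<bar>" "d 0 x - d 0 x0 = d (Suc k) t / fact (Suc k) * (x - x0) ^ Suc k"
      using taylor_first_terms_vanish[of "Suc k" x] z x \<epsilon> by auto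
    have "\<bar>d (Suc k) t\<bar> \<le> C" using t(1) x by (intro C) (auto simp: abs_le_iff abs_less_iff)
    then have "\<bar>d (Suc k) t\<bar> / fact (Suc k) * \<bar>x - x0\<bar> ^ Suc k \<le> C / fact (Suc k) * \<bar>x - x0\<bar> ^ Suc k"
      by (intro mult_right_mono divide_right_mono) auto
    then show ?thesis unfolding t(2) abs_mult abs_divide power_abs by simp
  qed
  moreover have "\<epsilon> / 2 > 0" using \<epsilon> by simp
  ultimately show "vanishes_to_order (Suc k) (\<lambda>x. d 0 x - d 0 x0) x0"
    unfolding vanishes_to_order_def by blast
next
  assume "vanishes_to_order (Suc k) (\<lambda>x. d 0 x - d 0 x0) x0"
  then obtain C \<delta> where \<delta>: "\<delta> > 0" "\<And>x. \<bar>x - x0\<bar> < \<delta> \<Longrightarrow> \<bar>d 0 x - d 0 x0\<bar> \<le> C * \<bar>x - x0\<bar> ^ Suc k"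
    by (auto simp: vanishes_to_order_def)
  show "\<forall>i\<in>{1..k}. d i x0 = 0"
  proof (rule ccontr)
    assume "\<not> ?thesis"
    then have ex: "\<exists>i. i \<in> {1..k} \<and> d i x0 \<noteq> 0" by blast
    define j where "j = (LEAST i. i \<in> {1..k} \<and> d i x0 \<noteq> 0)"
    have j: "j \<in> {1..k}" "d j x0 \<noteq> 0" using LeastI_ex[OF ex] by (auto simp: j_def)
    have less: "d i x0 = 0" if "0 < i" "i < j" for i
      using not_less_Least[of i "\<lambda>i. i \<in> {1..k} \<and> d i x0 \<noteq> 0"] that j(1) by (auto simp: j_def)
    define D where "D = \<bar>d j x0\<bar>"
    have D: "D > 0" using j by (simp add: D_def)
    have "isCont (d j) x0" using d[of x0 j] \<epsilon> by (auto intro: DERIV_isCont)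
    then obtain \<eta> where \<eta>: "\<eta> > 0" "\<And>t. \<bar>t - x0\<bar> < \<eta> \<Longrightarrow> \<bar>d j t - d j x0\<bar> < D / 2"
      using D unfolding continuous_at_eps_delta dist_real_def by (metis half_gt_zero)
    \<comment> \<open>Near \<open>x0\<close> the \<open>j\<close>-th derivative is at least
      \<open>D / 2\<close> in absolute value, so \<open>E * r ^ j\<close> bounds the difference from
      below.\<close>
    define E where "E = D / 2 / fact j"
    have E: "E > 0" using D by (simp add: E_def)
    \<comment> \<open>The threshold ensures \<open>(\<bar>C\<bar> + 1) * r \<le> E / 2\<close>;
      adding \<open>1\<close> keeps the denominator positive when \<open>C = 0\<close>.\<close>
    define e where "e = E / (2 * (\<bar>C\<bar> + 1))"
    have e: "e > 0" using E by (simp add: e_def)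
    \<comment> \<open>The entry \<open>1\<close> is there to lower the exponent \<open>Suc k\<close>
      to \<open>Suc j\<close>; the others keep \<open>x0 + r\<close> in all the neighbourhoods in
      play.\<close>
    define r where "r = Min {1, \<epsilon> / 2, \<delta> / 2, \<eta> / 2, e}"
    have r: "r > 0" "r \<le> 1" "r < \<epsilon>" "r < \<delta>" "r < \<eta>" "r \<le> e"
      using \<epsilon> \<delta>(1) \<eta>(1) e by (auto simp: r_def min_def)
    obtain t where t: "\<bar>t - x0\<bar> \<le> r" "d 0 (x0 + r) - d 0 x0 = d j t / fact j * r ^ j"
      using taylor_first_terms_vanish[of j "x0 + r"] less j(1) r by auto
    have "\<bar>d j t - d j x0\<bar> < D / 2" using t(1) r by (intro \<eta>) auto
    then have "D / 2 \<le> \<bar>d j t\<bar>" unfolding D_def by linarith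
    then have "E \<le> \<bar>d j t\<bar> / fact j" unfolding E_def by (intro divide_right_mono) auto
    then have "E * r ^ j \<le> \<bar>d j t\<bar> / fact j * r ^ j" using r by (intro mult_right_mono) auto
    also have "\<dots> = \<bar>d 0 (x0 + r) - d 0 x0\<bar>" using t(2) r by (simp add: abs_mult)
    also have "\<dots> \<le> C * r ^ Suc k" using \<delta>(2)[of "x0 + r"] r by simp
    also have "\<dots> \<le> \<bar>C\<bar> * r ^ Suc j"
      using r j(1) by (intro mult_mono power_decreasing) auto
    also have "\<dots> = (\<bar>C\<bar> * r) * r ^ j" by simp
    finally have "E \<le> \<bar>C\<bar> * r" using r by simp
    also have "\<dots> \<le> (\<bar>C\<bar> + 1) * r" using r by (intro mult_right_mono) auto
    also have "\<dots> \<le> E / 2" using r(6) by (simp add: e_def field_simps)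
    finally show False using E by simp
  qed
qed

end

text \<open>Membership in all classes passes from a function to its derivative, so differentiation
  can be repeated indefinitely.\<close>

lemma param_Ck_iterated_deriv:
  assumes I: "open I" and \<psi>: "\<And>k. param_Ck I k (\<lambda>p t. \<psi> p)"
  shows "p \<in> I \<Longrightarrow> ((deriv ^^ i) \<psi> has_real_derivative (deriv ^^ Suc i) \<psi> p) (at p)"
proof -
  have step: "(\<forall>k. param_Ck I k (\<lambda>p t. deriv \<xi> p)) \<and> (\<forall>p\<in>I. (\<xi> has_real_derivative deriv \<xi> p) (at p))"
    if \<xi>: "\<And>k. param_Ck I k (\<lambda>p t. \<xi> p)" for \<xi>
  proof -
    have *: "param_Ck I k (\<lambda>p t. deriv \<xi> p) \<and> (\<forall>p\<in>I. (\<xi> has_real_derivative deriv \<xi> p) (at p))" for k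
    proof -
      obtain y' where y': "\<And>p t. p \<in> I \<Longrightarrow> t \<in> {0..1} \<Longrightarrow> (\<xi> has_real_derivative y' p t) (at p)"
        "param_Ck I k y'" using param_Ck_SucE[OF \<xi>] by metis
      \<comment> \<open>The derivative family could formally depend on \<open>t\<close>; uniqueness
        of derivatives identifies it with \<open>deriv \<xi>\<close>.\<close>
      have eq: "deriv \<xi> p = y' p t" if "p \<in> I" "t \<in> {0..1}" for p t
        using DERIV_imp_deriv[OF y'(1)[OF that]] .
      then have "param_Ck I k (\<lambda>p t. deriv \<xi> p)" by (rule param_Ck_cong[OF I y'(2)])
      moreover have "(\<xi> has_real_derivative deriv \<xi> p) (at p)" if "p \<in> I" for p
        using y'(1)[OF that, of 0] eq[OF that, of 0] by simp
      ultimately show ?thesis by blast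
    qed
    then show ?thesis by blast
  qed
  have "\<forall>k. param_Ck I k (\<lambda>p t. (deriv ^^ i) \<psi> p)"
    by (induction i) (use \<psi> step in auto)
  then show "p \<in> I \<Longrightarrow> ((deriv ^^ i) \<psi> has_real_derivative (deriv ^^ Suc i) \<psi> p) (at p)"
    using step by simp
qed

section \<open>Local families of solutions\<close>

lemma antiderivative_exists:
  fixes \<phi> :: "real \<Rightarrow> real"
  assumes "continuous_on UNIV \<phi>"
  shows "\<exists>\<Phi>. \<forall>x. (\<Phi> has_real_derivative \<phi> x) (at x)"
  using einterval_antiderivative[of "- \<infinity>" \<infinity> \<phi>] assms
  by (auto simp: continuous_on_eq_continuous_at has_real_derivative_iff_has_vector_derivative)

text \<open>Outside \<open>\<bar>s\<bar> \<le> R\<close> the nonlinearity is continued affinely in \<open>s\<close>.\<close>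

lemma lipschitz_truncation:
  fixes f f' :: "real \<Rightarrow> real \<Rightarrow> real"
  assumes f: "continuous_on UNIV (\<lambda>(t, s). f t s)" and f': "continuous_on UNIV (\<lambda>(t, s). f' t s)"
    and deriv: "\<And>t s. (f t has_real_derivative f' t s) (at s)" and R: "R \<ge> (0 :: real)"
    and V: "continuous_on {0..1} V" "V 0 = 0"
  shows "\<exists>g g' L. lipschitz_ode g g' V L \<and>
    (\<forall>t s. \<bar>s\<bar> \<le> R \<longrightarrow> g t s = f t s \<and> g' t s = f' t s)"
proof -
  define cl where "cl s = max (- R) (min R s)" for s
  have cl: "cl s \<in> {- R..R}" "\<bar>s\<bar> \<le> R \<Longrightarrow> cl s = s" for s using R by (auto simp: cl_def)
  define g' where "g' t s = f' t (cl s)" for t s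
  \<comment> \<open>Writing the integral of \<open>g'\<close> from \<open>0\<close> to
    \<open>s\<close> in averaged form makes joint continuity immediate.\<close>
  define g where "g t s = f t 0 + avg_deriv g' t s 0 * s" for t s
  have g': "continuous_on UNIV (\<lambda>(t, s). g' t s)"
    unfolding g'_def cl_def split_beta by (intro continuous_on_nonlinearity[OF f'] continuous_intros)
  have g: "continuous_on UNIV (\<lambda>(t, s). g t s)"
    unfolding g_def split_beta
    by (intro continuous_intros continuous_on_avg_deriv[OF g'] continuous_on_nonlinearity[OF f])
  have dg: "(g t has_real_derivative g' t s) (at s)" for t s
  proof -
    \<comment> \<open>An antiderivative on the whole line lets the averaged expression be
      differentiated for either sign of \<open>s\<close>.\<close>
    have "continuous_on UNIV (g' t)"
      by (rule continuous_on_nonlinearity[OF g']) (intro continuous_intros)+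
    then obtain \<Phi> where \<Phi>: "\<And>x. (\<Phi> has_real_derivative g' t x) (at x)"
      using antiderivative_exists by blast
    have "\<Phi> x - \<Phi> 0 = avg_deriv g' t x 0 * (x - 0)" for x
      by (rule diff_eq_avg_deriv[OF g', where g = "\<lambda>_. \<Phi>"]) (rule \<Phi>)
    then have "g t = (\<lambda>x. f t 0 + (\<Phi> x - \<Phi> 0))" by (simp add: g_def fun_eq_iff)
    then show ?thesis using \<Phi>[of s] by (auto intro!: derivative_eq_intros)
  qed
  have "bounded ((\<lambda>x. f' (fst x) (snd x)) ` ({0..1} \<times> {- R..R}))"
    by (intro compact_imp_bounded compact_continuous_image compact_Times compact_Icc
        continuous_on_nonlinearity[OF f'] continuous_on_fst continuous_on_snd continuous_on_id)
  then obtain L where L': "\<And>x. x \<in> {0..1} \<times> {- R..R} \<Longrightarrow> norm (f' (fst x) (snd x)) \<le> L"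
    unfolding bounded_iff by blast
  have L: "\<bar>g' t s\<bar> \<le> L" if "t \<in> {0..1}" for t s
    using L'[of "(t, cl s)"] that cl(1)[of s] by (simp add: g'_def)
  have "g t s = f t s \<and> g' t s = f' t s" if s: "\<bar>s\<bar> \<le> R" for t s
  proof
    \<comment> \<open>The segment from \<open>0\<close> to \<open>s\<close> stays where the clamping
      changes nothing.\<close>
    have "avg_deriv g' t s 0 = avg_deriv f' t s 0"
      unfolding avg_deriv_def
    proof (rule integral_cong)
      fix \<sigma> :: real assume "\<sigma> \<in> {0..1}"
      then have "\<bar>\<sigma> * s\<bar> \<le> 1 * R" unfolding abs_mult using s by (intro mult_mono) auto
      then show "g' t (0 + \<sigma> * (s - 0)) = f' t (0 + \<sigma> * (s - 0))" by (simp add: g'_def cl)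
    qed
    then show "g t s = f t s"
      using diff_eq_avg_deriv[where g = f and t = t and x = s and y = 0, OF f' deriv] by (simp add: g_def)
  qed (simp add: g'_def cl s)
  then have eq: "\<forall>t s. \<bar>s\<bar> \<le> R \<longrightarrow> g t s = f t s \<and> g' t s = f' t s" by blast
  have "lipschitz_ode g g' V L"
    by (rule lipschitz_ode.intro[OF g g' dg L V])
  with eq show ?thesis by (intro exI[of _ g] exI[of _ g'] exI[of _ L] conjI)
qed

lemma integral_sol_cong:
  assumes "\<And>t. t \<in> {0..1} \<Longrightarrow> g t (y t) = f t (y t)"
  shows "integral_sol g V a \<kappa> y \<longleftrightarrow> integral_sol f V a \<kappa> y"
proof -
  have "integral {0..t} (\<lambda>s. g s (y s)) = integral {0..t} (\<lambda>s. f s (y s))" if "t \<in> {0..1}" for t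
    by (rule integral_cong) (use assms that in auto)
  then show ?thesis by (simp add: integral_sol_def)
qed

context lipschitz_ode
begin

text \<open>The solutions \<open>y\<close> and \<open>u\<close> start at the same value and their
  forcings differ by \<open>\<kappa>\<close>; since \<open>u 1 = u 0\<close>, the endpoint of
  \<open>y - u\<close> is the displacement of the return map.\<close>

lemma abs_return_displacement:
  assumes u: "integral_sol g V (u 0) \<kappa> u" "u 1 = u 0" and y: "integral_sol g V (u 0) 0 y"
  shows "\<bar>\<kappa>\<bar> \<le> exp (2 * L) * \<bar>y 1 - u 0\<bar>" "\<bar>y 1 - u 0\<bar> \<le> exp (2 * L) * \<bar>\<kappa>\<bar>"
proof -
  note d = sol_diff[OF y u(1)]
  have w: "linear_sol (q y u) 0 (- \<kappa>) (\<lambda>t. y t - u t)" using d(2) by simp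
  note e = linear_sol_endpoint[OF d(1) q_le[of _ y u] w, unfolded u(2)]
  show "\<bar>\<kappa>\<bar> \<le> exp (2 * L) * \<bar>y 1 - u 0\<bar>" "\<bar>y 1 - u 0\<bar> \<le> exp (2 * L) * \<bar>\<kappa>\<bar>"
    using e by (simp_all add: exp_minus field_simps)
qed

text \<open>Differences of initial values are differences of means times a ratio in
  \<open>[exp (- (2 * L)), exp (2 * L)]\<close>, so the bi-Lipschitz criterion applies.\<close>

lemma periodic_family_initial_surj:
  assumes u: "\<And>c. integral_sol g V (u c 0) (\<kappa> c) (u c)" "\<And>c. u c 1 = u c 0"
    and mean: "\<And>c. integral {0..1} (u c) = c"
  shows "surj (\<lambda>c. u c 0)"
proof -
  have *: "\<exists>\<theta>. exp (- (2 * L)) \<le> \<theta> \<and> \<theta> \<le> exp (2 * L) \<and> u c 0 - u d 0 = \<theta> * (c - d)" for c d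
  proof -
    let ?M = "profile_mean (q (u c) (u d))" and ?N = "int_factor_prim (q (u c) (u d)) 1"
    note dc = sol_diff(1)[OF u(1)[of c] u(1)[of d]]
    have MN: "0 < ?M" "0 < ?N" using profile_mean_pos[OF dc] int_factor_prim_1_pos[OF dc] by auto
    have "c - d = ?M / ?N * (u c 0 - u d 0)"
      using periodic_sol_diff(3)[OF u(1)[of c] u(1)[of d] u(2)[of c] u(2)[of d], of 0] by (simp add: mean)
    then have "u c 0 - u d 0 = ?N / ?M * (c - d)" using MN by (simp add: field_simps)
    moreover have "exp (- (2 * L)) \<le> ?N / ?M" "?N / ?M \<le> exp (2 * L)"
      using profile_mean_bounds[OF dc q_le[of _ "u c" "u d"]] MN by (simp_all add: exp_minus field_simps)
    ultimately show ?thesis by blast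
  qed
  have "\<exists>c. u c 0 = a" for a by (rule bilipschitz_surj[OF _ *]) simp
  then have "\<exists>c. a = u c 0" for a by (blast intro: sym)
  then show ?thesis unfolding surj_def by blast
qed

end

text \<open>Collects what is needed near one periodic solution \<open>w\<close>. The families are
  built globally for a truncated equation and then restricted to parameters whose solutions stay
  where the truncation agrees with \<open>f\<close>.\<close>

lemma local_families:
  fixes f f' :: "real \<Rightarrow> real \<Rightarrow> real"
  assumes f: "\<And>k. Ck k f" and f': "\<And>k. Ck k f'"
    and deriv: "\<And>t s. (f t has_real_derivative f' t s) (at s)"
    and V: "continuous_on {0..1} V" "V 0 = 0"
    and w: "integral_sol f V (w 0) 0 w" "w 1 = w 0"
  defines "c0 \<equiv> integral {0..1} w"
  shows "\<exists>\<epsilon>>0. \<exists>u \<kappa> y.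
    (\<forall>c. \<bar>c - c0\<bar> < \<epsilon> \<longrightarrow> integral_sol f V (u c 0) (\<kappa> c) (u c) \<and> u c 1 = u c 0 \<and> integral {0..1} (u c) = c) \<and>
    (\<forall>a. \<bar>a - w 0\<bar> < \<epsilon> \<longrightarrow> integral_sol f V a 0 (y a)) \<and>
    (\<forall>k. param_Ck {c. \<bar>c - c0\<bar> < \<epsilon>} k (\<lambda>c t. \<kappa> c)) \<and>
    (\<forall>k. param_Ck {a. \<bar>a - w 0\<bar> < \<epsilon>} k (\<lambda>a t. y a 1)) \<and>
    \<kappa> c0 = 0 \<and> y (w 0) 1 = w 0 \<and>
    (\<forall>n. vanishes_to_order n \<kappa> c0 \<longleftrightarrow> vanishes_to_order n (\<lambda>a. y a 1 - a) (w 0))"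
proof -
  have cw: "continuous_on {0..1} w" using w(1) unfolding integral_sol_def by blast
  obtain R0 where R0: "\<forall>t\<in>{0..1}. \<bar>w t\<bar> \<le> R0" using continuous_on_unit_bounded[OF cw] by blast
  \<comment> \<open>The margin \<open>1\<close> beyond the bound on \<open>w\<close> leaves room for
    neighbouring solutions.\<close>
  define R where "R = R0 + 1"
  have R: "R \<ge> 0" using R0[rule_format, of 0] by (simp add: R_def)
  obtain g g' L where ode: "lipschitz_ode g g' V L"
    and eq': "\<forall>t s. \<bar>s\<bar> \<le> R \<longrightarrow> g t s = f t s \<and> g' t s = f' t s"
    using lipschitz_truncation[OF Ck_continuous[OF f] Ck_continuous[OF f'] deriv R V] by blast
  note eq = eq'[rule_format]
  interpret lipschitz_ode g g' V L by (rule ode)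
  have L: "L \<ge> 0" using bound[of 0 0] by simp
  have near: "\<bar>z t\<bar> \<le> R" if "t \<in> {0..1}" "\<bar>z t - w t\<bar> \<le> 1" for z t
    using that(2) R0[rule_format, OF that(1)] unfolding R_def by linarith
  have transfer: "integral_sol g V a \<kappa> z \<longleftrightarrow> integral_sol f V a \<kappa> z"
    if "\<And>t. t \<in> {0..1} \<Longrightarrow> \<bar>z t\<bar> \<le> R" for z a \<kappa>
    by (rule integral_sol_cong) (rule eq[OF that, THEN conjunct1])
  have "\<bar>w t\<bar> \<le> R" if "t \<in> {0..1}" for t using near[OF that, of w] by simp
  then have wg: "integral_sol g V (w 0) 0 w" using w(1) transfer by blast
  obtain u \<kappa> where u: "\<And>c. integral_sol g V (u c 0) (\<kappa> c) (u c)" "\<And>c. u c 1 = u c 0"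
      "\<And>c. integral {0..1} (u c) = c"
    using periodic_sol_exists by metis
  have "\<forall>a. \<exists>y. integral_sol g V a 0 y" using sol_exists by blast
  then obtain y where y: "\<And>a. integral_sol g V a 0 (y a)" by metis
  have m0: "integral {0..1} (u c0) - integral {0..1} w = 0" using u(3) by (simp add: c0_def)
  have uw: "u c0 t = w t" if "t \<in> {0..1}" for t
    using periodic_sol_diff(1)[OF u(1)[of c0] wg u(2)[of c0] w(2) that] m0 by simp
  have \<kappa>0: "\<kappa> c0 = 0"
    using periodic_sol_diff(2)[OF u(1)[of c0] wg u(2)[of c0] w(2), of 0] m0 by simp
  have yw: "y (w 0) t = w t" if "t \<in> {0..1}" for t
    using sol_initial_diff(1)[OF y[of "w 0"] wg that] by simp
  \<comment> \<open>The distances to \<open>w\<close> are Lipschitz in the parameters with constants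
    \<open>exp (4 * L)\<close> and \<open>exp L\<close>, so this radius keeps both families within
    distance \<open>1\<close> of \<open>w\<close>.\<close>
  define \<epsilon> where "\<epsilon> = exp (- (4 * L))"
  have \<epsilon>: "\<epsilon> > 0" "exp (4 * L) * \<epsilon> = 1" by (auto simp: \<epsilon>_def simp flip: exp_add)
  have "exp L * \<epsilon> \<le> exp (4 * L) * \<epsilon>" using L \<epsilon>(1) by (intro mult_right_mono) auto
  then have \<epsilon>': "exp L * \<epsilon> \<le> 1" using \<epsilon>(2) by simp
  have u_near: "\<bar>u c t\<bar> \<le> R" if "\<bar>c - c0\<bar> < \<epsilon>" "t \<in> {0..1}" for c t
  proof (rule near[OF that(2)])
    have "\<bar>u c t - w t\<bar> \<le> exp (4 * L) * \<bar>c - c0\<bar>"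
      using periodic_sol_bounds(2)[OF u(1)[of c] wg u(2)[of c] w(2) that(2)] by (simp add: u(3) c0_def)
    also have "\<dots> \<le> exp (4 * L) * \<epsilon>" using that by (intro mult_left_mono) auto
    finally show "\<bar>u c t - w t\<bar> \<le> 1" using \<epsilon>(2) by simp
  qed
  have y_near: "\<bar>y a t\<bar> \<le> R" if "\<bar>a - w 0\<bar> < \<epsilon>" "t \<in> {0..1}" for a t
  proof (rule near[OF that(2)])
    have "\<bar>y a t - w t\<bar> \<le> exp L * \<bar>a - w 0\<bar>" by (rule sol_initial_diff(2)[OF y wg that(2)])
    also have "\<dots> \<le> exp L * \<epsilon>" using that by (intro mult_left_mono) auto
    finally show "\<bar>y a t - w t\<bar> \<le> 1" using \<epsilon>' by simp
  qed
  have ball: "{x. \<bar>x - x0\<bar> < \<epsilon>} = ball x0 \<epsilon>" for x0 :: real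
    by (auto simp: dist_real_def)
  have I: "open {x. \<bar>x - x0\<bar> < \<epsilon>}" "convex {x. \<bar>x - x0\<bar> < \<epsilon>}" for x0 :: real
    unfolding ball by (rule open_ball convex_ball)+
  have smooth_\<kappa>: "param_Ck {c. \<bar>c - c0\<bar> < \<epsilon>} k (\<lambda>c t. \<kappa> c)" for k
    by (rule periodic_family_smooth(2)[OF u I f']) (rule eq[OF u_near, THEN conjunct2], auto)
  have smooth_y: "param_Ck {a. \<bar>a - w 0\<bar> < \<epsilon>} k (\<lambda>a t. y a 1)" for k
    by (rule param_Ck_eval[OF _ initial_family_smooth[OF y I f']]) (simp, rule eq[OF y_near, THEN conjunct2], auto)
  have sol_u: "integral_sol f V (u c 0) (\<kappa> c) (u c)" if "\<bar>c - c0\<bar> < \<epsilon>" for c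
    using u(1)[of c] transfer[of "u c"] u_near[OF that] by blast
  have sol_y: "integral_sol f V a 0 (y a)" if "\<bar>a - w 0\<bar> < \<epsilon>" for a
    using y[of a] transfer[of "y a"] y_near[OF that] by blast
  have order: "vanishes_to_order n \<kappa> c0 \<longleftrightarrow> vanishes_to_order n (\<lambda>a. y a 1 - a) (w 0)" for n
  proof -
    have u0: "u c0 0 = w 0" using uw by simp
    have A: "exp (2 * L) \<le> exp (4 * L)" using L by simp
    have "vanishes_to_order n \<kappa> c0 \<longleftrightarrow> vanishes_to_order n (\<lambda>a. y a 1 - a) (u c0 0)"
    \<comment> \<open>All estimates hold for every \<open>c\<close>, because the families of the
      truncated equation are global; \<open>exp (4 * L)\<close> also dominates the constant
      \<open>exp (2 * L)\<close> of the displacement bound.\<close>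
    proof (rule vanishes_to_order_reparam[where A = "exp (4 * L)" and \<alpha> = "\<lambda>c. u c 0" and \<xi> = "\<lambda>a. y a 1 - a"])
      fix c
      note b = periodic_sol_bounds[OF u(1)[of c] u(1)[of c0] u(2)[of c] u(2)[of c0], of 0]
      show "\<bar>u c 0 - u c0 0\<bar> \<le> exp (4 * L) * \<bar>c - c0\<bar>" using b(2) by (simp add: u(3))
      show "\<bar>c - c0\<bar> \<le> exp (4 * L) * \<bar>u c 0 - u c0 0\<bar>"
        using b(1) by (simp add: u(3) exp_minus divide_inverse[symmetric] pos_divide_le_eq mult.commute)
      note d = abs_return_displacement[OF u(1)[of c] u(2)[of c] y]
      show "\<bar>\<kappa> c\<bar> \<le> exp (4 * L) * \<bar>y (u c 0) 1 - u c 0\<bar>"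
        "\<bar>y (u c 0) 1 - u c 0\<bar> \<le> exp (4 * L) * \<bar>\<kappa> c\<bar>"
        using d mult_right_mono[OF A, of "\<bar>\<kappa> c\<bar>"] mult_right_mono[OF A, of "\<bar>y (u c 0) 1 - u c 0\<bar>"]
        by linarith+
    qed (use periodic_family_initial_surj[OF u] in simp_all)
    then show ?thesis by (simp only: u0)
  qed
  have y1: "y (w 0) 1 = w 0" using yw[of 1] w(2) by simp
  show ?thesis
    by (rule exI[of _ \<epsilon>], rule conjI, rule \<epsilon>(1), rule exI[of _ u], rule exI[of _ \<kappa>], rule exI[of _ y],
        intro conjI allI impI)
      (rule \<epsilon>(1) sol_u u(2) u(3) sol_y smooth_\<kappa> smooth_y \<kappa>0 y1 order | assumption)+
qed

section \<open>The return map and the strata\<close>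

lemma smooth_on_cylinderD:
  assumes "smooth_on_cylinder f"
  shows "periodic f" "Ck k f" "Ck k (D2 f)" "(f t has_real_derivative D2 f t s) (at s)"
proof -
  show "periodic f" "Ck k f" using assms by (auto simp: smooth_on_cylinder_def)
  have *: "(f t has_real_derivative D2 f t s) (at s) \<and> Ck k (D2 f)" for t s k
  proof -
    have "Ck (Suc k) f" using assms by (simp add: smooth_on_cylinder_def)
    then obtain f2 where f2: "\<And>t s. (f t has_real_derivative f2 t s) (at s)" "Ck k f2" by auto
    have "D2 f = f2" unfolding D2_def by (intro ext DERIV_imp_deriv f2)
    with f2 show ?thesis by simp
  qed
  then show "Ck k (D2 f)" "(f t has_real_derivative D2 f t s) (at s)" by auto
qed

text \<open>An interface that lets one argument serve both function spaces: solutions become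
  integral equations, periodic solutions are realized by elements of the domain space, and constants
  and means are compatible.\<close>

locale regular_circle_pair = circle_pair +
  assumes rep_integrable: "rep v integrable_on {0..1}"
    and has_der_iff: "continuous_on UNIV (\<lambda>(t, s). f t s) \<Longrightarrow>
      has_der y (\<lambda>t. rep v t - f t (y t)) \<longleftrightarrow> integral_sol f (\<lambda>t. integral {0..t} (rep v)) (y 0) 0 y"
    and solution_val: "continuous_on UNIV (\<lambda>(t, s). f t s) \<Longrightarrow> periodic f \<Longrightarrow> solution f (F f u) (val u)"
    and periodic_solution_realized: "continuous_on UNIV (\<lambda>(t, s). f t s) \<Longrightarrow> periodic f \<Longrightarrow>
      solution f v y \<Longrightarrow> y 1 = y 0 \<Longrightarrow> \<exists>u. (\<forall>t\<in>{0..1}. val u t = y t) \<and> F f u = v"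
    and val_1: "val u 1 = val u 0"
    and val_eqI: "(\<And>t. t \<in> {0..1} \<Longrightarrow> val u t = val u' t) \<Longrightarrow> u = u'"
    and val_integral: "(\<integral>t\<in>{0..1}. val u t \<partial>lborel) = integral {0..1} (val u)"
    and mean_eq: "mean v = integral {0..1} (rep v)"
    and integral_rep_add_const:
      "t \<in> {0..1} \<Longrightarrow> integral {0..t} (rep (v + const c)) = integral {0..t} (rep v) + c * t"
    and const_add: "const (a + b) = const a + const b"
begin

abbreviation V :: "'b \<Rightarrow> real \<Rightarrow> real" where "V v t \<equiv> integral {0..t} (rep v)"

lemma V: "continuous_on {0..1} (V v)" "V v 0 = 0"
  by (auto intro: indefinite_integral_continuous_1 rep_integrable)

lemma const_uminus: "const (- c) = - const c"
proof -
  have "const 0 = 0" using const_add[of 0 0] by simp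
  then show ?thesis using const_add[of c "- c"] by (simp add: minus_unique)
qed

lemma const_diff: "const (a - b) = const a - const b"
  using const_add[of a "- b"] by (simp add: const_uminus)

lemma mean_add_const: "mean (v + const c) = mean v + c"
  using integral_rep_add_const[of 1 v c] by (simp add: mean_eq)

lemma Psi_eq: "Psi f u = F f u + const (integral {0..1} (val u) - mean (F f u))"
  by (simp add: Psi_def val_integral const_diff)

text \<open>Identifies the height on a vertical line with the mean of the preimage, the parameter of
  the periodic families.\<close>

lemma mean_Psi: "mean (Psi f u) = integral {0..1} (val u)"
  by (simp add: Psi_eq mean_add_const)

section \<open>\<open>Psi\<close>, \<open>phi\<close> and the return map of a fixed
  nonlinearity\<close>

context
  fixes f :: "real \<Rightarrow> real \<Rightarrow> real"
  assumes f: "smooth_on_cylinder f"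
begin

lemma f_cont: "continuous_on UNIV (\<lambda>(t, s). f t s)"
  by (rule Ck_continuous[OF smooth_on_cylinderD(2)[OF f, of 0]])

lemma f'_cont: "continuous_on UNIV (\<lambda>(t, s). D2 f t s)"
  by (rule Ck_continuous[OF smooth_on_cylinderD(3)[OF f, of 0]])

lemmas f_deriv = smooth_on_cylinderD(4)[OF f]

lemma solution_iff: "solution f v y \<longleftrightarrow> integral_sol f (V v) (y 0) 0 y"
  unfolding solution_def by (rule has_der_iff[OF f_cont])

lemma integral_sol_initial: "integral_sol f (V v) a \<kappa> y \<Longrightarrow> y 0 = a"
  by (simp add: integral_sol_def)

lemma integral_sol_add_const:
  "integral_sol f (V (v + const c)) a 0 y \<longleftrightarrow> integral_sol f (V v) a c y"
  by (simp add: integral_sol_def integral_rep_add_const add.assoc)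

lemma integral_sol_val: "integral_sol f (V (F f u)) (val u 0) 0 (val u)"
  using solution_val[OF f_cont smooth_on_cylinderD(1)[OF f]] by (simp only: solution_iff)

text \<open>Equal images force equal means and values of \<open>F\<close> that differ by a constant,
  so uniqueness of periodic solutions with prescribed mean applies.\<close>

lemma Psi_inj: "inj (Psi f)"
proof (rule injI)
  fix u u' assume eq: "Psi f u = Psi f u'"
  have m: "integral {0..1} (val u) = integral {0..1} (val u')"
    using arg_cong[OF eq, of mean] by (simp only: mean_Psi)
  define c where "c = mean (F f u') - mean (F f u)"
  have "F f u' = F f u + const c"
    using eq unfolding Psi_eq m c_def const_diff by (simp add: algebra_simps)
  then have "integral_sol f (V (F f u)) (val u' 0) c (val u')"
    using integral_sol_val[of u'] by (simp only: integral_sol_add_const)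
  from integral_sol_periodic_unique[OF f_cont f'_cont f_deriv integral_sol_val[of u] this val_1 val_1 m]
  show "u = u'" by (rule val_eqI)
qed

lemma return_map_eq:
  assumes y: "integral_sol f (V v) a 0 y"
  shows "a \<in> return_domain f v" "return_map f v a = y 1"
proof -
  have y0: "y 0 = a" by (rule integral_sol_initial[OF y])
  have sol: "solution f v y" unfolding solution_iff y0 by (rule y)
  with y0 show "a \<in> return_domain f v" by (auto simp: return_domain_def)
  show "return_map f v a = y 1"
    unfolding return_map_def
  proof (rule the_equality)
    show "\<exists>z. solution f v z \<and> z 0 = a \<and> z 1 = y 1" using sol y0 by blast
  next
    fix b assume "\<exists>z. solution f v z \<and> z 0 = a \<and> z 1 = b"
    then obtain z where z: "integral_sol f (V v) a 0 z" "z 1 = b" by (auto simp: solution_iff)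
    show "b = y 1" using integral_sol_unique[OF f_cont f'_cont f_deriv z(1) y, of 1] z(2) by simp
  qed
qed

text \<open>The solution is realized by some \<open>u'\<close> with
  \<open>F f u' = F f u + const \<kappa>\<close>, and its mean puts \<open>Psi f u'\<close> on the
  vertical line through \<open>Psi f u\<close> at height \<open>c\<close>. By injectivity
  \<open>inv (Psi f)\<close> returns this \<open>u'\<close>.\<close>

lemma phi_eq:
  assumes u': "integral_sol f (V (F f u)) (y 0) \<kappa> y" "y 1 = y 0" and c: "integral {0..1} y = c"
  shows "phi f (Psi f u - const (mean (Psi f u))) c = mean (F f u) + \<kappa>"
proof -
  have "solution f (F f u + const \<kappa>) y" unfolding solution_iff integral_sol_add_const by (rule u')
  from periodic_solution_realized[OF f_cont smooth_on_cylinderD(1)[OF f] this u'(2)]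
  obtain u' where u': "\<forall>t\<in>{0..1}. val u' t = y t" "F f u' = F f u + const \<kappa>" by blast
  have "integral {0..1} (val u') = c"
    unfolding c[symmetric] by (rule integral_cong) (use u'(1) in blast)
  then have "Psi f u' = Psi f u - const (mean (Psi f u)) + const c"
    unfolding Psi_eq[of f u'] mean_Psi unfolding Psi_eq u'(2) mean_add_const
    by (simp add: const_diff const_add algebra_simps)
  then have "inv (Psi f) (Psi f u - const (mean (Psi f u)) + const c) = u'"
    by (intro inv_f_eq Psi_inj)
  then show ?thesis by (simp add: phi_def u'(2) mean_add_const)
qed

text \<open>Both conditions become orders of vanishing, one of \<open>\<kappa>\<close> at the mean
  of \<open>u\<close> and one of the return map minus the identity at the initial value; the local
  families show that these agree.\<close>

lemma S_iff_return_map: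
  fixes u
  defines "\<rho> \<equiv> return_map f (F f u)" and "a0 \<equiv> val u 0"
  shows "a0 \<in> return_domain f (F f u)" and "\<rho> a0 = a0"
    and "1 \<le> k \<Longrightarrow> u \<in> S f k \<longleftrightarrow> deriv \<rho> a0 = 1 \<and> (\<forall>i\<in>{2..k}. (deriv ^^ i) \<rho> a0 = 0)"
proof -
  define c0 where "c0 = integral {0..1} (val u)"
  define \<phi> where "\<phi> = phi f (Psi f u - const (mean (Psi f u)))"
  note w = integral_sol_val[of u]
  show dom: "a0 \<in> return_domain f (F f u)" and fixed: "\<rho> a0 = a0"
    using return_map_eq[OF w] by (simp_all add: a0_def \<rho>_def val_1)
  obtain \<epsilon> y and x :: "real \<Rightarrow> real \<Rightarrow> real" and \<kappa> where \<epsilon>: "\<epsilon> > 0"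
    and x: "\<forall>c. \<bar>c - c0\<bar> < \<epsilon> \<longrightarrow> integral_sol f (V (F f u)) (x c 0) (\<kappa> c) (x c) \<and> x c 1 = x c 0 \<and> integral {0..1} (x c) = c"
    and y: "\<forall>a. \<bar>a - a0\<bar> < \<epsilon> \<longrightarrow> integral_sol f (V (F f u)) a 0 (y a)"
    and smooth: "\<forall>k. param_Ck {c. \<bar>c - c0\<bar> < \<epsilon>} k (\<lambda>c t. \<kappa> c)" "\<forall>k. param_Ck {a. \<bar>a - a0\<bar> < \<epsilon>} k (\<lambda>a t. y a 1)"
    and zero: "\<kappa> c0 = 0" "y a0 1 = a0"
    and order: "\<forall>n. vanishes_to_order n \<kappa> c0 \<longleftrightarrow> vanishes_to_order n (\<lambda>a. y a 1 - a) a0"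
    using local_families[OF smooth_on_cylinderD(2)[OF f] smooth_on_cylinderD(3)[OF f] f_deriv V w val_1]
    unfolding c0_def a0_def by blast
  have \<phi>: "\<phi> c = mean (F f u) + \<kappa> c" if "\<bar>c - c0\<bar> < \<epsilon>" for c
    using phi_eq[of u "x c"] x[rule_format, OF that] unfolding \<phi>_def by blast
  have \<rho>: "\<rho> a = y a 1" if "\<bar>a - a0\<bar> < \<epsilon>" for a
    unfolding \<rho>_def by (rule return_map_eq(2)[OF y[rule_format, OF that]])
  have op: "open {x. \<bar>x - x0\<bar> < \<epsilon>}" for x0 :: real
    using open_ball[of x0 \<epsilon>] by (simp add: ball_def dist_real_def abs_minus_commute)
  have "param_Ck {c. \<bar>c - c0\<bar> < \<epsilon>} k (\<lambda>c t. \<phi> c)" for k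
    by (rule param_Ck_cong[OF op param_Ck_add[OF param_Ck_const smooth(1)[rule_format]]]) (use \<phi> in simp)
  from param_Ck_iterated_deriv[OF op this]
  have d\<phi>: "((deriv ^^ i) \<phi> has_real_derivative (deriv ^^ Suc i) \<phi> c) (at c)" if "\<bar>c - c0\<bar> < \<epsilon>" for i c
    using that by simp
  have "param_Ck {a. \<bar>a - a0\<bar> < \<epsilon>} k (\<lambda>a t. \<rho> a)" for k
    by (rule param_Ck_cong[OF op smooth(2)[rule_format]]) (use \<rho> in simp)
  from param_Ck_iterated_deriv[OF op this]
  have d\<rho>: "((deriv ^^ i) \<rho> has_real_derivative (deriv ^^ Suc i) \<rho> a) (at a)" if "\<bar>a - a0\<bar> < \<epsilon>" for i a
    using that by simp
  \<comment> \<open>\<open>d i\<close> is the \<open>i\<close>-th derivative of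
    \<open>\<rho>\<close> minus the identity, so the correction affects only \<open>i = 0\<close>
    and \<open>i = 1\<close>.\<close>
  define d where "d i a = (deriv ^^ i) \<rho> a - (if i = 0 then a else if i = 1 then 1 else 0)" for i a
  have dd: "(d i has_real_derivative d (Suc i) a) (at a)" if "\<bar>a - a0\<bar> < \<epsilon>" for i a
    using d\<rho>[OF that, of i] unfolding d_def
    by (cases i) (auto intro!: derivative_eq_intros)
  assume k: "1 \<le> k"
  have "u \<in> S f k \<longleftrightarrow> (\<forall>i\<in>{1..k}. (deriv ^^ i) \<phi> c0 = 0)"
    by (simp add: S_def Let_def \<phi>_def mean_Psi c0_def)
  \<comment> \<open>Vanishing of the derivatives \<open>1..k\<close> corresponds to order
    \<open>Suc k\<close>; the zeroth one is removed by subtracting the value at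
    \<open>c0\<close>.\<close>
  also have "\<dots> \<longleftrightarrow> vanishes_to_order (Suc k) (\<lambda>c. (deriv ^^ 0) \<phi> c - (deriv ^^ 0) \<phi> c0) c0"
    by (rule derivs_vanish_iff[where d = "\<lambda>i. (deriv ^^ i) \<phi>", OF \<epsilon> d\<phi>])
  also have "\<dots> \<longleftrightarrow> vanishes_to_order (Suc k) \<kappa> c0"
    by (rule vanishes_to_order_cong[OF \<epsilon>]) (use \<phi> zero \<epsilon> in simp)
  also have "\<dots> \<longleftrightarrow> vanishes_to_order (Suc k) (\<lambda>a. y a 1 - a) a0"
    using order by blast
  also have "\<dots> \<longleftrightarrow> vanishes_to_order (Suc k) (\<lambda>a. d 0 a - d 0 a0) a0"
    by (rule vanishes_to_order_cong[OF \<epsilon>]) (use \<rho> fixed in \<open>simp add: d_def\<close>)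
  also have "\<dots> \<longleftrightarrow> (\<forall>i\<in>{1..k}. d i a0 = 0)"
    by (rule derivs_vanish_iff[where d = d, OF \<epsilon> dd, symmetric])
  also have "\<dots> \<longleftrightarrow> deriv \<rho> a0 = 1 \<and> (\<forall>i\<in>{2..k}. (deriv ^^ i) \<rho> a0 = 0)"
  proof -
    have "{1..k} = insert 1 {2..k}" using k by auto
    then show ?thesis by (auto simp: d_def)
  qed
  finally show "u \<in> S f k \<longleftrightarrow> deriv \<rho> a0 = 1 \<and> (\<forall>i\<in>{2..k}. (deriv ^^ i) \<rho> a0 = 0)" .
qed

end

end

section \<open>The pair of continuous functions\<close>

text \<open>On each closed unit interval the extension is a translate of \<open>h\<close>; equal
  endpoint values glue neighbouring intervals.\<close>

lemma continuous_on_frac_extension: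
  fixes h :: "real \<Rightarrow> real"
  assumes h: "continuous_on {0..1} h" "h 0 = h 1"
  shows "continuous_on UNIV (\<lambda>t. h (frac t))"
proof -
  have unit: "continuous_on {of_int n..of_int n + 1} (\<lambda>t. h (frac t))" for n :: int
  proof (rule continuous_on_eq)
    show "continuous_on {of_int n..of_int n + 1 :: real} (\<lambda>t. h (t - of_int n))"
      by (rule continuous_on_compose2[OF h(1) continuous_on_diff[OF continuous_on_id continuous_on_const]]) auto
    fix t :: real assume t: "t \<in> {of_int n..of_int n + 1}"
    show "h (t - of_int n) = h (frac t)"
    proof (cases "t = of_int n + 1")
      \<comment> \<open>At the right end \<open>frac\<close> drops to \<open>0\<close>, and
        \<open>h 0 = h 1\<close> closes the gap.\<close>
      case True
      then have "frac t = frac (of_int (n + 1))" by simp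
      then have "frac t = 0" by (simp only: frac_of_int)
      with True h(2) show ?thesis by simp
    next
      case False
      then have "frac t = t - of_int n" using t by (simp add: frac_unique_iff)
      then show ?thesis by simp
    qed
  qed
  have "isCont (\<lambda>t. h (frac t)) t" for t :: real
  proof -
    \<comment> \<open>Then \<open>n < t \<le> n + 1\<close>, so \<open>t\<close> is interior to the
      union of two adjacent unit intervals even when it is an integer.\<close>
    define n where "n = \<lceil>t\<rceil> - 1"
    have nt: "of_int n < t" "t < of_int n + 2" 
      using ceiling_correct[of t] unfolding n_def of_int_diff of_int_1 by linarith+
    have "continuous_on ({of_int n..of_int n + 1} \<union> {of_int (n + 1)..of_int (n + 1) + 1}) (\<lambda>t. h (frac t))"
      by (intro continuous_on_closed_Un unit closed_atLeastAtMost)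
    then have "continuous_on {of_int n<..<of_int n + 2} (\<lambda>t. h (frac t))"
      by (rule continuous_on_subset) auto
    then show ?thesis
      using nt by (simp only: continuous_on_eq_continuous_at[OF open_greaterThanLessThan] greaterThanLessThan_iff Ball_def)
  qed
  then show ?thesis by (simp add: continuous_at_imp_continuous_on)
qed

lemma periodic_frac_extension: "periodic (\<lambda>t. h (frac t))"
  by (simp add: periodic_def frac_1_eq)

text \<open>The fundamental theorem of calculus in both directions; either side makes
  \<open>y\<close> continuous, hence the integrand as well.\<close>

lemma integral_sol_iff_derivative:
  assumes f: "continuous_on UNIV (\<lambda>(t, s). f t s)" and v: "continuous_on {0..1} v"
  shows "has_deriv_on_unit_interval y (\<lambda>t. v t - f t (y t)) \<longleftrightarrow>
    integral_sol f (\<lambda>t. integral {0..t} v) (y 0) 0 y"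
proof
  assume d: "has_deriv_on_unit_interval y (\<lambda>t. v t - f t (y t))"
  then have y: "continuous_on {0..1} y"
    by (auto simp: has_deriv_on_unit_interval_def intro: DERIV_continuous_on)
  note fy = continuous_on_nonlinearity[OF f continuous_on_id y]
  show "integral_sol f (\<lambda>t. integral {0..t} v) (y 0) 0 y"
  proof (rule integral_solI[OF y])
    fix t :: real assume t: "t \<in> {0..1}"
    have "((\<lambda>t. v t - f t (y t)) has_integral (y t - y 0)) {0..t}"
    proof (rule fundamental_theorem_of_calculus)
      fix x assume "x \<in> {0..t}"
      then have "(y has_real_derivative v x - f x (y x)) (at x within {0..1})"
        using d t by (auto simp: has_deriv_on_unit_interval_def)
      then show "(y has_vector_derivative v x - f x (y x)) (at x within {0..t})"
        unfolding has_real_derivative_iff_has_vector_derivative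
        by (rule has_vector_derivative_within_subset) (use t in auto)
    qed (use t in simp)
    then have "integral {0..t} (\<lambda>t. v t - f t (y t)) = y t - y 0" by (rule integral_unique)
    then have "integral {0..t} v - integral {0..t} (\<lambda>t. f t (y t)) = y t - y 0"
      using integral_diff[OF integrable_on_initial[OF v t] integrable_on_initial[OF fy t]] by simp
    then show "y t = y 0 + integral {0..t} v + 0 * t - integral {0..t} (\<lambda>s. f s (y s))" by simp
  qed
next
  assume i: "integral_sol f (\<lambda>t. integral {0..t} v) (y 0) 0 y"
  then have y: "continuous_on {0..1} y"
    and eq: "\<And>t. t \<in> {0..1} \<Longrightarrow> y t = y 0 + integral {0..t} v - integral {0..t} (\<lambda>s. f s (y s))"
    unfolding integral_sol_def mult_zero_left add_0_right by blast+
  note fy = continuous_on_nonlinearity[OF f continuous_on_id y]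
  show "has_deriv_on_unit_interval y (\<lambda>t. v t - f t (y t))"
    unfolding has_deriv_on_unit_interval_def
  proof
    fix t :: real assume t: "t \<in> {0..1}"
    have "((\<lambda>t. y 0 + integral {0..t} v - integral {0..t} (\<lambda>s. f s (y s))) has_real_derivative
        v t - f t (y t)) (at t within {0..1})"
      using integral_has_real_derivative[OF v t] integral_has_real_derivative[OF fy t]
      by (auto intro!: derivative_eq_intros)
    then show "(y has_real_derivative v t - f t (y t)) (at t within {0..1})"
      by (rule has_field_derivative_transform_within[OF _ zero_less_one t]) (rule eq[symmetric])
  qed
qed

lemma periodic_nonlinearity:
  assumes "periodic f" "periodic u"
  shows "periodic (\<lambda>t. f t (u t))"
  using assms by (simp add: periodic_def)

lemma Rep_Abs_circle_C0:
  assumes "continuous_on UNIV v" "periodic v"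
  shows "Rep_circle_C0 (Abs_circle_C0 v) = v"
  using assms by (intro Abs_circle_C0_inverse) simp

lemma set_integral_continuous:
  fixes v :: "real \<Rightarrow> real"
  assumes "continuous_on {0..1} v"
  shows "(\<integral>t\<in>{0..1}. v t \<partial>lborel) = integral {0..1} v"
  by (rule set_borel_integral_eq_integral(2)[OF borel_integrable_atLeastAtMost'[OF assms]])

lemma Rep_circle_C1_D:
  shows "(Rep_circle_C1 u has_real_derivative Rep_circle_C0 (deriv_C1 u) t) (at t)"
    and "continuous_on A (Rep_circle_C1 u)" and "periodic (Rep_circle_C1 u)"
proof -
  have u: "Rep_circle_C1 u C1_differentiable_on UNIV" "periodic (Rep_circle_C1 u)"
    using Rep_circle_C1[of u] by auto
  show "(Rep_circle_C1 u has_real_derivative Rep_circle_C0 (deriv_C1 u) t) (at t)"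
    using C1_realD(1)[OF u(1)] by (simp add: deriv_C1.rep_eq)
  show "continuous_on A (Rep_circle_C1 u)"
    using C1_realD(3)[OF u(1)] by (rule continuous_on_subset) simp
  show "periodic (Rep_circle_C1 u)" by (rule u(2))
qed

lemma Rep_circle_C1_eqI:
  assumes "\<And>t. t \<in> {0..1} \<Longrightarrow> Rep_circle_C1 u t = Rep_circle_C1 u' t"
  shows "u = u'"
proof -
  have "Rep_circle_C1 u t = Rep_circle_C1 u' t" for t
    using periodic_frac[OF Rep_circle_C1_D(3), of u t] periodic_frac[OF Rep_circle_C1_D(3), of u' t]
      assms[of "frac t"] frac_ge_0[of t] frac_lt_1[of t] by simp
  then show ?thesis by (simp add: Rep_circle_C1_inject[symmetric] fun_eq_iff)
qed

text \<open>The derivative is extended periodically and integrated to \<open>A\<close>. On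
  \<open>[0,1]\<close> the difference \<open>A - y\<close> is constant;
  \<open>A (t + 1) - A t\<close> is constant by periodicity of the integrand, and
  \<open>y 1 = y 0\<close> makes it zero.\<close>

lemma circle_C1_exists:
  assumes y: "\<And>t. t \<in> {0..1} \<Longrightarrow> (y has_real_derivative w t) (at t within {0..1})"
    and w: "continuous_on {0..1} w" "w 0 = w 1" and per: "y 1 = y 0"
  shows "\<exists>u. (\<forall>t\<in>{0..1}. Rep_circle_C1 u t = y t) \<and> (\<forall>t\<in>{0..1}. Rep_circle_C0 (deriv_C1 u) t = w t)"
proof -
  let ?w = "\<lambda>t. w (frac t)"
  have cw: "continuous_on UNIV ?w" by (rule continuous_on_frac_extension[OF w])
  have frac: "?w t = w t" if "t \<in> {0..1}" for t
  proof (cases "t = 1")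
    case False
    then have "frac t = t" using that by (simp add: frac_eq)
    then show ?thesis by simp
  qed (simp add: w(2))
  obtain A where A: "\<And>t. (A has_real_derivative ?w t) (at t)"
    using antiderivative_exists[OF cw] by blast
  have "\<exists>c. \<forall>t\<in>{0..1}. A t - y t = c"
  proof (rule has_field_derivative_zero_constant[OF convex_real_interval(5)])
    fix t :: real assume t: "t \<in> {0..1}"
    show "((\<lambda>t. A t - y t) has_real_derivative 0) (at t within {0..1})"
      using DERIV_diff[OF has_field_derivative_at_within[OF A, of t "{0..1}"] y[OF t]] frac[OF t] by simp
  qed
  then obtain c where c: "\<And>t. t \<in> {0..1} \<Longrightarrow> A t - y t = c" by blast
  have "\<exists>d. \<forall>t\<in>UNIV. A (t + 1) - A t = d"
  proof (rule has_field_derivative_zero_constant[OF convex_UNIV])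
    fix t
    have "((\<lambda>t. A (t + 1)) has_real_derivative ?w (t + 1)) (at t)"
      using A[of "t + 1"] by (simp only: DERIV_shift)
    then show "((\<lambda>t. A (t + 1) - A t) has_real_derivative 0) (at t)"
      using DERIV_diff[OF _ A[of t], of "\<lambda>t. A (t + 1)" "?w (t + 1)"] by (simp add: frac_1_eq)
  qed
  then obtain d where d: "\<And>t. A (t + 1) - A t = d" by blast
  have "d = 0" using d[of 0] c[of 0] c[of 1] per by simp
  define u where "u t = A t - c" for t
  have u: "(u has_real_derivative ?w t) (at t)" for t
    unfolding u_def using A[of t] by (auto intro!: derivative_eq_intros)
  have "u C1_differentiable_on UNIV"
    unfolding C1_differentiable_on_def using u cw
    by (intro exI[of _ ?w]) (simp add: has_real_derivative_iff_has_vector_derivative)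
  moreover have "A (t + 1) = A t" for t using d[of t] \<open>d = 0\<close> by linarith
  then have "periodic u" by (simp add: periodic_def u_def)
  ultimately have rep: "Rep_circle_C1 (Abs_circle_C1 u) = u" by (simp add: Abs_circle_C1_inverse)
  have "deriv u = ?w" by (intro ext DERIV_imp_deriv u)
  then have "Rep_circle_C0 (deriv_C1 (Abs_circle_C1 u)) t = ?w t" for t
    by (simp add: deriv_C1.rep_eq rep)
  moreover have "u t = y t" if "t \<in> {0..1}" for t unfolding u_def using c[OF that] by linarith
  ultimately show ?thesis using rep frac by (intro exI[of _ "Abs_circle_C1 u"]) simp
qed

lemma periodic_0_1: "periodic h \<Longrightarrow> h 1 = h 0"
  unfolding periodic_def by (metis add_0)

lemma Rep_C_F:
  assumes "continuous_on UNIV (\<lambda>(t, s). f t s)" "periodic f"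
  shows "Rep_circle_C0 (C.F f u) t = Rep_circle_C0 (deriv_C1 u) t + f t (Rep_circle_C1 u t)"
proof -
  have "Rep_circle_C0 (Abs_circle_C0 (\<lambda>t. f t (Rep_circle_C1 u t))) = (\<lambda>t. f t (Rep_circle_C1 u t))"
    by (rule Rep_Abs_circle_C0[OF continuous_on_nonlinearity[OF assms(1) continuous_on_id Rep_circle_C1_D(2)]
        periodic_nonlinearity[OF assms(2) Rep_circle_C1_D(3)]])
  then show ?thesis by (simp add: C.F_def plus_circle_C0.rep_eq)
qed

lemma Rep_C_const: "Rep_circle_C0 (C.const c) t = c"
  unfolding C.const_def by (subst Rep_Abs_circle_C0) (auto simp: periodic_def)

interpretation C1: regular_circle_pair Rep_circle_C1 deriv_C1 Rep_circle_C0 Abs_circle_C0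
  has_deriv_on_unit_interval
proof
  fix v :: circle_C0 and u u' :: circle_C1 and f :: "real \<Rightarrow> real \<Rightarrow> real" and y and t a b c :: real
  note cv = Rep_circle_C0_cont
  show "Rep_circle_C0 v integrable_on {0..1}" by (intro integrable_continuous_real cv)
  show "C.mean v = integral {0..1} (Rep_circle_C0 v)"
    unfolding C.mean_def by (rule set_integral_continuous[OF cv])
  show "(\<integral>t\<in>{0..1}. Rep_circle_C1 u t \<partial>lborel) = integral {0..1} (Rep_circle_C1 u)"
    by (rule set_integral_continuous[OF Rep_circle_C1_D(2)])
  show "Rep_circle_C1 u 1 = Rep_circle_C1 u 0" by (rule periodic_0_1[OF Rep_circle_C1_D(3)])
  show "C.const (a + b) = C.const a + C.const b"
    by (simp add: Rep_circle_C0_inject[symmetric] fun_eq_iff plus_circle_C0.rep_eq Rep_C_const)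
  show "u = u'" if "\<And>t. t \<in> {0..1} \<Longrightarrow> Rep_circle_C1 u t = Rep_circle_C1 u' t"
    by (rule Rep_circle_C1_eqI[OF that])
  show "integral {0..t} (Rep_circle_C0 (v + C.const c)) = integral {0..t} (Rep_circle_C0 v) + c * t"
    if "t \<in> {0..1}"
    using that integral_add[OF integrable_on_initial[OF cv that] integrable_const_ivl[of c 0 t]]
    by (simp add: plus_circle_C0.rep_eq[abs_def] Rep_C_const)
  assume f: "continuous_on UNIV (\<lambda>(t, s). f t s)"
  show iff: "has_deriv_on_unit_interval y (\<lambda>t. Rep_circle_C0 v t - f t (y t)) =
      integral_sol f (\<lambda>t. integral {0..t} (Rep_circle_C0 v)) (y 0) 0 y" for v y
    by (rule integral_sol_iff_derivative[OF f cv])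
  assume per: "periodic f"
  show "C.solution f (C.F f u) (Rep_circle_C1 u)"
    unfolding C.solution_def has_deriv_on_unit_interval_def
    using has_field_derivative_at_within[OF Rep_circle_C1_D(1)] by (simp add: Rep_C_F[OF f per])
  assume y: "C.solution f v y" "y 1 = y 0"
  let ?w = "\<lambda>t. Rep_circle_C0 v t - f t (y t)"
  have dy: "\<And>t. t \<in> {0..1} \<Longrightarrow> (y has_real_derivative ?w t) (at t within {0..1})"
    using y(1) by (simp add: C.solution_def has_deriv_on_unit_interval_def)
  have cy: "continuous_on {0..1} y" using dy by (rule DERIV_continuous_on)
  have "continuous_on {0..1} ?w"
    by (intro continuous_intros cv continuous_on_nonlinearity[OF f] cy)
  \<comment> \<open>Periodicity of \<open>v\<close> and \<open>f\<close> makes the derivative match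
    at the endpoints, so that \<open>y\<close> closes up to a continuously differentiable function
    on the circle.\<close>
  moreover have "?w 0 = ?w 1"
    using periodic_0_1[OF Rep_circle_C0_periodic, of v] periodic_0_1[OF per] y(2) by simp
  ultimately obtain u where u: "\<forall>t\<in>{0..1}. Rep_circle_C1 u t = y t"
      "\<forall>t\<in>{0..1}. Rep_circle_C0 (deriv_C1 u) t = ?w t"
    using circle_C1_exists[OF dy _ _ y(2)] by blast
  have *: "Rep_circle_C0 (C.F f u) t = Rep_circle_C0 v t" if "t \<in> {0..1}" for t
    using u that by (simp add: Rep_C_F[OF f per])
  have "Rep_circle_C0 (C.F f u) t = Rep_circle_C0 v t" for t
    using *[of "frac t"] periodic_frac[OF Rep_circle_C0_periodic, of "C.F f u" t]
      periodic_frac[OF Rep_circle_C0_periodic, of v t] frac_ge_0[of t] frac_lt_1[of t] by simp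
  then have "C.F f u = v" by (simp add: Rep_circle_C0_inject[symmetric] fun_eq_iff)
  with u(1) show "\<exists>u. (\<forall>t\<in>{0..1}. Rep_circle_C1 u t = y t) \<and> C.F f u = v" by blast
qed

section \<open>The Sobolev pair\<close>

lemma rep_plus_L2: "AE t\<in>{0..1} in lborel. rep_circle_L2 (v + w) t = rep_circle_L2 v t + rep_circle_L2 w t"
  unfolding plus_L2_abs by (rule rep_abs_L2[OF square_integrable_add[OF square_integrable_rep square_integrable_rep]])

lemma Rep_circle_H1_D:
  shows "continuous_on UNIV (Rep_circle_H1 u)" and "periodic (Rep_circle_H1 u)"
proof -
  show per: "periodic (Rep_circle_H1 u)" by (rule Rep_circle_H1_periodic)
  have "continuous_on UNIV (\<lambda>t. Rep_circle_H1 u (frac t))"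
    by (rule continuous_on_frac_extension[OF has_weak_deriv_continuous[OF has_weak_deriv_H1]])
      (rule periodic_0_1[OF per, symmetric])
  then show "continuous_on UNIV (Rep_circle_H1 u)"
    by (simp only: periodic_frac[OF per, symmetric])
qed

lemma Rep_circle_H1_eqI:
  assumes "\<And>t. t \<in> {0..1} \<Longrightarrow> Rep_circle_H1 u t = Rep_circle_H1 u' t"
  shows "u = u'"
proof -
  have "Rep_circle_H1 u t = Rep_circle_H1 u' t" for t
    using periodic_frac[OF Rep_circle_H1_periodic, of u t] periodic_frac[OF Rep_circle_H1_periodic, of u' t]
      assms[of "frac t"] frac_ge_0[of t] frac_lt_1[of t] by simp
  then show ?thesis by (simp add: Rep_circle_H1_inject[symmetric] fun_eq_iff)
qed

text \<open>The weak derivative is defined by an integral identity, so it remains to split the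
  integral and pass to gauge integrals. Continuity of \<open>y\<close>, available on either side,
  makes the nonlinear term integrable.\<close>

lemma integral_sol_iff_weak_derivative:
  assumes f: "continuous_on UNIV (\<lambda>(t, s). f t s)" and v: "set_integrable lborel {0..1} v"
  shows "has_weak_deriv y (\<lambda>t. v t - f t (y t)) \<longleftrightarrow> integral_sol f (\<lambda>t. integral {0..t} v) (y 0) 0 y"
proof -
  have int: "set_integrable lborel {0..1} (\<lambda>t. v t - f t (y t))"
    and eq: "\<And>t. t \<in> {0..1} \<Longrightarrow>
      (\<integral>s\<in>{0..t}. v s - f s (y s) \<partial>lborel) = integral {0..t} v - integral {0..t} (\<lambda>s. f s (y s))"
    if y: "continuous_on {0..1} y"
  proof -
    have fy: "set_integrable lborel {0..1} (\<lambda>t. f t (y t))"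
      by (rule borel_integrable_atLeastAtMost'[OF continuous_on_nonlinearity[OF f continuous_on_id y]])
    show "set_integrable lborel {0..1} (\<lambda>t. v t - f t (y t))" by (rule set_integral_diff(1)[OF v fy])
    fix t :: real assume t: "t \<in> {0..1}"
    have "set_integrable lborel {0..t} v" "set_integrable lborel {0..t} (\<lambda>s. f s (y s))"
      using t by (auto intro: set_integrable_subset[OF v] set_integrable_subset[OF fy])
    then show "(\<integral>s\<in>{0..t}. v s - f s (y s) \<partial>lborel) = integral {0..t} v - integral {0..t} (\<lambda>s. f s (y s))"
      by (simp only: set_integral_diff(2) set_borel_integral_eq_integral(2))
  qed
  show ?thesis
  proof
    assume d: "has_weak_deriv y (\<lambda>t. v t - f t (y t))"
    have y: "continuous_on {0..1} y" by (rule has_weak_deriv_continuous[OF d])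
    show "integral_sol f (\<lambda>t. integral {0..t} v) (y 0) 0 y"
    proof (rule integral_solI[OF y])
      fix t :: real assume t: "t \<in> {0..1}"
      show "y t = y 0 + integral {0..t} v + 0 * t - integral {0..t} (\<lambda>s. f s (y s))"
        using has_weak_derivD(2)[OF d t] eq[OF y t] by linarith
    qed
  next
    assume i: "integral_sol f (\<lambda>t. integral {0..t} v) (y 0) 0 y"
    then have y: "continuous_on {0..1} y" unfolding integral_sol_def by blast
    show "has_weak_deriv y (\<lambda>t. v t - f t (y t))"
    proof (rule has_weak_derivI[OF int[OF y]])
      fix t :: real assume t: "t \<in> {0..1}"
      have "y t = y 0 + integral {0..t} v + 0 * t - integral {0..t} (\<lambda>s. f s (y s))"
        using i t unfolding integral_sol_def by blast
      then show "y t = y 0 + (\<integral>s\<in>{0..t}. v s - f s (y s) \<partial>lborel)" using eq[OF y t] by linarith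
    qed
  qed
qed

lemma has_weak_deriv_cong:
  assumes "has_weak_deriv y g" "\<And>t. t \<in> {0..1} \<Longrightarrow> z t = y t"
  shows "has_weak_deriv z g"
proof (rule has_weak_derivI[OF has_weak_derivD(1)[OF assms(1)]])
  fix t :: real assume t: "t \<in> {0..1}"
  show "z t = z 0 + (\<integral>s\<in>{0..t}. g s \<partial>lborel)"
    using has_weak_derivD(2)[OF assms(1) t] assms(2)[OF t] assms(2)[of 0] by simp
qed

lemma set_integrable_rep_L2: "set_integrable lborel {0..1} (rep_circle_L2 v)"
  by (rule square_integrable_imp_integrable[OF square_integrable_rep])

lemma rep_H_const: "AE t\<in>{0..1} in lborel. rep_circle_L2 (H.const c) t = c"
  unfolding H.const_def
  by (rule rep_abs_L2[OF square_integrable_continuous]) (auto simp: periodic_def)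

lemma square_integrable_nonlinearity:
  assumes "continuous_on UNIV (\<lambda>(t, s). f t s)" "periodic f" "continuous_on UNIV u" "periodic u"
  shows "square_integrable (\<lambda>t. f t (u t))"
  by (rule square_integrable_continuous[OF continuous_on_nonlinearity[OF assms(1) continuous_on_id assms(3)]
        periodic_nonlinearity[OF assms(2,4)]])

lemma rep_H_F:
  assumes "continuous_on UNIV (\<lambda>(t, s). f t s)" "periodic f"
  shows "AE t\<in>{0..1} in lborel. rep_circle_L2 (H.F f u) t =
    rep_circle_L2 (deriv_H1 u) t + f t (Rep_circle_H1 u t)"
  unfolding H.F_def
  using rep_plus_L2[of "deriv_H1 u" "abs_circle_L2 (\<lambda>t. f t (Rep_circle_H1 u t))"]
    rep_abs_L2[OF square_integrable_nonlinearity[OF assms Rep_circle_H1_D, of u]]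
  by eventually_elim auto

interpretation H1: regular_circle_pair Rep_circle_H1 deriv_H1 rep_circle_L2 abs_circle_L2 has_weak_deriv
proof
  fix v :: circle_L2 and u u' :: circle_H1 and f :: "real \<Rightarrow> real \<Rightarrow> real" and y and t a b c :: real
  have cu: "continuous_on {0..1} (Rep_circle_H1 u)" for u
    by (rule has_weak_deriv_continuous[OF has_weak_deriv_H1])
  show "rep_circle_L2 v integrable_on {0..1}"
    by (rule set_borel_integral_eq_integral(1)[OF set_integrable_rep_L2])
  show "H.mean v = integral {0..1} (rep_circle_L2 v)"
    unfolding H.mean_def by (rule set_borel_integral_eq_integral(2)[OF set_integrable_rep_L2])
  show "(\<integral>t\<in>{0..1}. Rep_circle_H1 u t \<partial>lborel) = integral {0..1} (Rep_circle_H1 u)"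
    by (rule set_integral_continuous[OF cu])
  show "Rep_circle_H1 u 1 = Rep_circle_H1 u 0" by (rule periodic_0_1[OF Rep_circle_H1_periodic])
  show "H.const (a + b) = H.const a + H.const b"
  proof (rule circle_L2_eqI)
    show "AE t\<in>{0..1} in lborel. rep_circle_L2 (H.const (a + b)) t = rep_circle_L2 (H.const a + H.const b) t"
      using rep_H_const[of "a + b"] rep_H_const[of a] rep_H_const[of b] rep_plus_L2[of "H.const a" "H.const b"]
      by eventually_elim auto
  qed
  show "u = u'" if "\<And>t. t \<in> {0..1} \<Longrightarrow> Rep_circle_H1 u t = Rep_circle_H1 u' t"
    by (rule Rep_circle_H1_eqI[OF that])
  show "integral {0..t} (rep_circle_L2 (v + H.const c)) = integral {0..t} (rep_circle_L2 v) + c * t"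
    if t: "t \<in> {0..1}"
  proof -
    have int: "set_integrable lborel {0..t} (rep_circle_L2 w)" for w
      using t by (intro set_integrable_subset[OF set_integrable_rep_L2]) auto
    have intc: "set_integrable lborel {0..t} (\<lambda>_. c)"
      by (rule borel_integrable_atLeastAtMost') (rule continuous_on_const)
    have meas: "rep_circle_L2 w \<in> borel_measurable borel" for w
      using square_integrable_rep[of w] by (simp add: square_integrable_def)
    \<comment> \<open>Representatives of sums and constants are known only almost everywhere, which
      is enough under the integral.\<close>
    have "AE s\<in>{0..1} in lborel. rep_circle_L2 (v + H.const c) s = rep_circle_L2 v s + c"
      using rep_H_const[of c] rep_plus_L2[of v "H.const c"] by eventually_elim auto
    then have "AE s\<in>{0..t} in lborel. rep_circle_L2 (v + H.const c) s = rep_circle_L2 v s + c"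
      by eventually_elim (use t in auto)
    then have "(\<integral>s\<in>{0..t}. rep_circle_L2 (v + H.const c) s \<partial>lborel) = (\<integral>s\<in>{0..t}. rep_circle_L2 v s + c \<partial>lborel)"
      using meas by (intro set_lebesgue_integral_cong_AE) auto
    also have "\<dots> = (\<integral>s\<in>{0..t}. rep_circle_L2 v s \<partial>lborel) + (\<integral>s\<in>{0..t}. c \<partial>lborel)"
      by (rule set_integral_add(2)[OF int intc])
    finally show ?thesis
      using t by (simp add: set_borel_integral_eq_integral(2)[OF int] set_borel_integral_eq_integral(2)[OF intc])
  qed
  assume f: "continuous_on UNIV (\<lambda>(t, s). f t s)"
  show "has_weak_deriv y (\<lambda>t. rep_circle_L2 v t - f t (y t)) =
      integral_sol f (\<lambda>t. integral {0..t} (rep_circle_L2 v)) (y 0) 0 y"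
    by (rule integral_sol_iff_weak_derivative[OF f set_integrable_rep_L2])
  assume per: "periodic f"
  show "H.solution f (H.F f u) (Rep_circle_H1 u)"
    unfolding H.solution_def
  proof (rule has_weak_deriv_cong_AE[OF has_weak_deriv_H1])
    show "set_integrable lborel {0..1} (\<lambda>t. rep_circle_L2 (H.F f u) t - f t (Rep_circle_H1 u t))"
      by (rule set_integral_diff(1)[OF set_integrable_rep_L2
            borel_integrable_atLeastAtMost'[OF continuous_on_nonlinearity[OF f continuous_on_id cu]]])
    show "AE t\<in>{0..1} in lborel. rep_circle_L2 (deriv_H1 u) t =
        rep_circle_L2 (H.F f u) t - f t (Rep_circle_H1 u t)"
      using rep_H_F[OF f per, of u] by eventually_elim auto
  qed
  assume y: "H.solution f v y" "y 1 = y 0"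
  let ?u = "\<lambda>t. y (frac t)"
  have y': "has_weak_deriv y (\<lambda>t. rep_circle_L2 v t - f t (y t))" using y(1) by (simp add: H.solution_def)
  have frac: "?u t = y t" if "t \<in> {0..1}" for t
  proof (cases "t = 1")
    case False
    then have "frac t = t" using that by (simp add: frac_eq)
    then show ?thesis by simp
  qed (simp add: y(2))
  have cu: "continuous_on UNIV ?u"
    by (rule continuous_on_frac_extension[OF has_weak_deriv_continuous[OF y'] y(2)[symmetric]])
  \<comment> \<open>The derivative is written as a sum with a multiple by \<open>-1\<close> to use
    closure of square-integrable functions; the periodic extension of \<open>y\<close> makes it a
    function on the circle.\<close>
  let ?w = "\<lambda>t. rep_circle_L2 v t + (-1) * f t (?u t)"
  note fu = square_integrable_nonlinearity[OF f per cu periodic_frac_extension]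
  have sq: "square_integrable ?w"
    by (rule square_integrable_add[OF square_integrable_rep square_integrable_cmult[OF fu]])
  have "has_weak_deriv ?u (\<lambda>t. rep_circle_L2 v t - f t (y t))"
    by (rule has_weak_deriv_cong[OF y']) (rule frac)
  then have "has_weak_deriv ?u ?w"
  proof (rule has_weak_deriv_cong_AE)
    show "set_integrable lborel {0..1} ?w" by (rule square_integrable_imp_integrable[OF sq])
    show "AE t\<in>{0..1} in lborel. rep_circle_L2 v t - f t (y t) = ?w t"
      by (rule AE_I2) (simp add: frac)
  qed
  from has_weak_deriv_abs_L2[OF this sq]
  have d: "has_weak_deriv ?u (rep_circle_L2 (abs_circle_L2 ?w))" .
  define u where "u = Abs_circle_H1 ?u"
  have rep: "Rep_circle_H1 u = ?u"
    unfolding u_def using d periodic_frac_extension by (intro Abs_circle_H1_inverse) blast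
  have D: "deriv_H1 u = abs_circle_L2 ?w"
    by (rule deriv_H1_eqI) (simp only: rep d)
  have "H.F f u = v"
  proof (rule circle_L2_eqI)
    show "AE t\<in>{0..1} in lborel. rep_circle_L2 (H.F f u) t = rep_circle_L2 v t"
      using rep_H_F[OF f per, of u, unfolded D rep] rep_abs_L2[OF sq] by eventually_elim auto
  qed
  then show "\<exists>u. (\<forall>t\<in>{0..1}. Rep_circle_H1 u t = y t) \<and> H.F f u = v"
    using frac by (intro exI[of _ u]) (simp add: rep)
qed

theorem proposition2p3:
  fixes f :: "real \<Rightarrow> real \<Rightarrow> real"
  assumes "smooth_on_cylinder f" and "tame f"
  shows "(regular_value (C.mean_D2 f) 0 \<longrightarrow>
          (\<forall>(u :: circle_C1) v. v = C.F f u \<longrightarrow>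
            (let u0 = Rep_circle_C1 u 0; \<rho> = C.return_map f v in
              u0 \<in> C.return_domain f v \<and> \<rho> u0 = u0 \<and>
              (u \<in> C.S f 1 \<longleftrightarrow> deriv \<rho> u0 = 1) \<and>
              (\<forall>k\<ge>2. u \<in> C.S f k \<longleftrightarrow>
                deriv \<rho> u0 = 1 \<and> (\<forall>i\<in>{2..k}. (deriv ^^ i) \<rho> u0 = 0)))))
       \<and> (regular_value (H.mean_D2 f) 0 \<longrightarrow>
          (\<forall>(u :: circle_H1) v. v = H.F f u \<longrightarrow>
            (let u0 = Rep_circle_H1 u 0; \<rho> = H.return_map f v in
              u0 \<in> H.return_domain f v \<and> \<rho> u0 = u0 \<and>
              (u \<in> H.S f 1 \<longleftrightarrow> deriv \<rho> u0 = 1) \<and>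
              (\<forall>k\<ge>2. u \<in> H.S f k \<longleftrightarrow>
                deriv \<rho> u0 = 1 \<and> (\<forall>i\<in>{2..k}. (deriv ^^ i) \<rho> u0 = 0)))))"
  \<comment> \<open>For \<open>k = 1\<close> the range \<open>{2..k}\<close> is empty, which leaves
    the condition on the first derivative.\<close>
  using C1.S_iff_return_map[OF assms(1)] H1.S_iff_return_map[OF assms(1)]
  by (simp add: Let_def)

end
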